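(* For every hereditary and extendable graph property $\mathcal{P}$ there is a function $s_{\mathcal{P}}:(0,1)\to\mathbb{N}$ such that the following holds for every $\varepsilon\in(0,1)$ and every vertex-weighted graph $(G,\mathcal{D})$ which is $\varepsilon$-far from $\mathcal{P}$. Let $u_1,\dots,u_s$, with $s=s_{\mathcal{P}}(\varepsilon)$, be a sequence of random vertices of $G$, sampled independently according to $\mathcal{D}$. Then with probability at least $\frac{2}{3}$, the induced subgraph $G[\{u_1,\dots,u_s\}]$ does not satisfy $\mathcal{P}$.
   Context: All graphs are finite, simple, undirected, with nonempty vertex set. A graph property is a family of graphs closed under isomorphism. $\mathcal{P}$ is hereditary if it is closed under removal of vertices. $\mathcal{P}$ is extendable if for every graph $G$ satisfying $\mathcal{P}$ there is a graph on $|V(G)|+1$ vertices which satisfies $\mathcal{P}$ and contains $G$ as an induced subgraph. A vertex-weighted graph is a pair $(G,\mathcal{D})$ with $G$ a graph and $\mathcal{D}$ a probability distribution on $V(G)$ (weight $0$ is allowed). For graphs $G_1,G_2$ on the same vertex set $V$ and a distribution $\mathcal{D}$ on $V$, their distance with respect to $\mathcal{D}$ is $\sum_{\{x,y\}\in E(G_1)\triangle E(G_2)}\mathcal{D}(x)\mathcal{D}(y)$. $(G,\mathcal{D})$ is $\varepsilon$-far from $\mathcal{P}$ if for every $G'\in\mathcal{P}$ with $V(G')=V(G)$ the distance between $G$ and $G'$ with respect to $\mathcal{D}$ is at least $\varepsilon$ (vacuously true if no such $G'$ exists). $\{u_1,\dots,u_s\}$ denotes the set of distinct sampled vertices (repetitions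 are discarded). *)

theory Defs
  imports
    "HOL-Probability.Probability"
    "HOL-Library.Infinite_Typeclass"
    "HOL-Library.Ramsey"
begin

record 'a ugraph =
  verts :: "'a set"
  edges :: "'a set set"

definition is_graph :: "'a ugraph \<Rightarrow> bool" where
  "is_graph G \<longleftrightarrow> finite (verts G) \<and> verts G \<noteq> {} \<and> edges G \<subseteq> nsets (verts G) 2"

definition graph_iso :: "'a ugraph \<Rightarrow> 'a ugraph \<Rightarrow> bool" where
  "graph_iso G H \<longleftrightarrow>
     (\<exists>f. bij_betw f (verts G) (verts H) \<and>
        (\<forall>x\<in>verts G. \<forall>y\<in>verts G. {x, y} \<in> edges G \<longleftrightarrow> {f x, f y} \<in> edges H))"

definition induced_subgraph :: "'a ugraph \<Rightarrow> 'a set \<Rightarrow> 'a ugraph" where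
  "induced_subgraph G W =
     \<lparr>verts = verts G \<inter> W, edges = {e \<in> edges G. e \<subseteq> W}\<rparr>"

text \<open>
  Vertices are drawn from one fixed type. It will be taken infinite: then it contains an
  isomorphic copy of every finite graph, and every finite vertex set can be enlarged by a
  new vertex.
\<close>

definition graph_property :: "'a ugraph set \<Rightarrow> bool" where
  "graph_property P \<longleftrightarrow>
     (\<forall>G\<in>P. is_graph G) \<and>
     (\<forall>G\<in>P. \<forall>H. is_graph H \<and> graph_iso G H \<longrightarrow> H \<in> P)"

text \<open>Not all vertices may be removed, as graphs have a nonempty vertex set.\<close>

definition hereditary :: "'a ugraph set \<Rightarrow> bool" where
  "hereditary P \<longleftrightarrow>
     (\<forall>G\<in>P. \<forall>X. verts G - X \<noteq> {} \<longrightarrow> induced_subgraph G (verts G - X) \<in> P)"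

definition extendable :: "'a ugraph set \<Rightarrow> bool" where
  "extendable P \<longleftrightarrow>
     (\<forall>G\<in>P. \<exists>H\<in>P. card (verts H) = card (verts G) + 1 \<and>
        verts G \<subseteq> verts H \<and> induced_subgraph H (verts G) = G)"

definition weighted_graph :: "'a ugraph \<Rightarrow> 'a pmf \<Rightarrow> bool" where
  "weighted_graph G D \<longleftrightarrow> is_graph G \<and> set_pmf D \<subseteq> verts G"

text \<open>Edges are two-element sets, so the inner product for \<open>e = {x, y}\<close> is
  \<open>pmf D x * pmf D y\<close>.\<close>

definition graph_dist :: "'a pmf \<Rightarrow> 'a ugraph \<Rightarrow> 'a ugraph \<Rightarrow> real" where
  "graph_dist D G1 G2 = (\<Sum>e\<in>sym_diff (edges G1) (edges G2). \<Prod>x\<in>e. pmf D x)"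

definition eps_far :: "real \<Rightarrow> 'a ugraph \<Rightarrow> 'a pmf \<Rightarrow> 'a ugraph set \<Rightarrow> bool" where
  "eps_far \<epsilon> G D P \<longleftrightarrow>
     (\<forall>G'\<in>P. verts G' = verts G \<longrightarrow> graph_dist D G G' \<ge> \<epsilon>)"

text \<open>
  The law of \<open>n\<close> independent samples \<open>u 0, \<dots>, u (n - 1)\<close> from \<open>D\<close>; outside \<open>{..<n}\<close>
  the function \<open>u\<close> takes the irrelevant constant value \<open>undefined\<close>.
\<close>

definition iid_samples :: "nat \<Rightarrow> 'a pmf \<Rightarrow> (nat \<Rightarrow> 'a) pmf" where
  "iid_samples n D = Pi_pmf {..<n} undefined (\<lambda>_. D)"

end

theory Submission imports Defs begin

text \<open>
  The argument is by compactness. If no sample size works for some \<open>\<epsilon>\<close>, there are \<open>\<epsilon>\<close>-far weighted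
  graphs \<open>G\<^sub>n\<close> in which a random tuple induces any fixed \<open>F \<notin> P\<close> with probability tending to \<open>0\<close>
  (a sample contains many disjoint tuples). Nested weakly regular partitions of the \<open>G\<^sub>n\<close>, which also
  single out the heaviest vertices one by one, converge along a subsequence to a limit kernel \<open>WL\<close> on
  a probability space \<open>M\<close>, and by counting almost every tuple of points of \<open>M\<close> sees no forbidden \<open>F\<close>.

  As in the proof of Lovasz and Szegedy for graphons, a graph in \<open>P\<close> close to \<open>G\<^sub>n\<close> is obtained by
  sending each vertex to a random point of its cell in \<open>M\<close> and flipping only those pairs whose
  colour has density exactly \<open>0\<close> in the limit at the chosen points. This requires distinct
  points not to lie in one atom of \<open>M\<close>, and cells of positive measure; the few vertices violating this
  are dropped and put back by extendability.
\<close>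

section \<open>Weak regularity in finite weighted sets\<close>

text \<open>Graphs have no loops, so inside one class the densities of edges and non-edges may add
  up to less than 1. For this reason the two colours are carried as separate kernels throughout. The
  defect is harmless in a class of light vertices. A single vertex whose weight does not vanish,
  however, becomes a block of positive measure in \<open>M\<close> on which both limit densities are
  0. Two vertices sent into such a block would have no colour left for their pair, so heavy vertices
  need blocks of their own and no two vertices may share one.

  Asking for density exactly 0, not merely small, leaves only colours of positive density. If all
  pairs of a graph have positive density at almost surely chosen points, the graph cannot be
  forbidden, whatever its size, so an infinite family of forbidden graphs needs no extra care. The
  flips are cheap because the step densities tend to 0 in mean on the zero set of their limit. This
  fixes the order of choices: the level \<open>m\<close> comes from the limit alone, and
  \<open>n\<close> is chosen afterwards.\<close>

locale weighted_set =
  fixes V :: "'v set" and d :: "'v \<Rightarrow> real"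
  assumes fin: "finite V" and d_nonneg: "d v \<ge> 0" and d_sum: "sum d V = 1"
begin

definition mass :: "('v \<Rightarrow> nat) \<Rightarrow> nat \<Rightarrow> real" where
  "mass c i = (\<Sum>v | v \<in> V \<and> c v = i. d v)"

text \<open>On classes of mass \<open>0\<close> the average is \<open>0\<close>, by \<open>x / 0 = 0\<close>.\<close>

definition avg :: "('v \<Rightarrow> nat) \<Rightarrow> ('v \<Rightarrow> real) \<Rightarrow> 'v \<Rightarrow> real" where
  "avg c f v = (\<Sum>w | w \<in> V \<and> c w = c v. d w * f w) / mass c (c v)"

definition bil :: "('v \<Rightarrow> 'v \<Rightarrow> real) \<Rightarrow> ('v \<Rightarrow> real) \<Rightarrow> ('v \<Rightarrow> real) \<Rightarrow> real" where
  "bil A f h = (\<Sum>w\<in>V. d w * h w * (\<Sum>v\<in>V. d v * f v * A v w))"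

text \<open>The index of the partition for the kernel averaged in its first argument only. Each
  column is then projected separately, with \<open>w\<close> as a mere parameter.\<close>

definition energy :: "('v \<Rightarrow> 'v \<Rightarrow> real) \<Rightarrow> ('v \<Rightarrow> nat) \<Rightarrow> real" where
  "energy A c = (\<Sum>w\<in>V. d w * (\<Sum>v\<in>V. d v * (avg c (\<lambda>v. A v w) v)\<^sup>2))"

definition refines :: "('v \<Rightarrow> nat) \<Rightarrow> ('v \<Rightarrow> nat) \<Rightarrow> bool" where
  "refines c' c \<longleftrightarrow> (\<exists>\<theta>. \<forall>v\<in>V. c v = \<theta> (c' v))"

text \<open>Weak regularity in the cut norm, one-sided. The tests are functions into [0, 1] and not
  only sets, because counting produces such functions and because \<open>avg c' f\<close> itself
  serves as a test function in \<open>good_refine\<close>.\<close>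

definition good :: "('v \<Rightarrow> 'v \<Rightarrow> real) \<Rightarrow> ('v \<Rightarrow> nat) \<Rightarrow> real \<Rightarrow> bool" where
  "good A c \<delta> \<longleftrightarrow> (\<forall>f h. range f \<subseteq> {0..1} \<longrightarrow> range h \<subseteq> {0..1} \<longrightarrow>
     \<bar>bil A f h - bil A (avg c f) h\<bar> \<le> \<delta>)"

lemma mass_nonneg: "mass c i \<ge> 0"
  unfolding mass_def by (intro sum_nonneg d_nonneg)

lemma class_sum_eq_0:
  assumes "mass c i = 0"
  shows "(\<Sum>w | w \<in> V \<and> c w = i. d w * f w) = 0"
proof -
  have "\<forall>w\<in>{w \<in> V. c w = i}. d w = 0"
    using assms unfolding mass_def by (subst (asm) sum_nonneg_eq_0_iff) (auto simp: fin d_nonneg)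
  then show ?thesis by (intro sum.neutral) auto
qed

text \<open>\<open>avg c\<close> is the orthogonal projection, with respect to the weights
  \<open>d\<close>, onto the functions of the class; this is its defining identity. A class of mass
  0 contributes 0 to both sides, whatever default the quotient takes.\<close>

lemma avg_inner: "(\<Sum>v\<in>V. d v * F (c v) * avg c f v) = (\<Sum>v\<in>V. d v * F (c v) * f v)"
proof -
  have "(\<Sum>v\<in>V. d v * F (c v) * avg c f v)
      = (\<Sum>i\<in>c ` V. \<Sum>v | v \<in> V \<and> c v = i. d v * F (c v) * avg c f v)"
    by (rule sum.image_gen[OF fin])
  also have "\<dots> = (\<Sum>i\<in>c ` V. \<Sum>v | v \<in> V \<and> c v = i. d v * F (c v) * f v)"
  proof (rule sum.cong[OF refl])
    fix i
    have "(\<Sum>v | v \<in> V \<and> c v = i. d v * F (c v) * avg c f v)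
        = (\<Sum>v | v \<in> V \<and> c v = i. d v * (F i * ((\<Sum>w | w \<in> V \<and> c w = i. d w * f w) / mass c i)))"
      by (intro sum.cong) (auto simp: avg_def)
    also have "\<dots> = mass c i * (F i * ((\<Sum>w | w \<in> V \<and> c w = i. d w * f w) / mass c i))"
      unfolding mass_def sum_distrib_right ..
    also have "\<dots> = F i * (\<Sum>w | w \<in> V \<and> c w = i. d w * f w)"
      using class_sum_eq_0[of c i f] by (cases "mass c i = 0") auto
    also have "\<dots> = (\<Sum>v | v \<in> V \<and> c v = i. d v * F (c v) * f v)"
      by (auto simp: sum_distrib_left intro!: sum.cong)
    finally show "(\<Sum>v | v \<in> V \<and> c v = i. d v * F (c v) * avg c f v)
        = (\<Sum>v | v \<in> V \<and> c v = i. d v * F (c v) * f v)" .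
  qed
  also have "\<dots> = (\<Sum>v\<in>V. d v * F (c v) * f v)"
    by (rule sum.image_gen[OF fin, symmetric])
  finally show ?thesis .
qed

lemma avg_factor: "\<exists>F. avg c f = (\<lambda>v. F (c v))"
  by (rule exI[of _ "\<lambda>i. (\<Sum>w | w \<in> V \<and> c w = i. d w * f w) / mass c i"])
     (auto simp: avg_def)

lemma avg_inner':
  assumes "\<And>v. v \<in> V \<Longrightarrow> g v = F (c v)"
  shows "(\<Sum>v\<in>V. d v * g v * avg c f v) = (\<Sum>v\<in>V. d v * g v * f v)"
  using avg_inner[of F c f] assms by (simp cong: sum.cong)

lemma avg_self_adjoint: "(\<Sum>v\<in>V. d v * f v * avg c g v) = (\<Sum>v\<in>V. d v * avg c f v * g v)"
proof -
  obtain F G where FG: "avg c f = (\<lambda>v. F (c v))" "avg c g = (\<lambda>v. G (c v))"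
    using avg_factor by metis
  have "(\<Sum>v\<in>V. d v * avg c f v * avg c g v) = (\<Sum>v\<in>V. d v * avg c f v * g v)"
    using FG by (intro avg_inner'[where F = F]) auto
  moreover have "(\<Sum>v\<in>V. d v * avg c g v * avg c f v) = (\<Sum>v\<in>V. d v * avg c g v * f v)"
    using FG by (intro avg_inner'[where F = G]) auto
  ultimately show ?thesis by (simp add: mult_ac)
qed

lemma avg_range:
  assumes "range f \<subseteq> {0..1}"
  shows "range (avg c f) \<subseteq> {0..1}"
proof -
  have f: "0 \<le> f w" "f w \<le> 1" for w using assms by (auto simp: image_subset_iff)
  have "0 \<le> avg c f v" for v
    unfolding avg_def by (intro divide_nonneg_nonneg sum_nonneg mult_nonneg_nonneg d_nonneg f mass_nonneg)
  moreover have "avg c f v \<le> 1" for v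
  proof -
    have "(\<Sum>w | w \<in> V \<and> c w = c v. d w * f w) \<le> mass c (c v)"
      unfolding mass_def by (intro sum_mono) (simp add: mult_left_le d_nonneg f)
    then show ?thesis unfolding avg_def using mass_nonneg[of c "c v"]
      by (cases "mass c (c v) = 0") (auto simp: divide_le_eq)
  qed
  ultimately show ?thesis by auto
qed

text \<open>Pythagoras: as \<open>c'\<close> is finer, \<open>avg c f\<close> is a function of the
  classes of \<open>c'\<close>, so \<open>avg c f\<close> is the projection of
  \<open>avg c' f\<close> as well as of \<open>f\<close>.\<close>

lemma avg_tower:
  assumes "refines c' c"
  shows "(\<Sum>v\<in>V. d v * (avg c' f v - avg c f v)\<^sup>2)
    = (\<Sum>v\<in>V. d v * (avg c' f v)\<^sup>2) - (\<Sum>v\<in>V. d v * (avg c f v)\<^sup>2)"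
proof -
  obtain F where F: "avg c f = (\<lambda>v. F (c v))" using avg_factor by metis
  obtain \<theta> where \<theta>: "\<forall>v\<in>V. c v = \<theta> (c' v)" using assms unfolding refines_def by auto
  have 1: "(\<Sum>v\<in>V. d v * avg c f v * avg c' f v) = (\<Sum>v\<in>V. d v * avg c f v * f v)"
    using \<theta> F by (intro avg_inner'[where F = "\<lambda>i. F (\<theta> i)"]) auto
  have 2: "(\<Sum>v\<in>V. d v * avg c f v * avg c f v) = (\<Sum>v\<in>V. d v * avg c f v * f v)"
    using F by (intro avg_inner'[where F = F]) auto
  have "(\<Sum>v\<in>V. d v * (avg c' f v - avg c f v)\<^sup>2)
     = (\<Sum>v\<in>V. d v * (avg c' f v)\<^sup>2) - 2 * (\<Sum>v\<in>V. d v * avg c f v * avg c' f v)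
       + (\<Sum>v\<in>V. d v * avg c f v * avg c f v)"
    by (simp add: power2_eq_square algebra_simps sum.distrib sum_subtractf sum_distrib_left)
  then show ?thesis using 1 2 by (simp add: power2_eq_square algebra_simps)
qed

lemma energy_diff:
  assumes "refines c' c"
  shows "energy A c' - energy A c
    = (\<Sum>w\<in>V. d w * (\<Sum>v\<in>V. d v * (avg c' (\<lambda>v. A v w) v - avg c (\<lambda>v. A v w) v)\<^sup>2))"
  unfolding energy_def avg_tower[OF assms] by (simp add: sum_subtractf right_diff_distrib)

lemma energy_mono:
  assumes "refines c' c"
  shows "energy A c \<le> energy A c'"
proof -
  have "energy A c' - energy A c \<ge> 0"
    unfolding energy_diff[OF assms] by (intro sum_nonneg mult_nonneg_nonneg d_nonneg zero_le_power2)
  then show ?thesis by simp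
qed

lemma weighted_sum_le_1:
  assumes "\<And>v. v \<in> V \<Longrightarrow> f v \<le> 1"
  shows "(\<Sum>v\<in>V. d v * f v) \<le> 1"
proof -
  have "(\<Sum>v\<in>V. d v * f v) \<le> (\<Sum>v\<in>V. d v * 1)"
    using assms by (intro sum_mono mult_left_mono d_nonneg) auto
  then show ?thesis by (simp add: d_sum)
qed

lemma energy_le_1:
  assumes "\<And>v w. A v w \<in> {0..1}"
  shows "energy A c \<le> 1"
proof -
  have "avg c (\<lambda>v. A v w) v \<in> {0..1}" for v w
    using avg_range[of "\<lambda>v. A v w" c] assms by (auto simp: image_subset_iff)
  then show ?thesis unfolding energy_def
    by (intro weighted_sum_le_1) (simp add: power_le_one)
qed

lemma energy_nonneg: "energy A c \<ge> 0"
  unfolding energy_def by (intro sum_nonneg mult_nonneg_nonneg d_nonneg zero_le_power2)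

lemma bil_avg_left: "bil A (avg c f) h = (\<Sum>w\<in>V. d w * h w * (\<Sum>v\<in>V. d v * f v * avg c (\<lambda>v. A v w) v))"
  unfolding bil_def avg_self_adjoint ..

lemma weighted_Cauchy_Schwarz:
  fixes p :: "'b \<Rightarrow> real"
  assumes "\<And>x. x \<in> X \<Longrightarrow> p x \<ge> 0" "(\<Sum>x\<in>X. p x * (f x)\<^sup>2) \<le> 1"
  shows "(\<Sum>x\<in>X. p x * f x * g x)\<^sup>2 \<le> (\<Sum>x\<in>X. p x * (g x)\<^sup>2)"
proof -
  have "(\<Sum>x\<in>X. p x * f x * g x)\<^sup>2 = (\<Sum>x\<in>X. (sqrt (p x) * f x) * (sqrt (p x) * g x))\<^sup>2"
  proof (intro arg_cong[where f = "\<lambda>t. t\<^sup>2"] sum.cong refl)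
    fix x assume "x \<in> X"
    then have "p x * f x * g x = (sqrt (p x) * sqrt (p x)) * (f x * g x)" using assms(1) by simp
    then show "p x * f x * g x = (sqrt (p x) * f x) * (sqrt (p x) * g x)"
      by (simp only: mult_ac)
  qed
  also have "\<dots> \<le> (\<Sum>x\<in>X. (sqrt (p x) * f x)\<^sup>2) * (\<Sum>x\<in>X. (sqrt (p x) * g x)\<^sup>2)"
    by (rule Cauchy_Schwarz_ineq_sum)
  also have "\<dots> = (\<Sum>x\<in>X. p x * (f x)\<^sup>2) * (\<Sum>x\<in>X. p x * (g x)\<^sup>2)"
    using assms(1) by (auto simp: power_mult_distrib intro!: arg_cong2[where f = "(*)"] sum.cong)
  also have "\<dots> \<le> 1 * (\<Sum>x\<in>X. p x * (g x)\<^sup>2)"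
    using assms by (intro mult_right_mono sum_nonneg) auto
  finally show ?thesis by simp
qed

text \<open>As \<open>s\<close> depends only on the class of \<open>c'\<close>, the kernel may be
  replaced by its average over \<open>c'\<close>. What remains is the difference of two averages of
  the kernel, whose squared norm is the energy gain, paired with \<open>h w * s v\<close>, whose
  norm is at most 1.\<close>

lemma energy_increment:
  assumes c: "refines c' c"
    and s: "\<And>v. v \<in> V \<Longrightarrow> s v = \<sigma> (c' v)" "range s \<subseteq> {0..1}"
    and h: "range h \<subseteq> {0..1}"
  shows "(bil A s h - bil A (avg c s) h)\<^sup>2 \<le> energy A c' - energy A c"
proof -
  define g where "g w v = avg c' (\<lambda>v. A v w) v - avg c (\<lambda>v. A v w) v" for w v
  have "bil A s h = (\<Sum>w\<in>V. d w * h w * (\<Sum>v\<in>V. d v * s v * avg c' (\<lambda>v. A v w) v))"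
    unfolding bil_def using avg_inner'[of s \<sigma> c'] s by (intro sum.cong refl) auto
  then have "bil A s h - bil A (avg c s) h = (\<Sum>w\<in>V. d w * h w * (\<Sum>v\<in>V. d v * s v * g w v))"
    unfolding bil_avg_left g_def by (simp add: algebra_simps sum_subtractf)
  also have "\<dots> = (\<Sum>w\<in>V. \<Sum>v\<in>V. (d w * d v) * (h w * s v) * g w v)"
    by (simp add: sum_distrib_left mult_ac)
  also have "\<dots> = (\<Sum>(w, v)\<in>V \<times> V. (d w * d v) * (h w * s v) * g w v)"
    by (simp add: sum.cartesian_product)
  finally have eq: "bil A s h - bil A (avg c s) h
    = (\<Sum>x\<in>V \<times> V. (d (fst x) * d (snd x)) * (h (fst x) * s (snd x)) * g (fst x) (snd x))"
    by (simp add: case_prod_beta)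
  have le: "(\<Sum>x\<in>V \<times> V. (d (fst x) * d (snd x)) * (h (fst x) * s (snd x))\<^sup>2) \<le> 1"
  proof -
    have "h w * s v \<in> {0..1}" for w v using h s(2) by (auto simp: image_subset_iff intro: mult_le_one)
    then have "(\<Sum>w\<in>V. d w * (\<Sum>v\<in>V. d v * (h w * s v)\<^sup>2)) \<le> 1"
      by (intro weighted_sum_le_1) (simp add: power_le_one)
    then show ?thesis
      by (simp add: sum_distrib_left sum.cartesian_product case_prod_beta mult_ac)
  qed
  have "(bil A s h - bil A (avg c s) h)\<^sup>2
      \<le> (\<Sum>x\<in>V \<times> V. (d (fst x) * d (snd x)) * (g (fst x) (snd x))\<^sup>2)"
    unfolding eq by (intro weighted_Cauchy_Schwarz le) (simp add: d_nonneg)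
  also have "\<dots> = energy A c' - energy A c"
    unfolding energy_diff[OF c] g_def
    by (simp add: sum_distrib_left sum.cartesian_product case_prod_beta mult_ac)
  finally show ?thesis .
qed

text \<open>For fixed \<open>h\<close> the error is linear in \<open>f\<close>, hence extremal at the indicator of a set.\<close>

lemma good_if_energy_stable:
  assumes "\<And>S. \<exists>c' \<sigma>. refines c' c \<and> (\<forall>v\<in>V. indicator S v = (\<sigma> (c' v) :: real))
     \<and> energy A c' - energy A c \<le> \<eta>"
  shows "good A c (sqrt \<eta>)"
proof -
  have *: "\<bar>bil A (indicator S) h - bil A (avg c (indicator S)) h\<bar> \<le> sqrt \<eta>"
    if "range h \<subseteq> {0..1}" for S h
  proof -
    obtain c' \<sigma> where c': "refines c' c" "\<forall>v\<in>V. indicator S v = (\<sigma> (c' v) :: real)"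
      "energy A c' - energy A c \<le> \<eta>"
      using assms by metis
    have "(bil A (indicator S) h - bil A (avg c (indicator S)) h)\<^sup>2 \<le> energy A c' - energy A c"
      using c' that by (intro energy_increment[where \<sigma> = \<sigma>]) (auto simp: indicator_def)
    then show ?thesis using c'(3) real_sqrt_le_mono[of _ \<eta>] by (fastforce simp flip: real_sqrt_abs)
  qed
  have "\<bar>bil A f h - bil A (avg c f) h\<bar> \<le> sqrt \<eta>"
    if f: "range f \<subseteq> {0..1}" and h: "range h \<subseteq> {0..1}" for f h
  proof -
    define g where "g v = (\<Sum>w\<in>V. d w * h w * (A v w - avg c (\<lambda>v. A v w) v))" for v
    have L: "bil A f h - bil A (avg c f) h = (\<Sum>v\<in>V. d v * g v * f v)" for f
    proof -
      have "bil A f h - bil A (avg c f) h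
         = (\<Sum>w\<in>V. d w * h w * (\<Sum>v\<in>V. d v * f v * (A v w - avg c (\<lambda>v. A v w) v)))"
        unfolding bil_avg_left unfolding bil_def by (simp add: algebra_simps sum_subtractf)
      also have "\<dots> = (\<Sum>v\<in>V. d v * g v * f v)"
        unfolding g_def sum_distrib_left sum_distrib_right by (subst sum.swap) (simp add: mult_ac)
      finally show ?thesis .
    qed
    have fv: "0 \<le> f v" "f v \<le> 1" for v using f by (auto simp: image_subset_iff)
    have "bil A f h - bil A (avg c f) h
        \<le> bil A (indicator {v. g v > 0}) h - bil A (avg c (indicator {v. g v > 0})) h"
      unfolding L
    proof (intro sum_mono)
      fix v
      have "g v * f v \<le> g v * indicator {v. g v > 0} v"
        using fv[of v] by (cases "g v > 0") (auto simp: indicator_def mult_nonpos_nonneg)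
      then show "d v * g v * f v \<le> d v * g v * indicator {v. g v > 0} v"
        using mult_left_mono[OF _ d_nonneg] by (simp add: mult.assoc)
    qed
    moreover have "bil A f h - bil A (avg c f) h
        \<ge> bil A (indicator {v. g v < 0}) h - bil A (avg c (indicator {v. g v < 0})) h"
      unfolding L
    proof (intro sum_mono)
      fix v
      have "g v * f v \<ge> g v * indicator {v. g v < 0} v"
        using fv[of v] by (cases "g v < 0") (auto simp: indicator_def)
      then show "d v * g v * f v \<ge> d v * g v * indicator {v. g v < 0} v"
        using mult_left_mono[OF _ d_nonneg] by (simp add: mult.assoc)
    qed
    ultimately show ?thesis
      using *[OF h, of "{v. g v > 0}"] *[OF h, of "{v. g v < 0}"] by linarith
  qed
  then show ?thesis unfolding good_def by blast
qed

text \<open>The averages of \<open>f\<close> and of \<open>avg c' f\<close> over the coarser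
  \<open>c\<close> agree, so passing through them costs one error for each of the two functions. The
  energy argument only yields some good level below \<open>m\<close>; this lemma carries it up to
  \<open>m\<close>.\<close>

lemma good_refine:
  assumes c: "refines c' c" and g: "good A c \<delta>"
  shows "good A c' (2 * \<delta>)"
  unfolding good_def
proof (intro allI impI)
  obtain \<theta> where \<theta>: "\<forall>v\<in>V. c v = \<theta> (c' v)" using c unfolding refines_def by auto
  fix f h :: "'v \<Rightarrow> real" assume f: "range f \<subseteq> {0..1}" and h: "range h \<subseteq> {0..1}"
  have "bil A (avg c (avg c' f)) h = bil A (avg c f) h"
  proof -
    have "(\<Sum>v\<in>V. d v * avg c' f v * avg c k v) = (\<Sum>v\<in>V. d v * f v * avg c k v)" for k
    proof -
      obtain F where F: "avg c k = (\<lambda>v. F (c v))" using avg_factor by metis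
      have "(\<Sum>v\<in>V. d v * avg c k v * avg c' f v) = (\<Sum>v\<in>V. d v * avg c k v * f v)"
        using F \<theta> by (intro avg_inner'[where F = "\<lambda>i. F (\<theta> i)"]) auto
      then show ?thesis by (simp add: mult_ac)
    qed
    then show ?thesis unfolding bil_avg_left by simp
  qed
  moreover have "\<bar>bil A f h - bil A (avg c f) h\<bar> \<le> \<delta>"
    using g f h unfolding good_def by blast
  moreover have "\<bar>bil A (avg c' f) h - bil A (avg c (avg c' f)) h\<bar> \<le> \<delta>"
    using g avg_range[OF f, of c'] h unfolding good_def by blast
  ultimately show "\<bar>bil A f h - bil A (avg c' f) h\<bar> \<le> 2 * \<delta>" by linarith
qed

section \<open>Two-sided averages and densities of pairs of classes\<close>

definition emass :: "('v \<Rightarrow> 'v \<Rightarrow> real) \<Rightarrow> ('v \<Rightarrow> nat) \<Rightarrow> nat \<Rightarrow> nat \<Rightarrow> real" where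
  "emass A c i j = (\<Sum>w | w \<in> V \<and> c w = j. \<Sum>v | v \<in> V \<and> c v = i. d w * d v * A v w)"

definition dens :: "('v \<Rightarrow> 'v \<Rightarrow> real) \<Rightarrow> ('v \<Rightarrow> nat) \<Rightarrow> nat \<Rightarrow> nat \<Rightarrow> real" where
  "dens A c i j = emass A c i j / (mass c i * mass c j)"

lemma bil_sym:
  assumes "\<And>v w. A v w = A w v"
  shows "bil A f h = bil A h f"
proof -
  have "bil A f h = (\<Sum>w\<in>V. \<Sum>v\<in>V. (d w * h w) * (d v * f v * A v w))"
    by (simp add: bil_def sum_distrib_left)
  also have "\<dots> = (\<Sum>v\<in>V. \<Sum>w\<in>V. (d w * h w) * (d v * f v * A v w))"
    by (rule sum.swap)
  also have "\<dots> = (\<Sum>v\<in>V. \<Sum>w\<in>V. (d v * f v) * (d w * h w * A w v))"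
  proof (intro sum.cong refl)
    fix v w
    show "(d w * h w) * (d v * f v * A v w) = (d v * f v) * (d w * h w * A w v)"
      unfolding assms[of v w] by (simp only: mult_ac)
  qed
  finally show ?thesis by (simp add: bil_def sum_distrib_left)
qed

text \<open>Self-adjointness moves both averages from the test functions to the kernel, and a kernel
  averaged in both arguments is the step function of densities.\<close>

lemma bil_avg_avg: "bil A (avg c f) (avg c h) = bil (\<lambda>v w. dens A c (c v) (c w)) f h"
proof -
  have "bil A (avg c f) (avg c h)
      = (\<Sum>w\<in>V. d w * avg c h w * (\<Sum>v\<in>V. d v * f v * avg c (\<lambda>v. A v w) v))"
    by (rule bil_avg_left)
  also have "\<dots> = (\<Sum>w\<in>V. d w * h w * avg c (\<lambda>w. \<Sum>v\<in>V. d v * f v * avg c (\<lambda>v. A v w) v) w)"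
    by (rule avg_self_adjoint[symmetric])
  also have "avg c (\<lambda>w. \<Sum>v\<in>V. d v * f v * avg c (\<lambda>v. A v w) v)
      = (\<lambda>w. \<Sum>v\<in>V. d v * f v * dens A c (c v) (c w))"
  proof
    fix w
    have "avg c (\<lambda>w. \<Sum>v\<in>V. d v * f v * avg c (\<lambda>v. A v w) v) w
      = (\<Sum>v\<in>V. d v * f v * (\<Sum>w' | w' \<in> V \<and> c w' = c w. d w' * avg c (\<lambda>v. A v w') v) / mass c (c w))"
    proof -
      have "(\<Sum>w' | w' \<in> V \<and> c w' = c w. d w' * (\<Sum>v\<in>V. d v * f v * avg c (\<lambda>v. A v w') v))
        = (\<Sum>w' | w' \<in> V \<and> c w' = c w. \<Sum>v\<in>V. d v * f v * (d w' * avg c (\<lambda>v. A v w') v))"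
        unfolding sum_distrib_left by (intro sum.cong refl) (simp only: mult_ac)
      also have "\<dots> = (\<Sum>v\<in>V. \<Sum>w' | w' \<in> V \<and> c w' = c w. d v * f v * (d w' * avg c (\<lambda>v. A v w') v))"
        by (rule sum.swap)
      finally show ?thesis
        unfolding avg_def[of c _ w] by (simp only: sum_distrib_left sum_divide_distrib)
    qed
    also have "\<dots> = (\<Sum>v\<in>V. d v * f v * dens A c (c v) (c w))"
    proof (intro sum.cong refl)
      fix v
      have "(\<Sum>w' | w' \<in> V \<and> c w' = c w. d w' * avg c (\<lambda>v. A v w') v)
        = emass A c (c v) (c w) / mass c (c v)"
        by (simp add: avg_def emass_def sum_divide_distrib sum_distrib_left mult.assoc)
      then show "d v * f v * (\<Sum>w' | w' \<in> V \<and> c w' = c w. d w' * avg c (\<lambda>v. A v w') v) / mass c (c w)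
        = d v * f v * dens A c (c v) (c w)"
        by (simp add: dens_def)
    qed
    finally show "avg c (\<lambda>w. \<Sum>v\<in>V. d v * f v * avg c (\<lambda>v. A v w) v) w = (\<Sum>v\<in>V. d v * f v * dens A c (c v) (c w))" .
  qed
  finally show ?thesis unfolding bil_def .
qed

text \<open>By symmetry of \<open>A\<close> the one-sided estimate also applies to the second
  argument, with \<open>avg c f\<close> as the other test function. Hence two errors.\<close>

lemma good_imp_close:
  assumes "good A c \<delta>" "\<And>v w. A v w = A w v" "range f \<subseteq> {0..1}" "range h \<subseteq> {0..1}"
  shows "\<bar>bil A f h - bil (\<lambda>v w. dens A c (c v) (c w)) f h\<bar> \<le> 2 * \<delta>"
proof -
  have "\<bar>bil A f h - bil A (avg c f) h\<bar> \<le> \<delta>" using assms unfolding good_def by blast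
  moreover have "\<bar>bil A h (avg c f) - bil A (avg c h) (avg c f)\<bar> \<le> \<delta>"
    using assms(1,4) avg_range[OF assms(3), of c] unfolding good_def by blast
  ultimately show ?thesis
    unfolding bil_avg_avg[symmetric]
    using bil_sym[of A h "avg c f", OF assms(2)] bil_sym[of A "avg c h" "avg c f", OF assms(2)]
    by linarith
qed

end

section \<open>Nested partitions\<close>

text \<open>
  A cell at level \<open>m\<close> is a number below \<open>4 ^ m\<close>, and its children are \<open>4 * i + r\<close> with \<open>r < 4\<close>. The
  upper bit of \<open>r\<close> marks one heavy vertex, the lower bit a set chosen to increase the energy most.
\<close>

definition atom :: "nat \<Rightarrow> bool" where "atom i \<longleftrightarrow> i mod 4 \<ge> 2"

lemma div_pow_chain:
  fixes c :: "nat \<Rightarrow> nat"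
  assumes "\<And>m. c (Suc m) div 4 = c m" "k \<le> m"
  shows "c k = c m div 4 ^ (m - k)"
  using assms(2)
proof (induction m)
  case (Suc m)
  show ?case
  proof (cases "k \<le> m")
    case True
    then have "c k = c (Suc m) div 4 div 4 ^ (m - k)" using Suc assms(1) by simp
    then show ?thesis using True by (simp add: Suc_diff_le div_mult2_eq)
  next
    case False
    then show ?thesis using Suc by (simp add: le_Suc_eq)
  qed
qed auto

lemma code_less:
  fixes c :: "nat \<Rightarrow> nat"
  assumes "\<And>m. c (Suc m) div 4 = c m" "c 0 = 0"
  shows "c m < 4 ^ m"
proof -
  have "0 = c m div 4 ^ m" using div_pow_chain[of c 0 m] assms by simp
  then show ?thesis by (simp add: div_eq_0_iff)
qed

context weighted_set begin

text \<open>In an order of decreasing weight, a vertex not among the first \<open>m\<close> is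
  preceded by \<open>m\<close> vertices at least as heavy, and the total weight is 1.\<close>

lemma descending_enumeration:
  obtains xs where "set xs = V" "distinct xs"
    "\<And>m v. v \<in> V \<Longrightarrow> (\<forall>k<m. k < length xs \<longrightarrow> xs ! k \<noteq> v) \<Longrightarrow> real m * d v \<le> 1"
proof -
  obtain ys where ys: "set ys = V" "distinct ys" using finite_distinct_list[OF fin] by blast
  \<comment> \<open>The sign turns the ascending sort into a descending one.\<close>
  define xs where "xs = sort_key (\<lambda>v. - d v) ys"
  have xs: "set xs = V" "distinct xs" using ys by (auto simp: xs_def)
  have srt: "sorted (map (\<lambda>v. - d v) xs)" by (simp add: xs_def)
  have "real m * d v \<le> 1" if v: "v \<in> V" "\<forall>k<m. k < length xs \<longrightarrow> xs ! k \<noteq> v" for m v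
  proof -
    obtain l where l: "l < length xs" "xs ! l = v" using v xs(1) by (metis in_set_conv_nth)
    then have ml: "m \<le> l" using v(2) l by (metis not_le_imp_less)
    have "d v \<le> d (xs ! k)" if "k < m" for k
      using sorted_nth_mono[OF srt, of k l] that ml l by simp
    then have "real m * d v \<le> (\<Sum>k<m. d (xs ! k))"
      using sum_bounded_below[of "{..<m}" "d v" "\<lambda>k. d (xs ! k)"] by simp
    also have "\<dots> = sum d ((!) xs ` {..<m})"
      using ml l xs(2) by (subst sum.reindex) (auto simp: inj_on_def nth_eq_iff_index_eq)
    also have "\<dots> \<le> sum d V"
      using ml l xs(1) by (intro sum_mono2 fin) (auto simp: d_nonneg)
    finally show ?thesis by (simp add: d_sum)
  qed
  then show ?thesis using that xs by blast
qed

text \<open>Each level splits greedily by the set that raises the energy most. The total energy lies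
  between 0 and 2, so one of the first \<open>m\<close> steps gains at most \<open>2 / m\<close>. At
  that level no set could have gained more, which gives error \<open>sqrt (2 / m)\<close>; refining
  it to level \<open>m\<close> doubles the error.\<close>

lemma exists_code:
  fixes A :: "bool \<Rightarrow> 'v \<Rightarrow> 'v \<Rightarrow> real"
  assumes A: "\<And>b v w. A b v w \<in> {0..1}"
  shows "\<exists>c :: nat \<Rightarrow> 'v \<Rightarrow> nat. (\<forall>v. c 0 v = 0) \<and> (\<forall>m v. c (Suc m) v div 4 = c m v) \<and>
    (\<forall>m. \<forall>v w. atom (c (Suc m) v) \<longrightarrow> atom (c (Suc m) w) \<longrightarrow> v = w) \<and>
    (\<forall>v m k. atom (c (Suc m) v) \<longrightarrow> atom (c (Suc k) v) \<longrightarrow> m = k) \<and>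
    (\<forall>m. \<forall>v\<in>V. (\<forall>k<m. \<not> atom (c (Suc k) v)) \<longrightarrow> real m * d v \<le> 1) \<and>
    (\<forall>m>0. \<forall>b. good (A b) (c m) (2 * sqrt (2 / real m)))"
proof -
  obtain xs where xs: "set xs = V" "distinct xs"
    "\<And>m v. v \<in> V \<Longrightarrow> (\<forall>k<m. k < length xs \<longrightarrow> xs ! k \<noteq> v) \<Longrightarrow> real m * d v \<le> 1"
    using descending_enumeration by blast
  define step :: "nat \<Rightarrow> ('v \<Rightarrow> nat) \<Rightarrow> 'v set \<Rightarrow> 'v \<Rightarrow> nat" where
    "step m c S v = 4 * c v + (if m < length xs \<and> xs ! m = v then 2 else 0) + (if v \<in> S then 1 else 0)"
    for m c S v
  \<comment> \<open>The two energies are added so that a single partition is regular for both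
    colours.\<close>
  define \<Phi> where "\<Phi> c = energy (A True) c + energy (A False) c" for c
  have "\<exists>c. \<forall>m. (m = 0 \<longrightarrow> c m = (\<lambda>_. 0)) \<and>
     (\<exists>S. c (Suc m) = step m (c m) S \<and> (\<forall>S'\<in>Pow V. \<Phi> (step m (c m) S') \<le> \<Phi> (c (Suc m))))"
  proof (rule dependent_nat_choice)
    fix c :: "'v \<Rightarrow> nat" and m
    let ?X = "(\<lambda>S. \<Phi> (step m c S)) ` Pow V"
    have "Max ?X \<in> ?X" using fin by (intro Max_in) auto
    then obtain S where "\<Phi> (step m c S) = Max ?X" by (metis imageE)
    then have "\<forall>S'\<in>Pow V. \<Phi> (step m c S') \<le> \<Phi> (step m c S)" using fin by simp
    then show "\<exists>y. (Suc m = 0 \<longrightarrow> y = (\<lambda>_. 0)) \<and> (\<exists>S. y = step m c S \<and>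
        (\<forall>S'\<in>Pow V. \<Phi> (step m c S') \<le> \<Phi> y))" by blast
  qed auto
  then obtain c where c0: "c 0 = (\<lambda>_. 0)"
    and c: "\<And>m. \<exists>S. c (Suc m) = step m (c m) S \<and> (\<forall>S'\<in>Pow V. \<Phi> (step m (c m) S') \<le> \<Phi> (c (Suc m)))"
    by metis
  have div4: "c (Suc m) v div 4 = c m v" for m v
    using c[of m] by (auto simp: step_def)
  have atom: "atom (c (Suc m) v) \<longleftrightarrow> m < length xs \<and> xs ! m = v" for m v
  proof -
    have *: "(4 * k + (if p then 2 else 0) + (if q then 1 else 0)) mod 4
        = (if p then 2 else 0) + (if q then 1 else (0 :: nat))" for k p q
      by (cases p; cases q; simp only: if_True if_False; presburger)
    obtain S where "c (Suc m) = step m (c m) S" using c by blast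
    then show ?thesis unfolding atom_def step_def * by simp
  qed
  have ref: "refines (c m) (c k)" if "k \<le> m" for k m
    unfolding refines_def
    using div_pow_chain[of "\<lambda>m. c m v" k m for v, OF div4 that]
    by (intro exI[of _ "\<lambda>i. i div 4 ^ (m - k)"]) auto
  have good: "good (A b) (c m) (2 * sqrt (2 / real m))" if "m > 0" for m b
  proof -
    have "(\<Sum>k<m. \<Phi> (c (Suc k)) - \<Phi> (c k)) = \<Phi> (c m) - \<Phi> (c 0)"
      by (rule sum_lessThan_telescope)
    also have "\<dots> \<le> 2"
      using energy_le_1[of "A True" "c m", OF A] energy_le_1[of "A False" "c m", OF A]
        energy_nonneg[of "A True" "c 0"] energy_nonneg[of "A False" "c 0"]
      unfolding \<Phi>_def by linarith
    finally have s: "(\<Sum>k<m. \<Phi> (c (Suc k)) - \<Phi> (c k)) \<le> 2" .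
    have "\<exists>k<m. \<Phi> (c (Suc k)) - \<Phi> (c k) \<le> 2 / m"
    proof (rule ccontr)
      assume "\<not> ?thesis"
      then have "(\<Sum>k<m. 2 / real m) < (\<Sum>k<m. \<Phi> (c (Suc k)) - \<Phi> (c k))"
        using that by (intro sum_strict_mono) auto
      then show False using s that by simp
    qed
    then obtain k where k: "k < m" "\<Phi> (c (Suc k)) - \<Phi> (c k) \<le> 2 / m" by blast
    have "good (A b) (c k) (sqrt (2 / m))"
    proof (rule good_if_energy_stable)
      fix S
      \<comment> \<open>The competitor splits off the same heavy vertex as \<open>c (Suc k)\<close>
        does, so the maximality of the latter applies to it. Intersecting with \<open>V\<close>
        makes it one of the admissible choices.\<close>
      let ?c' = "step k (c k) (S \<inter> V)"
      have r: "refines ?c' (c k)"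
        unfolding refines_def by (intro exI[of _ "\<lambda>i. i div 4"]) (auto simp: step_def)
      have "indicator S v = (if ?c' v mod 2 = 1 then 1 else 0 :: real)" if "v \<in> V" for v
      proof -
        have "?c' v mod 2 = (if v \<in> S then 1 else 0)"
        proof -
          have *: "(4 * k + (if p then 2 else 0) + (if q then 1 else 0)) mod 2 = (if q then 1 else (0 :: nat))" for k p q
            by (cases p; cases q; simp only: if_True if_False; presburger)
          show ?thesis unfolding step_def * using that by simp
        qed
        then show ?thesis by (simp add: indicator_def)
      qed
      \<comment> \<open>The energy of the other colour does not drop under refinement, so the gain
        of one colour is at most the gain of the sum.\<close>
      moreover have "energy (A b) ?c' - energy (A b) (c k) \<le> 2 / m"
      proof -
        have "\<Phi> ?c' \<le> \<Phi> (c (Suc k))" using c[of k] by auto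
        moreover have "energy (A b) (c k) \<le> energy (A b) ?c'" for b by (rule energy_mono[OF r])
        ultimately show ?thesis using k(2) unfolding \<Phi>_def by (cases b) (smt (verit))+
      qed
      ultimately show "\<exists>c' \<sigma>. refines c' (c k) \<and> (\<forall>v\<in>V. indicator S v = (\<sigma> (c' v) :: real)) \<and>
          energy (A b) c' - energy (A b) (c k) \<le> 2 / m"
        using r by (intro exI[of _ ?c'] exI[of _ "\<lambda>i. if i mod 2 = 1 then 1 else 0"]) auto
    qed
    then show ?thesis using good_refine[OF ref[of k m]] k(1) by simp
  qed
  show ?thesis
  proof (intro exI[of _ c] conjI allI ballI impI)
    fix m k v
    assume "atom (c (Suc m) v)" "atom (c (Suc k) v)"
    then show "m = k" using xs(2) unfolding atom by (metis nth_eq_iff_index_eq)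
  qed (use c0 div4 good xs(3) atom in auto)
qed

section \<open>Counting\<close>

text \<open>A homomorphism density with one kernel per pair. Choosing the edge or the non-edge
  kernel for each pair makes it an induced density. \<open>R\<close> lists each unordered pair in
  one direction only.\<close>

definition hom :: "'i set \<Rightarrow> ('i \<times> 'i) set \<Rightarrow> ('i \<times> 'i \<Rightarrow> 'v \<Rightarrow> 'v \<Rightarrow> real) \<Rightarrow> real" where
  "hom I R K = (\<Sum>\<phi>\<in>PiE I (\<lambda>_. V). (\<Prod>i\<in>I. d (\<phi> i)) * (\<Prod>p\<in>R. K p (\<phi> (fst p)) (\<phi> (snd p))))"

lemma sum_PiE_insert:
  fixes g :: "('i \<Rightarrow> 'v) \<Rightarrow> real"
  assumes "a \<notin> J"
  shows "(\<Sum>\<phi>\<in>PiE (insert a J) (\<lambda>_. V). g \<phi>) = (\<Sum>x\<in>V. \<Sum>\<psi>\<in>PiE J (\<lambda>_. V). g (\<psi>(a := x)))"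
proof -
  have "(\<Sum>\<phi>\<in>PiE (insert a J) (\<lambda>_. V). g \<phi>) = (\<Sum>(x, \<psi>)\<in>V \<times> PiE J (\<lambda>_. V). g (\<psi>(a := x)))"
    unfolding PiE_insert_eq
    by (subst sum.reindex[OF inj_combinator[OF assms]]) (simp add: case_prod_beta)
  then show ?thesis by (simp add: sum.cartesian_product)
qed

text \<open>With the images of all vertices except the two ends of \<open>p\<close> held fixed, the
  other factors split into a function of the image of \<open>a\<close> and a function of the image
  of \<open>b\<close>, both with values in [0, 1]. The inner sum is then \<open>bil B\<close> of
  these two functions.\<close>

lemma counting_step:
  fixes L :: "'i \<times> 'i \<Rightarrow> 'v \<Rightarrow> 'v \<Rightarrow> real"
  assumes I: "finite I" "R \<subseteq> I \<times> I" and R: "\<And>a b. (a, b) \<in> R \<Longrightarrow> (b, a) \<notin> R"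
    and p: "p \<in> R" and L: "\<And>q v w. L q v w \<in> {0..1}"
    and close: "\<And>f h. range f \<subseteq> {0..1} \<Longrightarrow> range h \<subseteq> {0..1} \<Longrightarrow> \<bar>bil B f h\<bar> \<le> \<delta>"
  shows "\<bar>hom I R (L(p := B))\<bar> \<le> \<delta>"
proof -
  obtain a b where ab: "p = (a, b)" by (cases p)
  have [simp]: "a \<noteq> b" "b \<noteq> a" using R p ab by auto
  define J where "J = I - {a, b}"
  have IJ: "I = insert a (insert b J)" "a \<notin> insert b J" "b \<notin> J" "finite J"
    using I p ab by (auto simp: J_def)
  have finR: "finite R" using I finite_subset by blast
  \<comment> \<open>The pairs that meet \<open>b\<close>. They avoid \<open>a\<close>, since
    \<open>p\<close> is the only pair of \<open>R\<close> joining the two; the pairs in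
    \<open>R1\<close> avoid \<open>b\<close>.\<close>
  define R2 where "R2 = {q \<in> R - {p}. fst q = b \<or> snd q = b}"
  define R1 where "R1 = R - {p} - R2"
  have R12: "R - {p} = R1 \<union> R2" "R1 \<inter> R2 = {}" "finite R1" "finite R2"
    using finR by (auto simp: R1_def R2_def)
  have R1b: "fst q \<noteq> b" "snd q \<noteq> b" if "q \<in> R1" for q using that by (auto simp: R1_def R2_def)
  have R2a: "fst q \<noteq> a" "snd q \<noteq> a" if "q \<in> R2" for q
    using that R p ab by (cases q; auto simp: R2_def)+
  define e where "e Q \<phi> = (\<Prod>q\<in>Q. L q (\<phi> (fst q)) (\<phi> (snd q)))"
    for Q and \<phi> :: "'i \<Rightarrow> 'v"
  have e01: "e Q \<phi> \<in> {0..1}" for Q \<phi>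
    using L unfolding e_def by (auto intro!: prod_nonneg prod_le_1)
  have sum1: "(\<Sum>\<psi>\<in>PiE J (\<lambda>_. V). \<Prod>i\<in>J. d (\<psi> i)) = 1"
    using prod_sum_PiE[OF IJ(4), of "\<lambda>_. V" "\<lambda>_. d"] fin d_sum by simp
  have "hom I R (L(p := B)) = (\<Sum>x\<in>V. \<Sum>y\<in>V. \<Sum>\<psi>\<in>PiE J (\<lambda>_. V).
      (\<Prod>i\<in>I. d ((\<psi>(b := y, a := x)) i)) *
      (\<Prod>q\<in>R. (L(p := B)) q ((\<psi>(b := y, a := x)) (fst q)) ((\<psi>(b := y, a := x)) (snd q))))"
    unfolding hom_def IJ(1) sum_PiE_insert[OF IJ(2)] sum_PiE_insert[OF IJ(3)] ..
  also have "\<dots> = (\<Sum>x\<in>V. \<Sum>y\<in>V. \<Sum>\<psi>\<in>PiE J (\<lambda>_. V).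
      (\<Prod>i\<in>J. d (\<psi> i)) * (d x * d y * B x y * e R1 (\<psi>(a := x)) * e R2 (\<psi>(b := y))))"
  proof (intro sum.cong refl)
    fix x y and \<psi> :: "'i \<Rightarrow> 'v"
    let ?\<phi> = "\<psi>(b := y, a := x)"
    have "(\<Prod>i\<in>I. d (?\<phi> i)) = d x * (d y * (\<Prod>i\<in>J. d (?\<phi> i)))"
      unfolding IJ(1) using IJ by simp
    also have "(\<Prod>i\<in>J. d (?\<phi> i)) = (\<Prod>i\<in>J. d (\<psi> i))"
      using IJ by (intro prod.cong) auto
    finally have 1: "(\<Prod>i\<in>I. d (?\<phi> i)) = d x * (d y * (\<Prod>i\<in>J. d (\<psi> i)))" .
    have "(\<Prod>q\<in>R. (L(p := B)) q (?\<phi> (fst q)) (?\<phi> (snd q)))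
        = B x y * (\<Prod>q\<in>R - {p}. (L(p := B)) q (?\<phi> (fst q)) (?\<phi> (snd q)))"
      by (subst prod.remove[OF finR p]) (simp add: ab)
    also have "(\<Prod>q\<in>R - {p}. (L(p := B)) q (?\<phi> (fst q)) (?\<phi> (snd q))) = e (R - {p}) ?\<phi>"
      unfolding e_def by (intro prod.cong) auto
    also have "\<dots> = e R1 ?\<phi> * e R2 ?\<phi>"
      unfolding e_def R12(1) using R12 by (intro prod.union_disjoint) auto
    also have "e R1 ?\<phi> = e R1 (\<psi>(a := x))"
      unfolding e_def using R1b by (intro prod.cong refl) auto
    also have "e R2 ?\<phi> = e R2 (\<psi>(b := y))"
      unfolding e_def using R2a by (intro prod.cong refl) auto
    finally show "(\<Prod>i\<in>I. d (?\<phi> i)) * (\<Prod>q\<in>R. (L(p := B)) q (?\<phi> (fst q)) (?\<phi> (snd q))) =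
      (\<Prod>i\<in>J. d (\<psi> i)) * (d x * d y * B x y * e R1 (\<psi>(a := x)) * e R2 (\<psi>(b := y)))"
      unfolding 1 by (simp only: mult_ac)
  qed
  also have "\<dots> = (\<Sum>\<psi>\<in>PiE J (\<lambda>_. V). (\<Prod>i\<in>J. d (\<psi> i)) *
      (\<Sum>y\<in>V. \<Sum>x\<in>V. d x * d y * B x y * e R1 (\<psi>(a := x)) * e R2 (\<psi>(b := y))))"
    unfolding sum_distrib_left
    by (subst sum.swap, subst (2) sum.swap, subst (1) sum.swap) (rule refl)
  also have "\<dots> = (\<Sum>\<psi>\<in>PiE J (\<lambda>_. V). (\<Prod>i\<in>J. d (\<psi> i)) *
      bil B (\<lambda>x. e R1 (\<psi>(a := x))) (\<lambda>y. e R2 (\<psi>(b := y))))"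
    unfolding bil_def sum_distrib_left
    by (intro sum.cong refl) (simp only: mult_ac)
  finally have eq: "hom I R (L(p := B)) = \<dots>" .
  have "\<bar>hom I R (L(p := B))\<bar> \<le> (\<Sum>\<psi>\<in>PiE J (\<lambda>_. V). (\<Prod>i\<in>J. d (\<psi> i)) * \<delta>)"
    unfolding eq
  proof (rule order_trans[OF sum_abs sum_mono])
    fix \<psi> :: "'i \<Rightarrow> 'v"
    have "\<bar>bil B (\<lambda>x. e R1 (\<psi>(a := x))) (\<lambda>y. e R2 (\<psi>(b := y)))\<bar> \<le> \<delta>"
      using e01 by (intro close) auto
    then show "\<bar>(\<Prod>i\<in>J. d (\<psi> i)) * bil B (\<lambda>x. e R1 (\<psi>(a := x))) (\<lambda>y. e R2 (\<psi>(b := y)))\<bar>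
        \<le> (\<Prod>i\<in>J. d (\<psi> i)) * \<delta>"
      unfolding abs_mult using d_nonneg by (auto simp: abs_of_nonneg prod_nonneg intro!: mult_left_mono)
  qed
  also have "\<dots> = \<delta>" using sum1 by (simp flip: sum_distrib_right)
  finally show ?thesis .
qed

lemma hom_upd_diff:
  assumes "finite R" "p \<in> R"
  shows "hom I R (L(p := B)) - hom I R (L(p := B')) = hom I R (L(p := (\<lambda>v w. B v w - B' v w)))"
proof -
  have *: "(\<Prod>q\<in>R. (L(p := B)) q (\<phi> (fst q)) (\<phi> (snd q)))
    = B (\<phi> (fst p)) (\<phi> (snd p)) * (\<Prod>q\<in>R - {p}. L q (\<phi> (fst q)) (\<phi> (snd q)))" for B \<phi>
    by (subst prod.remove[OF assms]) (auto intro!: prod.cong)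
  show ?thesis unfolding hom_def * by (simp add: algebra_simps flip: sum_subtractf)
qed

lemma bil_diff_kernel: "bil (\<lambda>v w. B v w - B' v w) f h = bil B f h - bil B' f h"
  unfolding bil_def by (simp add: algebra_simps sum_subtractf)

text \<open>The kernels are exchanged one pair at a time. The density is linear in each kernel, so
  every exchange costs at most \<delta>.\<close>

lemma counting:
  fixes K K' :: "'i \<times> 'i \<Rightarrow> 'v \<Rightarrow> 'v \<Rightarrow> real"
  assumes I: "finite I" "R \<subseteq> I \<times> I" and R: "\<And>a b. (a, b) \<in> R \<Longrightarrow> (b, a) \<notin> R"
    and K: "\<And>q v w. K q v w \<in> {0..1}" "\<And>q v w. K' q v w \<in> {0..1}"
    and close: "\<And>q f h. range f \<subseteq> {0..1} \<Longrightarrow> range h \<subseteq> {0..1} \<Longrightarrow> \<bar>bil (K q) f h - bil (K' q) f h\<bar> \<le> \<delta>"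
  shows "\<bar>hom I R K - hom I R K'\<bar> \<le> real (card R) * \<delta>"
proof -
  have finR: "finite R" using I finite_subset by blast
  have "\<bar>hom I R K - hom I R (\<lambda>q. if q \<in> T then K' q else K q)\<bar> \<le> real (card T) * \<delta>" if "T \<subseteq> R" for T
    using finite_subset[OF that finR] that
  proof (induction T rule: finite_induct)
    case (insert p T)
    let ?L = "\<lambda>q. if q \<in> T then K' q else K q"
    have h1: "hom I R (?L(p := K p)) - hom I R (?L(p := K' p))
      = hom I R (?L(p := (\<lambda>v w. K p v w - K' p v w)))"
      using insert finR by (intro hom_upd_diff) auto
    have h2: "\<bar>hom I R (?L(p := (\<lambda>v w. K p v w - K' p v w)))\<bar> \<le> \<delta>"
      using insert.prems K by (intro counting_step I R) (auto simp: bil_diff_kernel intro!: close)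
    have h3: "?L(p := K p) = ?L" using insert by auto
    have h4: "?L(p := K' p) = (\<lambda>q. if q \<in> insert p T then K' q else K q)" by auto
    have h5: "\<bar>hom I R K - hom I R ?L\<bar> \<le> real (card T) * \<delta>" using insert by auto
    have "\<bar>hom I R K - hom I R (\<lambda>q. if q \<in> insert p T then K' q else K q)\<bar> \<le> real (card T) * \<delta> + \<delta>"
      using h2[folded h1, unfolded h3 h4] h5 by linarith
    then show ?case using insert by (simp add: algebra_simps)
  qed simp
  from this[of R] have "\<bar>hom I R K - hom I R (\<lambda>q. if q \<in> R then K' q else K q)\<bar> \<le> real (card R) * \<delta>" by simp
  moreover have "hom I R (\<lambda>q. if q \<in> R then K' q else K q) = hom I R K'"
    unfolding hom_def by (intro sum.cong arg_cong2[where f = "(*)"] prod.cong) auto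
  ultimately show ?thesis by simp
qed

text \<open>Maps are grouped by the classes of their values. The resulting finite sum no longer
  mentions vertices, so it can be compared with the limit space; \<open>integral_PiM_step\<close>
  yields the same sum there.\<close>

lemma hom_step_kernel:
  assumes "finite I" "\<And>v. v \<in> V \<Longrightarrow> c v < N" "R \<subseteq> I \<times> I"
  shows "hom I R (\<lambda>q v w. g q (c v) (c w))
    = (\<Sum>\<iota>\<in>PiE I (\<lambda>_. {..<N}). (\<Prod>i\<in>I. mass c (\<iota> i)) * (\<Prod>q\<in>R. g q (\<iota> (fst q)) (\<iota> (snd q))))"
proof -
  let ?S = "\<lambda>\<iota>. PiE I (\<lambda>i. {v \<in> V. c v = \<iota> i})"
  have "(\<Sum>\<iota>\<in>PiE I (\<lambda>_. {..<N}). (\<Prod>i\<in>I. mass c (\<iota> i)) * (\<Prod>q\<in>R. g q (\<iota> (fst q)) (\<iota> (snd q))))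
    = (\<Sum>\<iota>\<in>PiE I (\<lambda>_. {..<N}). \<Sum>\<phi>\<in>?S \<iota>. (\<Prod>i\<in>I. d (\<phi> i)) * (\<Prod>q\<in>R. g q (c (\<phi> (fst q))) (c (\<phi> (snd q)))))"
  proof (intro sum.cong refl)
    fix \<iota>
    have "(\<Prod>i\<in>I. mass c (\<iota> i)) = (\<Sum>\<phi>\<in>?S \<iota>. \<Prod>i\<in>I. d (\<phi> i))"
      unfolding mass_def using assms(1) fin by (intro prod_sum_PiE) auto
    moreover have "(\<Prod>q\<in>R. g q (c (\<phi> (fst q))) (c (\<phi> (snd q)))) = (\<Prod>q\<in>R. g q (\<iota> (fst q)) (\<iota> (snd q)))"
      if "\<phi> \<in> ?S \<iota>" for \<phi>
    proof (intro prod.cong refl)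
      fix q assume "q \<in> R"
      then have "fst q \<in> I" "snd q \<in> I" using assms(3) by auto
      then have "c (\<phi> (fst q)) = \<iota> (fst q)" "c (\<phi> (snd q)) = \<iota> (snd q)" using that by auto
      then show "g q (c (\<phi> (fst q))) (c (\<phi> (snd q))) = g q (\<iota> (fst q)) (\<iota> (snd q))" by simp
    qed
    ultimately show "(\<Prod>i\<in>I. mass c (\<iota> i)) * (\<Prod>q\<in>R. g q (\<iota> (fst q)) (\<iota> (snd q)))
      = (\<Sum>\<phi>\<in>?S \<iota>. (\<Prod>i\<in>I. d (\<phi> i)) * (\<Prod>q\<in>R. g q (c (\<phi> (fst q))) (c (\<phi> (snd q)))))"
      by (simp add: sum_distrib_right)
  qed
  also have "\<dots> = (\<Sum>\<phi>\<in>(\<Union>\<iota>\<in>PiE I (\<lambda>_. {..<N}). ?S \<iota>). (\<Prod>i\<in>I. d (\<phi> i)) * (\<Prod>q\<in>R. g q (c (\<phi> (fst q))) (c (\<phi> (snd q)))))"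
  proof (rule sum.UNION_disjoint[symmetric])
    show "finite (PiE I (\<lambda>_. {..<N}))" using assms(1) by (intro finite_PiE) auto
    show "\<forall>\<iota>\<in>PiE I (\<lambda>_. {..<N}). finite (?S \<iota>)" using assms(1) fin by (auto intro!: finite_PiE)
    show "\<forall>\<iota>\<in>PiE I (\<lambda>_. {..<N}). \<forall>\<kappa>\<in>PiE I (\<lambda>_. {..<N}). \<iota> \<noteq> \<kappa> \<longrightarrow> ?S \<iota> \<inter> ?S \<kappa> = {}"
    proof (intro ballI impI)
      fix \<iota> \<kappa> assume *: "\<iota> \<in> PiE I (\<lambda>_. {..<N})" "\<kappa> \<in> PiE I (\<lambda>_. {..<N})" "\<iota> \<noteq> \<kappa>"
      then obtain i where "i \<in> I" "\<iota> i \<noteq> \<kappa> i" by (metis PiE_ext)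
      then show "?S \<iota> \<inter> ?S \<kappa> = {}" by (auto simp: PiE_iff)
    qed
  qed
  also have "(\<Union>\<iota>\<in>PiE I (\<lambda>_. {..<N}). ?S \<iota>) = PiE I (\<lambda>_. V)"
  proof (intro equalityI subsetI)
    fix \<phi> assume \<phi>: "\<phi> \<in> PiE I (\<lambda>_. V)"
    then have "restrict (c \<circ> \<phi>) I \<in> PiE I (\<lambda>_. {..<N})" using assms(2) by (auto simp: PiE_iff)
    moreover have "\<phi> \<in> ?S (restrict (c \<circ> \<phi>) I)" using \<phi> by (auto simp: PiE_iff)
    ultimately show "\<phi> \<in> (\<Union>\<iota>\<in>PiE I (\<lambda>_. {..<N}). ?S \<iota>)" by blast
  qed (auto simp: PiE_iff)
  finally show ?thesis unfolding hom_def by simp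
qed

end

section \<open>The limit space\<close>

lemma sum_mult_4:
  fixes f :: "nat \<Rightarrow> real"
  shows "(\<Sum>j<4 * n. f j) = (\<Sum>i<n. \<Sum>r<4. f (4 * i + r))"
proof (induction n)
  case (Suc n)
  have "(\<Sum>r<4. f (4 * n + r)) = f (4 * n) + f (4 * n + 1) + f (4 * n + 2) + f (4 * n + 3)"
    by (simp add: eval_nat_numeral)
  moreover have "(\<Sum>j<4 * Suc n. f j) = (\<Sum>j<4 * n. f j) + f (4 * n) + f (4 * n + 1) + f (4 * n + 2) + f (4 * n + 3)"
    by (simp add: eval_nat_numeral)
  ultimately show ?case using Suc by simp
qed simp

lemma distr_PiM_pair:
  assumes N: "\<And>i. prob_space (N i)" and ab: "a \<in> I" "b \<in> I" "a \<noteq> b"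
  shows "distr (PiM I N) (N a \<Otimes>\<^sub>M N b) (\<lambda>x. (x a, x b)) = N a \<Otimes>\<^sub>M N b"
proof (rule pair_measure_eqI[symmetric])
  interpret product_prob_space N I
    by (intro product_prob_spaceI N)
  show "sigma_finite_measure (N a)" "sigma_finite_measure (N b)"
    using N by (auto intro: prob_space_imp_sigma_finite)
  have m: "(\<lambda>x. (x a, x b)) \<in> PiM I N \<rightarrow>\<^sub>M N a \<Otimes>\<^sub>M N b" using ab by measurable
  fix A B assume AB: "A \<in> sets (N a)" "B \<in> sets (N b)"
  have "(\<lambda>x. (x a, x b)) -` (A \<times> B) \<inter> space (PiM I N)
      = {x \<in> space (PiM I N). \<forall>i\<in>{a, b}. x i \<in> (if i = a then A else B)}"
    using ab by auto
  moreover have "emeasure (PiM I N) {x \<in> space (PiM I N). \<forall>i\<in>{a, b}. x i \<in> (if i = a then A else B)}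
      = (\<Prod>i\<in>{a, b}. emeasure (N i) (if i = a then A else B))"
    using ab AB by (intro emeasure_PiM_Collect) auto
  ultimately show "emeasure (N a) A * emeasure (N b) B
      = emeasure (distr (PiM I N) (N a \<Otimes>\<^sub>M N b) (\<lambda>x. (x a, x b))) (A \<times> B)"
    using ab AB by (subst emeasure_distr[OF m]) auto
qed simp

text \<open>The sum of the absolute increments has finite integral, so it is finite almost
  everywhere, and there the telescoping series converges absolutely.\<close>

lemma AE_convergent_if_L1_summable:
  fixes f :: "nat \<Rightarrow> 'a \<Rightarrow> real"
  assumes int: "\<And>k. integrable M (f k)"
    and le: "\<And>k. (\<integral>x. \<bar>f (Suc k) x - f k x\<bar> \<partial>M) \<le> (1/2) ^ k"
  shows "AE x in M. convergent (\<lambda>k. f k x)"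
proof -
  have meas [measurable]: "f k \<in> borel_measurable M" for k using int by auto
  have "(\<integral>\<^sup>+x. (\<Sum>k. ennreal \<bar>f (Suc k) x - f k x\<bar>) \<partial>M) = (\<Sum>k. \<integral>\<^sup>+x. ennreal \<bar>f (Suc k) x - f k x\<bar> \<partial>M)"
    by (rule nn_integral_suminf) measurable
  also have "\<dots> = (\<Sum>k. ennreal (\<integral>x. \<bar>f (Suc k) x - f k x\<bar> \<partial>M))"
    using int by (intro suminf_cong nn_integral_eq_integral) auto
  also have "\<dots> \<le> (\<Sum>k. ennreal ((1/2) ^ k))"
    using le by (intro suminf_le ennreal_leI) auto
  also have "\<dots> = ennreal (\<Sum>k. (1/2) ^ k)"
    by (intro suminf_ennreal2 summable_geometric) auto
  also have "\<dots> < \<infinity>" by simp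
  finally have fin: "(\<integral>\<^sup>+x. (\<Sum>k. ennreal \<bar>f (Suc k) x - f k x\<bar>) \<partial>M) \<noteq> \<infinity>" by simp
  have "AE x in M. (\<Sum>k. ennreal \<bar>f (Suc k) x - f k x\<bar>) \<noteq> \<infinity>"
    by (intro nn_integral_PInf_AE fin) measurable
  then show ?thesis
  proof eventually_elim
    case (elim x)
    then have "summable (\<lambda>k. \<bar>f (Suc k) x - f k x\<bar>)"
      by (intro summable_suminf_not_top) auto
    then have "summable (\<lambda>k. f (Suc k) x - f k x)"
      by (rule summable_rabs_cancel)
    then have "convergent (\<lambda>n. \<Sum>k<n. f (Suc k) x - f k x)"
      by (simp add: summable_iff_convergent)
    moreover have "(\<Sum>k<n. f (Suc k) x - f k x) = f n x - f 0 x" for n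
      by (rule sum_lessThan_telescope)
    ultimately have "convergent (\<lambda>n. f n x - f 0 x)" by simp
    then have "convergent (\<lambda>n. (f n x - f 0 x) + f 0 x)"
      by (intro convergent_add convergent_const)
    then show ?case by simp
  qed
qed

text \<open>The cell \<open>i\<close> at level \<open>m\<close> consists of a vertex marked as heavy at an earlier level.\<close>

definition early :: "nat \<Rightarrow> nat \<Rightarrow> bool" where
  "early m i \<longleftrightarrow> (\<exists>k<m. atom (i div 4 ^ (m - Suc k)))"

text \<open>These are the facts about masses of classes and of pairs of classes that survive a
  limit. For equal classes only an inequality remains, as loops are missing; \<open>e_diag\<close>
  says that away from the singled-out vertices the total defect tends to 0. \<open>two_atoms\<close>
  records that no vertex is singled out twice.\<close>

locale limit_data =
  fixes \<mu> :: "nat \<Rightarrow> nat \<Rightarrow> real" and e :: "bool \<Rightarrow> nat \<Rightarrow> nat \<Rightarrow> nat \<Rightarrow> real"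
  assumes mu_nonneg: "\<mu> m i \<ge> 0"
    and mu_0: "\<mu> 0 0 = 1"
    and mu_out: "i \<ge> 4 ^ m \<Longrightarrow> \<mu> m i = 0"
    and mu_split: "\<mu> m i = (\<Sum>r<4. \<mu> (Suc m) (4 * i + r))"
    and e_nonneg: "e b m i j \<ge> 0"
    and e_sym: "e b m i j = e b m j i"
    and e_split: "e b m i j = (\<Sum>r<4. \<Sum>s<4. e b (Suc m) (4 * i + r) (4 * j + s))"
    and e_sum_le: "e True m i j + e False m i j \<le> \<mu> m i * \<mu> m j"
    and e_sum: "i \<noteq> j \<Longrightarrow> e True m i j + e False m i j = \<mu> m i * \<mu> m j"
    and e_diag: "m > 0 \<Longrightarrow> (\<Sum>i | i < 4 ^ m \<and> \<not> early m i. \<mu> m i * \<mu> m i - e True m i i - e False m i i) \<le> 1 / m"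
    and two_atoms: "k < l \<Longrightarrow> atom i \<Longrightarrow> atom (i div 4 ^ (l - k)) \<Longrightarrow> \<mu> (Suc l) i = 0"
begin

lemma sum_mu: "(\<Sum>i<4 ^ m. \<mu> m i) = 1"
proof (induction m)
  case (Suc m)
  have "(\<Sum>i<4 ^ Suc m. \<mu> (Suc m) i) = (\<Sum>i<4 ^ m. \<mu> m i)"
    unfolding power_Suc sum_mult_4 mu_split[symmetric] ..
  then show ?case using Suc by simp
qed (simp add: mu_0)

text \<open>The cells of level \<open>m\<close> are consecutive intervals of lengths \<open>\<mu> m i\<close> in \<open>[0, 1)\<close>.\<close>

lemma exists_space:
  obtains M :: "real measure" and \<kappa> where "prob_space M" "\<And>m. \<kappa> m \<in> M \<rightarrow>\<^sub>M count_space UNIV"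
    "\<And>m i. measure M {x \<in> space M. \<kappa> m x = i} = \<mu> m i"
    "\<And>m x. x \<in> space M \<Longrightarrow> \<kappa> (Suc m) x div 4 = \<kappa> m x"
    "\<And>m x. x \<in> space M \<Longrightarrow> \<mu> m (\<kappa> m x) > 0"
proof -
  define M where "M = restrict_space lborel {0..<1::real}"
  have sp: "space M = {0..<1}" by (simp add: M_def space_restrict_space)
  define \<alpha> where "\<alpha> m i = (\<Sum>j<i. \<mu> m j)" for m i
  \<comment> \<open>The least index skips intervals of length 0, so every point, not just almost
    every point, lies in a cell of positive measure.\<close>
  define \<kappa> where "\<kappa> m x = (LEAST i. x < \<alpha> m (Suc i))" for m x
  have mono: "\<alpha> m i \<le> \<alpha> m j" if "i \<le> j" for m i j
    using that unfolding \<alpha>_def by (intro sum_mono2) (auto simp: mu_nonneg)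
  have one: "\<alpha> m (4 ^ m) = 1" for m unfolding \<alpha>_def by (rule sum_mu)
  have S: "\<alpha> m (Suc i) = \<alpha> m i + \<mu> m i" for m i by (simp add: \<alpha>_def)
  have le1: "\<alpha> m i \<le> 1" for m i
  proof (cases "i \<le> 4 ^ m")
    case False
    then have "\<alpha> m i = \<alpha> m (4 ^ m)"
      unfolding \<alpha>_def by (intro sum.mono_neutral_right) (auto simp: mu_out)
    then show ?thesis using one by simp
  qed (use mono[of i "4 ^ m" m] one in simp)
  have ge0: "0 \<le> \<alpha> m i" for m i unfolding \<alpha>_def by (intro sum_nonneg mu_nonneg)
  have \<kappa>: "\<alpha> m (\<kappa> m x) \<le> x \<and> x < \<alpha> m (Suc (\<kappa> m x))" if "x \<in> space M" for m x
  proof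
    have "x < \<alpha> m (Suc (4 ^ m - 1))" using that one[of m] by (simp add: sp)
    then show "x < \<alpha> m (Suc (\<kappa> m x))" unfolding \<kappa>_def by (rule LeastI)
    show "\<alpha> m (\<kappa> m x) \<le> x"
    proof (cases "\<kappa> m x")
      case 0 then show ?thesis using that by (simp add: \<alpha>_def sp)
    next
      case (Suc i)
      then have "\<not> x < \<alpha> m (Suc i)" using not_less_Least[of i "\<lambda>i. x < \<alpha> m (Suc i)"] by (simp add: \<kappa>_def)
      then show ?thesis using Suc by simp
    qed
  qed
  have \<kappa>_eq: "\<kappa> m x = i \<longleftrightarrow> \<alpha> m i \<le> x \<and> x < \<alpha> m (Suc i)" if "x \<in> space M" for m x i
  proof
    assume a: "\<alpha> m i \<le> x \<and> x < \<alpha> m (Suc i)"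
    show "\<kappa> m x = i"
    proof (rule linorder_cases[of "\<kappa> m x" i])
      assume "\<kappa> m x < i"
      then have "\<alpha> m (Suc (\<kappa> m x)) \<le> \<alpha> m i" by (intro mono) auto
      then show ?thesis using a \<kappa>[OF that, of m] by linarith
    next
      assume "i < \<kappa> m x"
      then have "\<alpha> m (Suc i) \<le> \<alpha> m (\<kappa> m x)" by (intro mono) auto
      then show ?thesis using a \<kappa>[OF that, of m] by linarith
    qed
  qed (use \<kappa>[OF that] in auto)
  have cell: "{x \<in> space M. \<kappa> m x = i} = {\<alpha> m i..<\<alpha> m (Suc i)}" for m i
  proof -
    have "{x \<in> space M. \<kappa> m x = i} = {x \<in> space M. \<alpha> m i \<le> x \<and> x < \<alpha> m (Suc i)}"
      using \<kappa>_eq by auto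
    also have "\<dots> = {\<alpha> m i..<\<alpha> m (Suc i)}" unfolding sp using le1[of m "Suc i"] ge0[of m i] by auto
    finally show ?thesis .
  qed
  \<comment> \<open>The children of a cell have consecutive numbers starting at
    \<open>4 * i\<close>, so the endpoints of level \<open>m\<close> are also endpoints of level
    \<open>Suc m\<close> and the intervals are nested.\<close>
  have \<alpha>4: "\<alpha> (Suc m) (4 * i) = \<alpha> m i" for m i
    unfolding \<alpha>_def sum_mult_4 mu_split[symmetric] ..
  show ?thesis
  proof (rule that[of M \<kappa>])
    show "prob_space M" unfolding M_def by (rule prob_space_restrict_space) auto
    show "\<kappa> m \<in> M \<rightarrow>\<^sub>M count_space UNIV" for m
    proof (subst measurable_count_space_eq_countable)
      show "\<kappa> m \<in> space M \<rightarrow> UNIV \<and> (\<forall>a\<in>UNIV. \<kappa> m -` {a} \<inter> space M \<in> sets M)"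
      proof (intro conjI ballI)
        fix i
        have "\<kappa> m -` {i} \<inter> space M = {x \<in> space M. \<kappa> m x = i}" by auto
        also have "\<dots> \<in> sets M" unfolding cell unfolding M_def sets_restrict_space
          using le1[of m "Suc i"] ge0[of m i]
          by (intro image_eqI[of _ _ "{\<alpha> m i..<\<alpha> m (Suc i)}"]) auto
        finally show "\<kappa> m -` {i} \<inter> space M \<in> sets M" .
      qed auto
    qed auto
    show "measure M {x \<in> space M. \<kappa> m x = i} = \<mu> m i" for m i
    proof -
      have "measure M {\<alpha> m i..<\<alpha> m (Suc i)} = measure lborel {\<alpha> m i..<\<alpha> m (Suc i)}"
        unfolding M_def using le1[of m "Suc i"] ge0[of m i] by (intro measure_restrict_space) auto
      then show ?thesis unfolding cell using S[of m i] mu_nonneg[of m i] by simp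
    qed
    show "\<kappa> (Suc m) x div 4 = \<kappa> m x" if x: "x \<in> space M" for m x
    proof -
      let ?j = "\<kappa> (Suc m) x"
      have "\<alpha> m (?j div 4) \<le> \<alpha> (Suc m) ?j" unfolding \<alpha>4[of m "?j div 4", symmetric] by (rule mono) auto
      moreover have "\<alpha> (Suc m) (Suc ?j) \<le> \<alpha> m (Suc (?j div 4))" unfolding \<alpha>4[of m "Suc (?j div 4)", symmetric] by (rule mono) auto
      ultimately have "\<kappa> m x = ?j div 4" using \<kappa>[OF x, of "Suc m"] by (subst \<kappa>_eq[OF x]) linarith
      then show ?thesis by simp
    qed
    show "\<mu> m (\<kappa> m x) > 0" if x: "x \<in> space M" for m x
      using \<kappa>[OF x, of m] S[of m "\<kappa> m x"] by linarith
  qed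
qed

end

locale limit_space = limit_data +
  fixes M :: "real measure" and \<kappa>
  assumes prob: "prob_space M" and \<kappa>_meas [measurable]: "\<And>m. \<kappa> m \<in> M \<rightarrow>\<^sub>M count_space UNIV"
    and cell_measure: "\<And>m i. measure M {x \<in> space M. \<kappa> m x = i} = \<mu> m i"
    and \<kappa>_div: "\<And>m x. x \<in> space M \<Longrightarrow> \<kappa> (Suc m) x div 4 = \<kappa> m x"
    and mu_pos: "\<And>m x. x \<in> space M \<Longrightarrow> \<mu> m (\<kappa> m x) > 0"
begin

sublocale prob_space M by (rule prob)
sublocale PP: pair_prob_space M M ..

abbreviation MM where "MM \<equiv> M \<Otimes>\<^sub>M M"

definition cell where "cell m i = {x \<in> space M. \<kappa> m x = i}"

lemma cell_sets [measurable]: "cell m i \<in> sets M" unfolding cell_def by measurable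

lemma measure_cell: "measure M (cell m i) = \<mu> m i" unfolding cell_def by (rule cell_measure)

definition W where "W b m x y = e b m (\<kappa> m x) (\<kappa> m y) / (\<mu> m (\<kappa> m x) * \<mu> m (\<kappa> m y))"

lemma \<kappa>_less: "x \<in> space M \<Longrightarrow> \<kappa> m x < 4 ^ m"
  using mu_pos[of x m] mu_out[of m "\<kappa> m x"] by (cases "\<kappa> m x < 4 ^ m") auto

lemma \<kappa>_chain: "x \<in> space M \<Longrightarrow> k \<le> m \<Longrightarrow> \<kappa> k x = \<kappa> m x div 4 ^ (m - k)"
  using div_pow_chain[of "\<lambda>m. \<kappa> m x" k m] \<kappa>_div by blast

abbreviation "on_cells m g p \<equiv> g (\<kappa> m (fst p)) (\<kappa> m (snd p)) :: real"

lemma step_measurable [measurable]: "(\<lambda>p. on_cells m g p) \<in> borel_measurable MM"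
proof -
  have [measurable]: "(\<lambda>p. (\<kappa> m (fst p), \<kappa> m (snd p))) \<in> MM \<rightarrow>\<^sub>M count_space UNIV \<Otimes>\<^sub>M count_space UNIV"
    by measurable
  have "(\<lambda>q. g (fst q) (snd q)) \<in> borel_measurable (count_space UNIV \<Otimes>\<^sub>M count_space UNIV :: (nat \<times> nat) measure)"
    by (simp add: pair_measure_countable)
  then have "(\<lambda>q. g (fst q) (snd q)) \<circ> (\<lambda>p. (\<kappa> m (fst p), \<kappa> m (snd p))) \<in> borel_measurable MM"
    by (intro measurable_comp) measurable
  then show ?thesis by (simp add: comp_def)
qed

abbreviation Wp where "Wp b m p \<equiv> W b m (fst p) (snd p)"

lemma W_measurable [measurable]: "(\<lambda>p. Wp b m p) \<in> borel_measurable MM"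
  unfolding W_def by (rule step_measurable)

lemma W_sym: "W b m x y = W b m y x" unfolding W_def by (simp add: e_sym mult_ac)

lemma e_le: "e b m i j \<le> \<mu> m i * \<mu> m j"
  using e_sum_le[of m i j] e_nonneg[of True m i j] e_nonneg[of False m i j] by (cases b) auto

lemma dens_01: "e b m i j / (\<mu> m i * \<mu> m j) \<in> {0..1}"
  using e_le[of b m i j] e_nonneg[of b m i j] mu_nonneg[of m i] mu_nonneg[of m j]
  by (cases "\<mu> m i * \<mu> m j = 0") (auto simp: divide_le_eq zero_less_mult_iff)

lemma W_01: "0 \<le> W b m x y" "W b m x y \<le> 1"
  using dens_01[of b m "\<kappa> m x" "\<kappa> m y"] unfolding W_def by auto

lemma integral_step_mult:
  fixes H :: "real \<times> real \<Rightarrow> real"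
  assumes H: "integrable MM H"
  shows "(\<integral>p. on_cells m g p * H p \<partial>MM)
    = (\<Sum>i<4 ^ m. \<Sum>j<4 ^ m. g i j * (\<integral>p. indicator (cell m i \<times> cell m j) p * H p \<partial>MM))"
proof -
  have int: "integrable MM (\<lambda>p. indicator (cell m i \<times> cell m j) p * H p)" for i j
    using integrable_mult_indicator[OF _ H, of "cell m i \<times> cell m j"] by simp
  have "(\<integral>p. on_cells m g p * H p \<partial>MM)
    = (\<integral>p. (\<Sum>i<4 ^ m. \<Sum>j<4 ^ m. g i j * (indicator (cell m i \<times> cell m j) p * H p)) \<partial>MM)"
  proof (intro Bochner_Integration.integral_cong refl)
    fix p assume p: "p \<in> space MM"
    have x: "fst p \<in> space M" "snd p \<in> space M" using p by (auto simp: space_pair_measure)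
    have ind: "indicator (cell m i \<times> cell m j) p = (if i = \<kappa> m (fst p) then if j = \<kappa> m (snd p) then 1 else 0 else 0 :: real)" for i j
      using x by (cases p) (simp add: cell_def indicator_def)
    have inner: "(\<Sum>j<4 ^ m. g i j * ((if j = \<kappa> m (snd p) then 1 else 0) * H p)) = g i (\<kappa> m (snd p)) * H p" for i
    proof -
      have "(\<Sum>j<4 ^ m. g i j * ((if j = \<kappa> m (snd p) then 1 else 0) * H p))
        = (\<Sum>j<4 ^ m. if j = \<kappa> m (snd p) then g i j * H p else 0)"
        by (intro sum.cong refl) simp
      then show ?thesis using \<kappa>_less[OF x(2), of m] by simp
    qed
    have "(\<Sum>i<4 ^ m. \<Sum>j<4 ^ m. g i j * (indicator (cell m i \<times> cell m j) p * H p))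
      = (\<Sum>i<4 ^ m. if i = \<kappa> m (fst p) then g i (\<kappa> m (snd p)) * H p else 0)"
      unfolding ind
    proof (rule sum.cong[OF refl])
      fix i
      show "(\<Sum>j<4 ^ m. g i j * ((if i = \<kappa> m (fst p) then if j = \<kappa> m (snd p) then 1 else 0 else 0) * H p))
        = (if i = \<kappa> m (fst p) then g i (\<kappa> m (snd p)) * H p else 0)"
        using inner[of i] by (cases "i = \<kappa> m (fst p)") simp_all
    qed
    also have "\<dots> = on_cells m g p * H p"
      using \<kappa>_less[OF x(1), of m] by simp
    finally show "on_cells m g p * H p
      = (\<Sum>i<4 ^ m. \<Sum>j<4 ^ m. g i j * (indicator (cell m i \<times> cell m j) p * H p))" ..
  qed
  also have "\<dots> = (\<Sum>i<4 ^ m. \<Sum>j<4 ^ m. g i j * (\<integral>p. indicator (cell m i \<times> cell m j) p * H p \<partial>MM))"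
    using int by (simp add: Bochner_Integration.integral_sum integrable_sum)
  finally show ?thesis .
qed

lemma measure_cell_times: "measure MM (cell m i \<times> cell m j) = \<mu> m i * \<mu> m j"
proof -
  have "emeasure MM (cell m i \<times> cell m j) = emeasure M (cell m i) * emeasure M (cell m j)"
    by (intro emeasure_pair_measure_Times cell_sets)
  then show ?thesis
    unfolding measure_cell[symmetric] measure_def by (simp only: enn2real_mult)
qed

lemma integral_step:
  "(\<integral>p. on_cells m g p \<partial>MM) = (\<Sum>i<4 ^ m. \<Sum>j<4 ^ m. g i j * (\<mu> m i * \<mu> m j))"
  using integral_step_mult[of "\<lambda>_. 1" g m] by (simp add: measure_cell_times)

text \<open>Cancelling is safe even when a cell has measure 0, because then \<open>e_le\<close>
  forces the numerator to be 0.\<close>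

lemma mu_mult_dens: "\<mu> m i * \<mu> m j * (e b m i j / (\<mu> m i * \<mu> m j)) = e b m i j"
  using e_le[of b m i j] e_nonneg[of b m i j] by (cases "\<mu> m i * \<mu> m j = 0") auto

lemma integral_step_W:
  "(\<integral>p. on_cells m g p * Wp b m p \<partial>MM) = (\<Sum>i<4 ^ m. \<Sum>j<4 ^ m. g i j * e b m i j)"
proof -
  have "g i j * (e b m i j / (\<mu> m i * \<mu> m j)) * (\<mu> m i * \<mu> m j) = g i j * e b m i j" for i j
    using mu_mult_dens[of m i j b] by (simp only: mult_ac)
  then show ?thesis
    unfolding W_def using integral_step[of "\<lambda>i j. g i j * (e b m i j / (\<mu> m i * \<mu> m j))" m] by simp
qed

text \<open>The martingale property of the step densities: tested against functions of the cells of
  level \<open>m\<close>, the next level looks the same, because \<open>e\<close> is additive over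
  children.\<close>

lemma integral_step_W_Suc:
  "(\<integral>p. on_cells m g p * Wp b (Suc m) p \<partial>MM)
   = (\<integral>p. on_cells m g p * Wp b m p \<partial>MM)"
proof -
  have "(\<integral>p. on_cells m g p * Wp b (Suc m) p \<partial>MM)
    = (\<integral>p. g (\<kappa> (Suc m) (fst p) div 4) (\<kappa> (Suc m) (snd p) div 4) * Wp b (Suc m) p \<partial>MM)"
    by (intro Bochner_Integration.integral_cong refl) (auto simp: space_pair_measure \<kappa>_div)
  also have "\<dots> = (\<Sum>i<4 * 4 ^ m. \<Sum>j<4 * 4 ^ m. g (i div 4) (j div 4) * e b (Suc m) i j)"
    using integral_step_W[of "\<lambda>i j. g (i div 4) (j div 4)" "Suc m" b] by simp
  also have "\<dots> = (\<Sum>i<4 ^ m. \<Sum>r<4. \<Sum>j<4 ^ m. \<Sum>s<4. g i j * e b (Suc m) (4 * i + r) (4 * j + s))"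
    unfolding sum_mult_4
  proof (intro sum.cong refl)
    fix i r j s :: nat assume "r \<in> {..<4}" "s \<in> {..<4}"
    then have "(4 * i + r) div 4 = i" "(4 * j + s) div 4 = j" by auto
    then show "g ((4 * i + r) div 4) ((4 * j + s) div 4) * e b (Suc m) (4 * i + r) (4 * j + s)
      = g i j * e b (Suc m) (4 * i + r) (4 * j + s)" by simp
  qed
  also have "\<dots> = (\<Sum>i<4 ^ m. \<Sum>j<4 ^ m. \<Sum>r<4. \<Sum>s<4. g i j * e b (Suc m) (4 * i + r) (4 * j + s))"
    by (rule sum.cong[OF refl], rule sum.swap)
  also have "\<dots> = (\<Sum>i<4 ^ m. \<Sum>j<4 ^ m. g i j * e b m i j)"
    by (subst e_split) (simp only: sum_distrib_left)
  finally show ?thesis unfolding integral_step_W .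
qed

lemma integral_step_W_le:
  assumes "m \<le> l"
  shows "(\<integral>p. on_cells m g p * Wp b l p \<partial>MM)
   = (\<integral>p. on_cells m g p * Wp b m p \<partial>MM)"
  using assms
proof (induction l rule: dec_induct)
  case (step l)
  have *: "(\<integral>p. on_cells m g p * Wp b k p \<partial>MM)
    = (\<integral>p. g (\<kappa> l (fst p) div 4 ^ (l - m)) (\<kappa> l (snd p) div 4 ^ (l - m)) * Wp b k p \<partial>MM)" for k
  proof (intro Bochner_Integration.integral_cong refl)
    fix p assume "p \<in> space MM"
    then have "fst p \<in> space M" "snd p \<in> space M" by (auto simp: space_pair_measure)
    then have "\<kappa> m (fst p) = \<kappa> l (fst p) div 4 ^ (l - m)" "\<kappa> m (snd p) = \<kappa> l (snd p) div 4 ^ (l - m)"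
      using step.hyps by (auto intro: \<kappa>_chain)
    then show "on_cells m g p * Wp b k p
      = g (\<kappa> l (fst p) div 4 ^ (l - m)) (\<kappa> l (snd p) div 4 ^ (l - m)) * Wp b k p" by simp
  qed
  show ?case
    unfolding step.IH[symmetric] unfolding *[of l] *[of "Suc l"]
    by (rule integral_step_W_Suc[of "\<lambda>i j. g (i div 4 ^ (l - m)) (j div 4 ^ (l - m))" l b])
qed simp

end

section \<open>The limit kernel\<close>

context limit_space begin

lemma integrable_bounded:
  assumes "f \<in> borel_measurable MM" "\<And>p. p \<in> space MM \<Longrightarrow> \<bar>f p\<bar> \<le> B"
  shows "integrable MM (f :: _ \<Rightarrow> real)"
  using assms by (intro PP.P.integrable_const_bound[where B = B] AE_I2) auto

lemma W_integrable: "integrable MM (\<lambda>p. Wp b m p)"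
  using W_01 by (intro integrable_bounded[where B = 1]) auto

lemma W_prod_integrable: "integrable MM (\<lambda>p. Wp b m p * Wp b l p)"
  using W_01 by (intro integrable_bounded[where B = 1]) (auto simp: abs_mult intro!: mult_le_one)

section \<open>Convergence of the bounded martingale of densities\<close>

definition L2 where "L2 b m = (\<integral>p. Wp b m p * Wp b m p \<partial>MM)"

text \<open>Orthogonality of martingale increments: taking the density of level \<open>m\<close>
  itself as the test function turns the mixed term into \<open>L2 b m\<close>.\<close>

lemma L2_diff:
  assumes "m \<le> l"
  shows "(\<integral>p. (Wp b l p - Wp b m p)\<^sup>2 \<partial>MM) = L2 b l - L2 b m"
proof -
  have "(\<integral>p. Wp b m p * Wp b l p \<partial>MM) = L2 b m"
    unfolding L2_def using integral_step_W_le[OF assms, of "\<lambda>i j. e b m i j / (\<mu> m i * \<mu> m j)" b]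
    by (simp add: W_def)
  moreover have "(\<integral>p. (Wp b l p - Wp b m p)\<^sup>2 \<partial>MM)
    = (\<integral>p. (Wp b l p * Wp b l p
         - 2 * (Wp b m p * Wp b l p))
         + Wp b m p * Wp b m p \<partial>MM)"
    by (intro Bochner_Integration.integral_cong refl) (simp add: power2_eq_square algebra_simps)
  moreover have "\<dots> = (L2 b l - 2 * (\<integral>p. Wp b m p * Wp b l p \<partial>MM)) + L2 b m"
    unfolding L2_def using W_prod_integrable
    by (subst Bochner_Integration.integral_add Bochner_Integration.integral_diff;
        (intro Bochner_Integration.integrable_diff integrable_mult_right)?; simp)+
  ultimately show ?thesis by simp
qed

lemma L2_mono: "m \<le> l \<Longrightarrow> L2 b m \<le> L2 b l"
proof -
  assume "m \<le> l"
  moreover have "0 \<le> (\<integral>p. (Wp b l p - Wp b m p)\<^sup>2 \<partial>MM)"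
    by (intro integral_nonneg_AE AE_I2) auto
  ultimately show ?thesis using L2_diff by simp
qed

lemma L2_le_1: "L2 b m \<le> 1"
proof -
  have "L2 b m \<le> (\<integral>p. 1 \<partial>MM)"
    unfolding L2_def using W_01 by (intro integral_mono W_prod_integrable) (auto intro!: mult_le_one)
  then show ?thesis by (simp add: PP.P.prob_space)
qed

text \<open>The square norms increase and stay below 1, so they form Cauchy sequences. Along a
  sparse subsequence the increments are summable in mean, which gives convergence almost
  everywhere.\<close>

lemma exists_convergent_subsequence:
  obtains ms where "strict_mono ms" "\<And>b. AE p in MM. convergent (\<lambda>k. Wp b (ms k) p)"
proof -
  \<comment> \<open>One sequence for both colours, so that one subsequence serves both.\<close>
  define s where "s m = L2 True m + L2 False m" for m
  have "incseq s" unfolding s_def incseq_def using L2_mono by (auto intro: add_mono)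
  moreover have "s m \<le> 2" for m using L2_le_1[of True m] L2_le_1[of False m] by (simp add: s_def)
  ultimately have "convergent s" by (metis incseq_convergent convergentI)
  then have "Cauchy s" by (rule convergent_Cauchy)
  then have "\<exists>N. \<forall>m\<ge>N. \<forall>n\<ge>N. \<bar>s m - s n\<bar> < (1/4) ^ k" for k
    by (auto simp: Cauchy_def dist_real_def)
  then obtain N where N: "\<And>k m n. m \<ge> N k \<Longrightarrow> n \<ge> N k \<Longrightarrow> \<bar>s m - s n\<bar> < (1/4) ^ k"
    by metis
  \<comment> \<open>The summand \<open>k\<close> makes the sequence strictly increasing, and the sum
    keeps it above every \<open>N k\<close> without assuming \<open>N\<close> monotone.\<close>
  define ms where "ms k = k + (\<Sum>j\<le>k. N j)" for k
  have mono: "strict_mono ms" unfolding strict_mono_Suc_iff ms_def by simp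
  have ge: "ms k \<ge> N k" for k
    unfolding ms_def using member_le_sum[of k "{..k}" N] by simp
  have le: "(\<integral>p. \<bar>W b (ms (Suc k)) (fst p) (snd p) - Wp b (ms k) p\<bar> \<partial>MM) \<le> (1/2) ^ k" for b k
  proof -
    let ?f = "\<lambda>p. W b (ms (Suc k)) (fst p) (snd p) - Wp b (ms k) p"
    have lt: "ms k \<le> ms (Suc k)" using mono by (simp add: strict_mono_Suc_iff less_imp_le)
    have "\<bar>s (ms (Suc k)) - s (ms k)\<bar> < (1/4) ^ k"
      using lt ge[of k] by (intro N) auto
    then have sq: "(\<integral>p. (?f p)\<^sup>2 \<partial>MM) \<le> (1/4) ^ k"
      using L2_mono[OF lt, of "\<not> b"] unfolding L2_diff[OF lt] s_def by (cases b) auto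
    have f1: "\<bar>?f p\<bar> \<le> 1" for p
      using W_01[of b "ms k" "fst p" "snd p"] W_01[of b "ms (Suc k)" "fst p" "snd p"] by linarith
    have int: "integrable MM (\<lambda>p. (?f p)\<^sup>2)" "integrable MM ?f"
      using f1 by (auto intro!: integrable_bounded[where B = 1] simp: abs_square_le_1)
    \<comment> \<open>The arithmetic-geometric mean inequality with weight \<open>2 ^ k\<close>. It
      turns the bound \<open>(1/4) ^ k\<close> for the square into \<open>(1/2) ^ k\<close> for the
      absolute value, each of the two terms contributing one half.\<close>
    have "(\<integral>p. \<bar>?f p\<bar> \<partial>MM) \<le> (\<integral>p. (2 ^ k / 2) * (?f p)\<^sup>2 + (1/2) ^ k / 2 \<partial>MM)"
    proof (intro integral_mono integrable_abs int Bochner_Integration.integrable_add integrable_mult_right)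
      fix p
      have "0 \<le> (1/2) ^ k * (2 ^ k * \<bar>?f p\<bar> - 1)\<^sup>2" by simp
      also have "\<dots> = 2 ^ k * (?f p)\<^sup>2 - 2 * \<bar>?f p\<bar> + (1/2) ^ k"
        by (simp add: power2_eq_square field_simps flip: abs_mult)
      finally show "\<bar>?f p\<bar> \<le> (2 ^ k / 2) * (?f p)\<^sup>2 + (1/2) ^ k / 2" by simp
    qed simp
    also have "\<dots> = (2 ^ k / 2) * (\<integral>p. (?f p)\<^sup>2 \<partial>MM) + (1/2) ^ k / 2"
      using int by (simp add: PP.P.prob_space)
    also have "\<dots> \<le> (2 ^ k / 2) * (1/4) ^ k + (1/2) ^ k / 2"
      using sq by (intro add_right_mono mult_left_mono) auto
    also have "(2 ^ k / 2) * (1/4) ^ k = ((1/2 :: real) ^ k) / 2"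
    proof -
      have "(2 :: real) ^ k * (1/4) ^ k = (1/2) ^ k" by (simp flip: power_mult_distrib)
      then show ?thesis by simp
    qed
    finally show ?thesis by simp
  qed
  have "AE p in MM. convergent (\<lambda>k. Wp b (ms k) p)" for b
    by (rule AE_convergent_if_L1_summable[of MM "\<lambda>k p. Wp b (ms k) p", OF W_integrable le])
  then show ?thesis by (rule that[OF mono])
qed

section \<open>The blocks of the singled-out vertices and the missing diagonal\<close>

definition At where "At k = {x \<in> space M. atom (\<kappa> (Suc k) x)}"

lemma At_sets [measurable]: "At k \<in> sets M" unfolding At_def by measurable

text \<open>A common point would lie in a cell that is marked at two levels. Such a cell has measure
  0 by \<open>two_atoms\<close>, but every point lies in cells of positive measure.\<close>

lemma At_disjoint:
  assumes "k < l" shows "At k \<inter> At l = {}"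
proof (rule ccontr)
  assume "At k \<inter> At l \<noteq> {}"
  then obtain x where x: "x \<in> space M" "atom (\<kappa> (Suc k) x)" "atom (\<kappa> (Suc l) x)"
    by (auto simp: At_def)
  have "\<kappa> (Suc k) x = \<kappa> (Suc l) x div 4 ^ (l - k)" using \<kappa>_chain[OF x(1), of "Suc k" "Suc l"] assms by simp
  then have "\<mu> (Suc l) (\<kappa> (Suc l) x) = 0" using two_atoms[OF assms x(3)] x(2) by simp
  then show False using mu_pos[OF x(1), of "Suc l"] by simp
qed

text \<open>The blocks are disjoint, so the tails of their union decrease to the empty set. This
  bounds the weight of the vertices that have to be dropped.\<close>

lemma late_atoms_small: "(\<lambda>m. measure M (\<Union>k\<in>{m..}. At k)) \<longlonglongrightarrow> 0"
proof -
  have "(\<lambda>m. measure M (\<Union>k\<in>{m..}. At k)) \<longlonglongrightarrow> measure M (\<Inter>m. \<Union>k\<in>{m..}. At k)"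
  proof (rule finite_Lim_measure_decseq)
    show "decseq (\<lambda>m. \<Union>k\<in>{m..}. At k)"
      unfolding decseq_def by (intro allI impI UN_mono) auto
  qed auto
  moreover have "(\<Inter>m. \<Union>k\<in>{m..}. At k) = {}"
  proof (rule ccontr)
    assume "(\<Inter>m. \<Union>k\<in>{m..}. At k) \<noteq> {}"
    then obtain x where "\<forall>m. \<exists>k\<in>{m..}. x \<in> At k" by auto
    then have x: "\<exists>k\<ge>m. x \<in> At k" for m by (metis atLeast_iff)
    obtain k l where "x \<in> At k" "l \<ge> Suc k" "x \<in> At l" using x[of 0] x by metis
    then show False using At_disjoint[of k l] by auto
  qed
  ultimately show ?thesis by simp
qed

text \<open>The pairs at which both colours may have limit density 0. Off this set the two densities
  add up to 1 almost everywhere.\<close>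

definition same_atom where "same_atom x y \<longleftrightarrow> (\<exists>k. x \<in> At k \<and> y \<in> At k)"

lemma same_atom_measurable [measurable]: "Measurable.pred MM (\<lambda>p. same_atom (fst p) (snd p))"
  unfolding same_atom_def by measurable

abbreviation "apart \<equiv> {p. \<not> same_atom (fst p) (snd p)}"

lemma W_sum_le: "W True m x y + W False m x y \<le> 1"
proof -
  have "W True m x y + W False m x y
    = (e True m (\<kappa> m x) (\<kappa> m y) + e False m (\<kappa> m x) (\<kappa> m y)) / (\<mu> m (\<kappa> m x) * \<mu> m (\<kappa> m y))"
    by (simp add: W_def add_divide_distrib)
  also have "\<dots> \<le> 1"
    using e_sum_le[of m "\<kappa> m x" "\<kappa> m y"] mu_nonneg[of m "\<kappa> m x"] mu_nonneg[of m "\<kappa> m y"]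
    by (simp add: divide_le_eq zero_less_mult_iff zero_le_mult_iff not_less)
  finally show ?thesis .
qed

text \<open>Different cells have no defect, and two points in one early cell lie in a common block.
  Only the diagonal over cells that are not early is left, and there \<open>e_diag\<close>
  applies.\<close>

lemma integral_defect_le:
  assumes "m > 0"
  shows "(\<integral>p. indicator apart p * (1 - Wp True m p - Wp False m p) \<partial>MM) \<le> 1 / m"
proof -
  let ?d = "\<lambda>b i j. e b m i j / (\<mu> m i * \<mu> m j)"
  \<comment> \<open>The defect as a function of cells only, cut down to this diagonal; it dominates
    the integrand pointwise.\<close>
  define g where "g i j = (if i = j \<and> \<not> early m i then 1 - ?d True i j - ?d False i j else 0)" for i j
  have g01: "\<bar>g i j\<bar> \<le> 1" for i j
    using dens_01[of True m i j] dens_01[of False m i j]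
    unfolding g_def by auto
  have gW: "indicator apart p * (1 - Wp True m p - Wp False m p)
      \<le> on_cells m g p" if p: "p \<in> space MM" for p
  proof -
    have x: "fst p \<in> space M" "snd p \<in> space M" using p by (auto simp: space_pair_measure)
    show ?thesis
    proof (cases "\<kappa> m (fst p) = \<kappa> m (snd p)")
      case False
      then have "Wp True m p + Wp False m p = 1"
        using e_sum[OF False, of m] mu_pos[OF x(1), of m] mu_pos[OF x(2), of m]
        by (simp add: W_def flip: add_divide_distrib)
      then have "1 - Wp True m p - Wp False m p = 0" by linarith
      then show ?thesis using False by (simp add: g_def)
    next
      case True
      show ?thesis
      proof (cases "early m (\<kappa> m (fst p))")
        case early: True
        then obtain k where k: "k < m" "atom (\<kappa> m (fst p) div 4 ^ (m - Suc k))" by (auto simp: early_def)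
        then have "same_atom (fst p) (snd p)"
          unfolding same_atom_def At_def
          using x \<kappa>_chain[OF x(1), of "Suc k" m] \<kappa>_chain[OF x(2), of "Suc k" m] True by (auto intro!: exI[of _ k])
        then show ?thesis using early True by (simp add: g_def)
      next
        case False
        then have "on_cells m g p = 1 - Wp True m p - Wp False m p"
          using True by (simp add: g_def W_def)
        then show ?thesis using W_sum_le[of m "fst p" "snd p"] by (simp add: indicator_def)
      qed
    qed
  qed
  have "(\<integral>p. indicator apart p * (1 - Wp True m p - Wp False m p) \<partial>MM)
     \<le> (\<integral>p. on_cells m g p \<partial>MM)"
  proof (intro integral_mono gW)
    have [measurable]: "(\<lambda>p. indicator apart p :: real) \<in> borel_measurable MM"
      unfolding indicator_def by measurable
    show "integrable MM (\<lambda>p. indicator apart p * (1 - Wp True m p - Wp False m p))"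
    proof (intro integrable_bounded[where B = 1])
      fix p
      show "\<bar>indicator apart p * (1 - Wp True m p - Wp False m p)\<bar> \<le> 1"
        using W_01[of True m "fst p" "snd p"] W_01[of False m "fst p" "snd p"] W_sum_le[of m "fst p" "snd p"]
        by (auto simp: indicator_def)
    qed measurable
    show "integrable MM (\<lambda>p. on_cells m g p)"
      using g01 by (intro integrable_bounded[where B = 1]) auto
  qed
  also have "\<dots> = (\<Sum>i<4 ^ m. \<Sum>j<4 ^ m. g i j * (\<mu> m i * \<mu> m j))" by (rule integral_step)
  also have "\<dots> = (\<Sum>i<4 ^ m. if \<not> early m i then \<mu> m i * \<mu> m i - e True m i i - e False m i i else 0)"
  proof (rule sum.cong[OF refl])
    fix i :: nat assume i: "i \<in> {..<4 ^ m}"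
    have "(\<Sum>j<4 ^ m. g i j * (\<mu> m i * \<mu> m j)) = (\<Sum>j<4 ^ m. if j = i then g i i * (\<mu> m i * \<mu> m i) else 0)"
      by (intro sum.cong refl) (auto simp: g_def)
    also have "\<dots> = g i i * (\<mu> m i * \<mu> m i)" using i by simp
    also have "\<dots> = (if \<not> early m i then \<mu> m i * \<mu> m i - e True m i i - e False m i i else 0)"
    proof (cases "early m i")
      case False
      then have "g i i = 1 - ?d True i i - ?d False i i" by (simp add: g_def)
      then have "g i i * (\<mu> m i * \<mu> m i)
        = \<mu> m i * \<mu> m i - \<mu> m i * \<mu> m i * ?d True i i - \<mu> m i * \<mu> m i * ?d False i i"
      proof -
        have "(1 - x - y) * t = t - t * x - t * y" for x y t :: real by (simp add: algebra_simps)
        then show ?thesis using \<open>g i i = 1 - ?d True i i - ?d False i i\<close> by (simp only:)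
      qed
      then show ?thesis unfolding mu_mult_dens using False by simp
    qed (simp add: g_def)
    finally show "(\<Sum>j<4 ^ m. g i j * (\<mu> m i * \<mu> m j)) = \<dots>" .
  qed
  also have "\<dots> = (\<Sum>i | i < 4 ^ m \<and> \<not> early m i. \<mu> m i * \<mu> m i - e True m i i - e False m i i)"
    by (subst sum.inter_filter[symmetric]) (auto intro!: sum.cong)
  also have "\<dots> \<le> 1 / m" by (rule e_diag[OF assms])
  finally show ?thesis .
qed

text \<open>The counterpart of \<open>hom_step_kernel\<close> on the limit space: the tuples are
  grouped into boxes of cells, whose measure is a product.\<close>

lemma integral_PiM_step:
  assumes I: "finite I" and R: "R \<subseteq> I \<times> I"
  shows "(\<integral>x. (\<Prod>q\<in>R. g q (\<kappa> m (x (fst q))) (\<kappa> m (x (snd q)))) \<partial>PiM I (\<lambda>_. M))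
    = (\<Sum>\<iota>\<in>PiE I (\<lambda>_. {..<4 ^ m}). (\<Prod>i\<in>I. \<mu> m (\<iota> i)) * (\<Prod>q\<in>R. g q (\<iota> (fst q)) (\<iota> (snd q)) :: real))"
proof -
  interpret P: finite_product_prob_space "\<lambda>_. M" I by unfold_locales (rule I)
  let ?G = "\<lambda>\<iota>. \<Prod>q\<in>R. g q (\<iota> (fst q)) (\<iota> (snd q))"
  let ?box = "\<lambda>\<iota>. PiE I (\<lambda>i. cell m (\<iota> i))"
  have fin: "finite (PiE I (\<lambda>_. {..<(4::nat) ^ m}))" using I by (intro finite_PiE) auto
  have box: "?box \<iota> \<in> sets (PiM I (\<lambda>_. M))" for \<iota> using I by (intro sets_PiM_I_finite) auto
  have "(\<integral>x. (\<Prod>q\<in>R. g q (\<kappa> m (x (fst q))) (\<kappa> m (x (snd q)))) \<partial>PiM I (\<lambda>_. M))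
    = (\<integral>x. (\<Sum>\<iota>\<in>PiE I (\<lambda>_. {..<4 ^ m}). ?G \<iota> * indicator (?box \<iota>) x) \<partial>PiM I (\<lambda>_. M))"
  proof (intro Bochner_Integration.integral_cong refl)
    fix x assume x: "x \<in> space (PiM I (\<lambda>_. M))"
    define \<kappa>x where "\<kappa>x = restrict (\<lambda>i. \<kappa> m (x i)) I"
    have xi: "x i \<in> space M" if "i \<in> I" for i using x that by (auto simp: space_PiM)
    have \<kappa>x: "\<kappa>x \<in> PiE I (\<lambda>_. {..<4 ^ m})" using xi \<kappa>_less by (auto simp: \<kappa>x_def)
    have "indicator (?box \<iota>) x = (if \<iota> = \<kappa>x then 1 else 0 :: real)" if "\<iota> \<in> PiE I (\<lambda>_. {..<4 ^ m})" for \<iota>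
    proof -
      have "x \<in> ?box \<iota> \<longleftrightarrow> (\<forall>i\<in>I. \<kappa> m (x i) = \<iota> i)"
        using x by (auto simp: space_PiM PiE_iff cell_def)
      also have "\<dots> \<longleftrightarrow> \<iota> = \<kappa>x"
      proof
        assume "\<forall>i\<in>I. \<kappa> m (x i) = \<iota> i"
        then show "\<iota> = \<kappa>x" by (intro PiE_ext[OF that \<kappa>x]) (simp add: \<kappa>x_def)
      qed (simp add: \<kappa>x_def)
      finally show ?thesis by (simp add: indicator_def)
    qed
    then have "(\<Sum>\<iota>\<in>PiE I (\<lambda>_. {..<4 ^ m}). ?G \<iota> * indicator (?box \<iota>) x)
      = (\<Sum>\<iota>\<in>PiE I (\<lambda>_. {..<4 ^ m}). if \<iota> = \<kappa>x then ?G \<kappa>x else 0)"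
      by (intro sum.cong refl) auto
    also have "\<dots> = ?G \<kappa>x" using \<kappa>x fin by simp
    also have "\<dots> = (\<Prod>q\<in>R. g q (\<kappa> m (x (fst q))) (\<kappa> m (x (snd q))))"
    proof (intro prod.cong refl)
      fix q assume "q \<in> R"
      then have "fst q \<in> I" "snd q \<in> I" using R by auto
      then show "g q (\<kappa>x (fst q)) (\<kappa>x (snd q)) = g q (\<kappa> m (x (fst q))) (\<kappa> m (x (snd q)))" by (simp add: \<kappa>x_def)
    qed
    finally show "(\<Prod>q\<in>R. g q (\<kappa> m (x (fst q))) (\<kappa> m (x (snd q))))
      = (\<Sum>\<iota>\<in>PiE I (\<lambda>_. {..<4 ^ m}). ?G \<iota> * indicator (?box \<iota>) x)" ..
  qed
  also have "\<dots> = (\<Sum>\<iota>\<in>PiE I (\<lambda>_. {..<4 ^ m}). ?G \<iota> * measure (PiM I (\<lambda>_. M)) (?box \<iota>))"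
  proof (subst Bochner_Integration.integral_sum)
    show "integrable (PiM I (\<lambda>_. M)) (\<lambda>x. ?G \<iota> * indicator (?box \<iota>) x)" for \<iota>
      using box by (intro integrable_mult_right integrable_real_indicator) (auto simp: P.P.emeasure_eq_measure)
    show "(\<Sum>\<iota>\<in>PiE I (\<lambda>_. {..<4 ^ m}). \<integral>x. ?G \<iota> * indicator (?box \<iota>) x \<partial>PiM I (\<lambda>_. M))
      = (\<Sum>\<iota>\<in>PiE I (\<lambda>_. {..<4 ^ m}). ?G \<iota> * measure (PiM I (\<lambda>_. M)) (?box \<iota>))"
      using box by (intro sum.cong refl) simp
  qed
  also have "\<dots> = (\<Sum>\<iota>\<in>PiE I (\<lambda>_. {..<4 ^ m}). (\<Prod>i\<in>I. \<mu> m (\<iota> i)) * ?G \<iota>)"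
    by (intro sum.cong refl) (subst P.prob_times, auto simp: measure_cell)
  finally show ?thesis .
qed

lemma PiM_pair_measurable:
  assumes "a \<in> I" "b \<in> I" "(\<lambda>p. f (fst p) (snd p)) \<in> borel_measurable MM"
  shows "(\<lambda>x. f (x a) (x b)) \<in> borel_measurable (PiM I (\<lambda>_. M))"
proof -
  have "(\<lambda>x. (x a, x b)) \<in> PiM I (\<lambda>_. M) \<rightarrow>\<^sub>M MM" using assms(1,2) by measurable
  from measurable_comp[OF this assms(3)] show ?thesis by (simp add: comp_def)
qed

lemma AE_PiM_pair:
  assumes "a \<in> I" "b \<in> I" "a \<noteq> b" "AE p in MM. Q (fst p) (snd p)"
  shows "AE x in PiM I (\<lambda>_. M). Q (x a) (x b)"
proof -
  have m: "(\<lambda>x. (x a, x b)) \<in> PiM I (\<lambda>_. M) \<rightarrow>\<^sub>M MM" using assms(1,2) by measurable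
  have d: "distr (PiM I (\<lambda>_. M)) MM (\<lambda>x. (x a, x b)) = MM"
    by (rule distr_PiM_pair[of "\<lambda>_. M" a I b, OF prob assms(1-3)])
  have "AE p in distr (PiM I (\<lambda>_. M)) MM (\<lambda>x. (x a, x b)). Q (fst p) (snd p)"
    unfolding d by (rule assms(4))
  from AE_distrD[OF m this] show ?thesis by simp
qed

end

locale limit_kernel = limit_space +
  fixes ms
  assumes ms: "strict_mono ms" and conv: "\<And>b. AE p in MM. convergent (\<lambda>k. Wp b (ms k) p)"
begin

text \<open>Where the sequence diverges \<open>lim\<close> is an unspecified value, but this happens
  only on a null set. Symmetry holds everywhere all the same, because the two sequences
  coincide.\<close>

definition WL where "WL b x y = lim (\<lambda>k. W b (ms k) x y)"

lemma WL_sym: "WL b x y = WL b y x" unfolding WL_def W_sym[of b _ x y] ..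

abbreviation WLp where "WLp b p \<equiv> WL b (fst p) (snd p)"

lemma WL_measurable [measurable]: "(\<lambda>p. WLp b p) \<in> borel_measurable MM"
  unfolding WL_def by (rule borel_measurable_lim_metric) measurable

lemma WL_lim: "AE p in MM. (\<lambda>k. Wp b (ms k) p) \<longlonglongrightarrow> WLp b p"
  using conv[of b] unfolding WL_def by eventually_elim (simp add: convergent_LIMSEQ_iff)

lemma integral_W_tendsto:
  assumes [measurable]: "h \<in> borel_measurable MM" and h: "\<And>p. \<bar>h p\<bar> \<le> 1"
  shows "(\<lambda>k. \<integral>p. h p * Wp b (ms k) p \<partial>MM) \<longlonglongrightarrow> (\<integral>p. h p * WLp b p \<partial>MM)"
proof (rule integral_dominated_convergence[where w = "\<lambda>_. 1"])
  show "AE p in MM. (\<lambda>k. h p * Wp b (ms k) p) \<longlonglongrightarrow> h p * WLp b p"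
    using WL_lim[of b] by eventually_elim (intro tendsto_intros)
  show "AE p in MM. norm (h p * Wp b (ms k) p) \<le> 1" for k
    using h W_01 by (intro AE_I2) (auto simp: abs_mult intro!: mult_le_one)
qed auto

definition Z where "Z b = {p \<in> space MM. WLp b p = 0}"

lemma Z_sets [measurable]: "Z b \<in> sets MM" unfolding Z_def by measurable

text \<open>By dominated convergence the limit is the integral of \<open>WL b\<close> over its own
  zero set. It measures the weight of the pairs that must change colour.\<close>

lemma integral_W_Z: "(\<lambda>k. \<integral>p. Wp b (ms k) p * indicator (Z b) p \<partial>MM) \<longlonglongrightarrow> 0"
proof -
  have "(\<lambda>k. \<integral>p. indicator (Z b) p * Wp b (ms k) p \<partial>MM) \<longlonglongrightarrow> (\<integral>p. indicator (Z b) p * WLp b p \<partial>MM)"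
    by (intro integral_W_tendsto) (auto simp: indicator_def)
  moreover have "(\<integral>p. indicator (Z b) p * WLp b p \<partial>MM) = (\<integral>p. 0 \<partial>MM)"
    by (intro Bochner_Integration.integral_cong refl) (auto simp: Z_def indicator_def)
  ultimately show ?thesis by (simp add: mult.commute)
qed

text \<open>The defect is nonnegative and its integral at level \<open>ms k\<close> is at most
  \<open>1 / ms k\<close>. So the limit defect is nonnegative with integral 0.\<close>

lemma WL_sum_1: "AE p in MM. same_atom (fst p) (snd p) \<or> WLp True p + WLp False p = 1"
proof -
  let ?h = "\<lambda>p. indicator apart p :: real"
  let ?D = "\<lambda>k p. ?h p * (1 - Wp True (ms k) p - Wp False (ms k) p)"
  let ?DL = "\<lambda>p. ?h p * (1 - WLp True p - WLp False p)"
  have [measurable]: "?h \<in> borel_measurable MM" unfolding indicator_def by measurable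
  have D01: "0 \<le> ?D k p" "?D k p \<le> 1" for k p
    using W_01[of True "ms k" "fst p" "snd p"] W_01[of False "ms k" "fst p" "snd p"] W_sum_le[of "ms k" "fst p" "snd p"]
    by (auto simp: indicator_def)
  have lim: "AE p in MM. (\<lambda>k. ?D k p) \<longlonglongrightarrow> ?DL p"
    using WL_lim[of True] WL_lim[of False] by eventually_elim (intro tendsto_intros)
  have "(\<lambda>k. \<integral>p. ?D k p \<partial>MM) \<longlonglongrightarrow> (\<integral>p. ?DL p \<partial>MM)"
  proof (rule integral_dominated_convergence[where w = "\<lambda>_. 1"])
    show "AE p in MM. norm (?D k p) \<le> 1" for k using D01 by (intro AE_I2) simp
  qed (use lim in measurable)
  moreover have "(\<lambda>k. \<integral>p. ?D k p \<partial>MM) \<longlonglongrightarrow> 0"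
  proof (rule real_tendsto_sandwich)
    show "\<forall>\<^sub>F k in sequentially. 0 \<le> (\<integral>p. ?D k p \<partial>MM)"
      using D01 by (intro always_eventually allI integral_nonneg_AE AE_I2)
    have "(\<integral>p. ?D k p \<partial>MM) \<le> 1 / k" if "k > 0" for k
    proof -
      have "k \<le> ms k" using ms by (rule strict_mono_imp_increasing)
      then have "(\<integral>p. ?D k p \<partial>MM) \<le> 1 / ms k" using that by (intro integral_defect_le) auto
      also have "\<dots> \<le> 1 / k" using that \<open>k \<le> ms k\<close> by (intro divide_left_mono) auto
      finally show ?thesis .
    qed
    then show "\<forall>\<^sub>F k in sequentially. (\<integral>p. ?D k p \<partial>MM) \<le> 1 / k"
      using eventually_gt_at_top[of 0] by (rule eventually_mono[rotated])
  qed (auto intro: lim_1_over_n)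
  ultimately have 0: "(\<integral>p. ?DL p \<partial>MM) = 0" using LIMSEQ_unique by blast
  have DL01: "AE p in MM. 0 \<le> ?DL p \<and> ?DL p \<le> 1"
    using lim
  proof eventually_elim
    case (elim p)
    show ?case using LIMSEQ_le_const[OF elim, of 0] LIMSEQ_le_const2[OF elim, of 1] D01 by blast
  qed
  have "AE p in MM. ?DL p = 0"
  proof (subst integral_nonneg_eq_0_iff_AE[symmetric])
    show "integrable MM ?DL"
      using DL01 by (intro PP.P.integrable_const_bound[where B = 1]) (auto elim: eventually_mono)
  qed (use 0 DL01 in \<open>auto elim: eventually_mono\<close>)
  then show ?thesis by eventually_elim (auto simp: indicator_def split: if_splits)
qed

text \<open>The product of the limit densities is nonnegative with integral 0, hence it is 0 almost
  everywhere, and so is one of its factors. Pairs \<open>(a, a)\<close> must be excluded since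
  statements almost everywhere on \<open>MM\<close> say nothing about the diagonal.\<close>

lemma AE_prod_WL_0:
  assumes I: "finite I" and R: "R \<subseteq> I \<times> I" "\<And>a. (a, a) \<notin> R"
    and lim: "(\<lambda>m. \<Sum>\<iota>\<in>PiE I (\<lambda>_. {..<4 ^ m}). (\<Prod>i\<in>I. \<mu> m (\<iota> i)) *
      (\<Prod>q\<in>R. e (c q) m (\<iota> (fst q)) (\<iota> (snd q)) / (\<mu> m (\<iota> (fst q)) * \<mu> m (\<iota> (snd q))))) \<longlonglongrightarrow> 0"
  shows "AE x in PiM I (\<lambda>_. M). \<exists>q\<in>R. WL (c q) (x (fst q)) (x (snd q)) = 0"
proof -
  interpret P: finite_product_prob_space "\<lambda>_. M" I by unfold_locales (rule I)
  let ?P = "PiM I (\<lambda>_. M)"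
  let ?PL = "\<lambda>x. \<Prod>q\<in>R. WL (c q) (x (fst q)) (x (snd q))"
  let ?PW = "\<lambda>m x. \<Prod>q\<in>R. W (c q) m (x (fst q)) (x (snd q))"
  have finR: "finite R" using I R(1) finite_subset by blast
  have Rq: "fst q \<in> I" "snd q \<in> I" "fst q \<noteq> snd q" if "q \<in> R" for q
    using R that by (cases q; auto)+
  have [measurable]: "(\<lambda>x. W (c q) m (x (fst q)) (x (snd q))) \<in> borel_measurable ?P" if "q \<in> R" for q m
    using Rq[OF that] W_measurable by (intro PiM_pair_measurable)
  have [measurable]: "(\<lambda>x. WL (c q) (x (fst q)) (x (snd q))) \<in> borel_measurable ?P" if "q \<in> R" for q
    using Rq[OF that] WL_measurable by (intro PiM_pair_measurable)
  have "AE x in ?P. \<forall>q\<in>R. (\<lambda>k. W (c q) (ms k) (x (fst q)) (x (snd q))) \<longlonglongrightarrow> WL (c q) (x (fst q)) (x (snd q))"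
    by (intro AE_finite_allI finR AE_PiM_pair[where Q = "\<lambda>x y. (\<lambda>k. W _ (ms k) x y) \<longlonglongrightarrow> WL _ x y"] Rq WL_lim)
  then have plim: "AE x in ?P. (\<lambda>k. \<Prod>q\<in>R. W (c q) (ms k) (x (fst q)) (x (snd q))) \<longlonglongrightarrow> (?PL x)"
    by eventually_elim (auto intro: tendsto_prod)
  have pr01: "0 \<le> (?PW m x) \<and> (?PW m x) \<le> 1" for m x
    using W_01 by (auto intro!: prod_nonneg prod_le_1)
  have "(\<lambda>k. \<integral>x. (?PW (ms k) x) \<partial>?P) \<longlonglongrightarrow> (\<integral>x. (?PL x) \<partial>?P)"
  proof (rule integral_dominated_convergence[where w = "\<lambda>_. 1"])
    show "AE x in ?P. norm (?PW (ms k) x) \<le> 1" for k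
      using pr01 by (intro AE_I2) simp
  qed (use plim in \<open>measurable\<close>)
  moreover have "(\<lambda>m. \<integral>x. (?PW m x) \<partial>?P) \<longlonglongrightarrow> 0"
  proof -
    have "(\<integral>x. (?PW m x) \<partial>?P) =
      (\<Sum>\<iota>\<in>PiE I (\<lambda>_. {..<4 ^ m}). (\<Prod>i\<in>I. \<mu> m (\<iota> i)) *
      (\<Prod>q\<in>R. e (c q) m (\<iota> (fst q)) (\<iota> (snd q)) / (\<mu> m (\<iota> (fst q)) * \<mu> m (\<iota> (snd q)))))" for m
      unfolding W_def
      by (rule integral_PiM_step[OF I R(1), of "\<lambda>q i j. e (c q) m i j / (\<mu> m i * \<mu> m j)" m])
    then show ?thesis using lim by simp
  qed
  then have "(\<lambda>k. \<integral>x. (?PW (ms k) x) \<partial>?P) \<longlonglongrightarrow> 0"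
    using LIMSEQ_subseq_LIMSEQ[OF _ ms] by (auto simp: comp_def)
  ultimately have 0: "(\<integral>x. (?PL x) \<partial>?P) = 0" using LIMSEQ_unique by blast
  have L01: "AE x in ?P. 0 \<le> (?PL x) \<and> (?PL x) \<le> 1"
    using plim
  proof eventually_elim
    case (elim x)
    show ?case using LIMSEQ_le_const[OF elim, of 0] LIMSEQ_le_const2[OF elim, of 1] pr01[of _ x] by auto
  qed
  have "AE x in ?P. (?PL x) = 0"
  proof (subst integral_nonneg_eq_0_iff_AE[symmetric])
    show "integrable ?P (\<lambda>x. \<Prod>q\<in>R. WL (c q) (x (fst q)) (x (snd q)))"
      using L01 by (intro P.P.integrable_const_bound[where B = 1]) (auto elim: eventually_mono)
  qed (use 0 L01 in \<open>auto elim: eventually_mono\<close>)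
  then show ?thesis by eventually_elim (use finR in auto)
qed

end

section \<open>Sampling and extending graphs\<close>

text \<open>Both colours are 0 on the diagonal, so a nonzero value also certifies that the two
  vertices differ.\<close>

definition adj :: "'a ugraph \<Rightarrow> bool \<Rightarrow> 'a \<Rightarrow> 'a \<Rightarrow> real" where
  "adj G b v w = (if v \<noteq> w \<and> ({v, w} \<in> edges G \<longleftrightarrow> b) then 1 else 0)"

text \<open>Every unordered pair in exactly one direction. Counting exchanges one factor at a time
  and requires that no other factor join the same two vertices.\<close>

definition orientation :: "'a set \<Rightarrow> ('a \<times> 'a) set \<Rightarrow> bool" where
  "orientation I R \<longleftrightarrow> R \<subseteq> I \<times> I \<and> (\<forall>a b. (a, b) \<in> R \<longrightarrow> (b, a) \<notin> R) \<and>
     (\<forall>a\<in>I. \<forall>b\<in>I. a \<noteq> b \<longrightarrow> (a, b) \<in> R \<or> (b, a) \<in> R)"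

lemma exists_orientation:
  assumes "finite I"
  obtains R where "orientation I R"
proof -
  obtain f :: "'a \<Rightarrow> nat" where f: "inj_on f I" using finite_imp_inj_to_nat_seg[OF assms] by blast
  have "orientation I {(a, b) \<in> I \<times> I. f a < f b}"
    unfolding orientation_def using f by (auto simp: inj_on_def) (metis linorder_neqE_nat)
  then show ?thesis by (rule that)
qed

lemma property_is_graph: "graph_property P \<Longrightarrow> G \<in> P \<Longrightarrow> is_graph G"
  unfolding graph_property_def by blast

lemma edge_not_singleton:
  assumes "is_graph G" shows "{x} \<notin> edges G"
proof
  assume "{x} \<in> edges G"
  then have "{x} \<in> nsets (verts G) 2" using assms unfolding is_graph_def by blast
  then show False by (simp add: nsets_def)
qed

lemma weighted_graph_imp_weighted_set:
  assumes "weighted_graph G D" shows "weighted_set (verts G) (pmf D)"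
proof
  show "finite (verts G)" using assms by (simp add: weighted_graph_def is_graph_def)
  then show "sum (pmf D) (verts G) = 1" using assms by (intro sum_pmf_eq_1) (auto simp: weighted_graph_def)
qed simp

section \<open>Independent blocks inside a sample\<close>

lemma measure_pair_pmf_times:
  "measure (pair_pmf p q) (A \<times> B) = measure p A * measure q B"
proof -
  have "measure (pair_pmf p q) (A \<times> B) = measure (pair_pmf p q) ((A \<times> B) \<inter> set_pmf (pair_pmf p q))"
    by (rule measure_Int_set_pmf[symmetric])
  also have "(A \<times> B) \<inter> set_pmf (pair_pmf p q) = (A \<inter> set_pmf p) \<times> (B \<inter> set_pmf q)" by auto
  also have "measure (pair_pmf p q) \<dots> = measure p (A \<inter> set_pmf p) * measure q (B \<inter> set_pmf q)"
    by (intro measure_pmf_prob_product countable_Int2 countable_set_pmf)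
  finally show ?thesis by (simp add: measure_Int_set_pmf)
qed

text \<open>The \<open>t\<close> blocks of length \<open>k\<close> use disjoint coordinates, so they
  are independent, and each is a copy of the law on \<open>I\<close>. That \<open>H\<close> looks
  only at coordinates in \<open>I\<close> makes it insensitive to the default values outside a
  block.\<close>

lemma prob_no_block:
  fixes D :: "'a pmf" and I :: "'i set" and g :: "'i \<Rightarrow> nat" and H :: "('i \<Rightarrow> 'a) set"
  assumes g: "bij_betw g I {..<k}" and I: "finite I"
    and H: "\<And>\<phi> \<psi>. (\<And>i. i \<in> I \<Longrightarrow> \<phi> i = \<psi> i) \<Longrightarrow> \<phi> \<in> H \<longleftrightarrow> \<psi> \<in> H"
  shows "measure (iid_samples (t * k) D) {u. \<forall>j<t. (\<lambda>i. u (j * k + g i)) \<notin> H}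
    = (1 - measure (Pi_pmf I undefined (\<lambda>_. D)) H) ^ t"
proof (induction t)
  case (Suc t)
  let ?A = "{..<t * k}" and ?B = "{t * k..<t * k + k}"
  let ?p = "Pi_pmf ?A undefined (\<lambda>_. D)" and ?q = "Pi_pmf ?B undefined (\<lambda>_. D)"
  let ?S = "\<lambda>t. {u. \<forall>j<t. (\<lambda>i. u (j * k + g i)) \<notin> H}"
  let ?T = "{u. (\<lambda>i. u (t * k + g i)) \<notin> H}"
  have gk: "g i < k" if "i \<in> I" for i using g that by (auto simp: bij_betw_def)
  have un: "{..<Suc t * k} = ?A \<union> ?B" by auto
  let ?f = "\<lambda>(f, h) x. if x \<in> ?A then f x else h x"
  have pre: "?f -` ?S (Suc t) = ?S t \<times> ?T"
  proof -
    have *: "(\<lambda>i. (if j * k + g i \<in> ?A then f (j * k + g i) else h (j * k + g i))) \<in> H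
      \<longleftrightarrow> (if j < t then (\<lambda>i. f (j * k + g i)) \<in> H else (\<lambda>i. h (t * k + g i)) \<in> H)" if "j < Suc t" for j f h
    proof (cases "j < t")
      case True
      have lt: "j * k + g i < t * k" if "i \<in> I" for i
      proof -
        have "j * k + g i < Suc j * k" using gk[OF that] by simp
        also have "\<dots> \<le> t * k" using True by (intro mult_le_mono1) simp
        finally show ?thesis .
      qed
      have "(\<lambda>i. (if j * k + g i \<in> ?A then f (j * k + g i) else h (j * k + g i))) \<in> H
        \<longleftrightarrow> (\<lambda>i. f (j * k + g i)) \<in> H"
        by (rule H) (simp add: lt)
      then show ?thesis using True by (simp only: if_True)
    next
      case False
      then have "j = t" using that by simp
      then show ?thesis by simp
    qed
    show ?thesis using * by (auto simp: less_Suc_eq)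
  qed
  have "measure (iid_samples (Suc t * k) D) (?S (Suc t)) = measure (map_pmf ?f (pair_pmf ?p ?q)) (?S (Suc t))"
    unfolding iid_samples_def un by (subst Pi_pmf_union) auto
  also have "\<dots> = measure (pair_pmf ?p ?q) (?S t \<times> ?T)" unfolding measure_map_pmf pre ..
  also have "\<dots> = measure ?p (?S t) * measure ?q ?T" by (rule measure_pair_pmf_times)
  also have "measure ?q ?T = 1 - measure (Pi_pmf I undefined (\<lambda>_. D)) H"
  proof -
    \<comment> \<open>Coordinates outside \<open>I\<close> are sent to an index outside the block,
      where the sample takes the default \<open>undefined\<close>, just as the law on
      \<open>I\<close> does there.\<close>
    define h where "h i = (if i \<in> I then t * k + g i else t * k + k)" for i
    have "bij_betw (\<lambda>x. t * k + x) {..<k} ?B"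
      by (intro bij_betwI[of _ _ _ "\<lambda>x. x - t * k"]) auto
    then have "bij_betw ((\<lambda>x. t * k + x) \<circ> g) I ?B" using g by (rule bij_betw_trans[rotated])
    then have "bij_betw h I ?B" by (rule bij_betw_cong[THEN iffD1, rotated]) (simp add: h_def)
    then have "Pi_pmf I undefined (\<lambda>_. D) = map_pmf (\<lambda>u. u \<circ> h) ?q"
      using I by (intro Pi_pmf_bij_betw) (auto simp: h_def)
    then have "measure (Pi_pmf I undefined (\<lambda>_. D)) H = measure ?q ((\<lambda>u. u \<circ> h) -` H)" by (simp add: measure_map_pmf)
    also have "(\<lambda>u. u \<circ> h) -` H = - ?T"
    proof -
      have "u \<circ> h \<in> H \<longleftrightarrow> (\<lambda>i. u (t * k + g i)) \<in> H" for u :: "nat \<Rightarrow> 'a" by (rule H) (simp add: h_def)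
      then show ?thesis by auto
    qed
    finally show ?thesis using measure_pmf.prob_compl[of ?T ?q] by (simp add: Compl_eq_Diff_UNIV)
  qed
  finally show ?case using Suc by (simp add: iid_samples_def)
qed simp

text \<open>A hit is an induced copy of \<open>F\<close>, injective because \<open>adj\<close>
  vanishes on the diagonal. If the sampled graph had the property, heredity and closure under
  isomorphism would pass it on to \<open>F\<close>.\<close>

lemma hit_imp_not_in_property:
  assumes P: "graph_property P" "hereditary P" and G: "is_graph G" and F: "is_graph F" "F \<notin> P"
    and R: "orientation (verts F) R" and U: "U \<subseteq> verts G" and \<phi>: "\<phi> ` verts F \<subseteq> U"
    and hit: "\<And>a b. (a, b) \<in> R \<Longrightarrow> adj G ({a, b} \<in> edges F) (\<phi> a) (\<phi> b) \<noteq> 0"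
  shows "induced_subgraph G U \<notin> P"
proof
  assume in_P: "induced_subgraph G U \<in> P"
  let ?I = "verts F" and ?GU = "induced_subgraph G U"
  have hit': "\<phi> a \<noteq> \<phi> b \<and> ({\<phi> a, \<phi> b} \<in> edges G \<longleftrightarrow> {a, b} \<in> edges F)" if "a \<in> ?I" "b \<in> ?I" "a \<noteq> b" for a b
  proof -
    have "(a, b) \<in> R \<or> (b, a) \<in> R" using R that unfolding orientation_def by blast
    then show ?thesis using hit[of a b] hit[of b a] by (auto simp: adj_def insert_commute split: if_splits)
  qed
  then have inj: "inj_on \<phi> ?I" by (auto simp: inj_on_def)
  let ?W = "\<phi> ` ?I"
  have vGU: "verts ?GU = U" using U by (auto simp: induced_subgraph_def)
  have ne: "?I \<noteq> {}" using F by (simp add: is_graph_def)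
  have "verts ?GU - (verts ?GU - ?W) = ?W" using \<phi> vGU by auto
  then have H: "induced_subgraph ?GU ?W \<in> P" (is "?H \<in> P")
    using P(2) in_P ne unfolding hereditary_def by (metis image_is_empty)
  have vH: "verts ?H = ?W" using \<phi> U by (auto simp: induced_subgraph_def)
  have "graph_iso ?H F"
    unfolding graph_iso_def
  proof (intro exI[of _ "the_inv_into ?I \<phi>"] conjI ballI)
    show "bij_betw (the_inv_into ?I \<phi>) (verts ?H) ?I" unfolding vH
      using inj by (intro bij_betw_the_inv_into) (simp add: bij_betw_def)
    fix x y assume "x \<in> verts ?H" "y \<in> verts ?H"
    then obtain a b where ab: "a \<in> ?I" "b \<in> ?I" "x = \<phi> a" "y = \<phi> b" unfolding vH by auto
    have inv: "the_inv_into ?I \<phi> x = a" "the_inv_into ?I \<phi> y = b"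
      using ab inj by (auto simp: the_inv_into_f_f)
    have "{x, y} \<in> edges ?H \<longleftrightarrow> {x, y} \<in> edges G" using ab \<phi> by (auto simp: induced_subgraph_def)
    \<comment> \<open>For \<open>a = b\<close> both sides are false, since singletons are not
      edges.\<close>
    also have "\<dots> \<longleftrightarrow> {a, b} \<in> edges F"
      using hit'[OF ab(1,2)] ab edge_not_singleton[OF G] edge_not_singleton[OF F(1)] by (cases "a = b") auto
    finally show "{x, y} \<in> edges ?H \<longleftrightarrow> {the_inv_into ?I \<phi> x, the_inv_into ?I \<phi> y} \<in> edges F"
      unfolding inv .
  qed
  then have "F \<in> P" using P(1) H F unfolding graph_property_def by blast
  then show False using F by simp
qed

text \<open>With kernels valued in 0 and 1 the product over \<open>R\<close> is an indicator, and
  the remaining weights are those of independent samples.\<close>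

lemma (in weighted_set) hom_eq_measure_Pi_pmf:
  assumes D: "d = pmf D" "set_pmf D \<subseteq> V" and I: "finite I" "finite R" and R: "R \<subseteq> I \<times> I"
    and K: "\<And>q v w. K q v w \<in> {0, 1}"
  shows "hom I R K = measure (Pi_pmf I undefined (\<lambda>_. D)) {\<phi>. \<forall>q\<in>R. K q (\<phi> (fst q)) (\<phi> (snd q)) \<noteq> 0}"
proof -
  let ?p = "Pi_pmf I undefined (\<lambda>_. D)"
  let ?H = "{\<phi>. \<forall>q\<in>R. K q (\<phi> (fst q)) (\<phi> (snd q)) \<noteq> 0}"
  have finE: "finite (PiE I (\<lambda>_. V))" using I fin by (intro finite_PiE) auto
  have "set_pmf ?p \<subseteq> PiE_dflt I undefined (\<lambda>_. set_pmf D)" using I by (simp add: set_Pi_pmf)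
  also have "\<dots> \<subseteq> PiE I (\<lambda>_. V)" using D(2) by (auto simp: PiE_dflt_def PiE_iff extensional_def)
  finally have supp: "set_pmf ?p \<subseteq> PiE I (\<lambda>_. V)" .
  have "measure ?p ?H = measure ?p (?H \<inter> set_pmf ?p)" by (simp add: measure_Int_set_pmf)
  also have "?H \<inter> set_pmf ?p = (?H \<inter> PiE I (\<lambda>_. V)) \<inter> set_pmf ?p" using supp by auto
  also have "measure ?p \<dots> = measure ?p (?H \<inter> PiE I (\<lambda>_. V))" by (rule measure_Int_set_pmf)
  also have "\<dots> = sum (pmf ?p) (?H \<inter> PiE I (\<lambda>_. V))"
    using finE by (intro measure_measure_pmf_finite) auto
  also have "\<dots> = (\<Sum>\<phi>\<in>PiE I (\<lambda>_. V). if \<phi> \<in> ?H then pmf ?p \<phi> else 0)"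
    using finE by (simp add: sum.inter_restrict Int_commute)
  also have "\<dots> = hom I R K"
    unfolding hom_def
  proof (intro sum.cong refl)
    fix \<phi> assume \<phi>: "\<phi> \<in> PiE I (\<lambda>_. V)"
    then have "pmf ?p \<phi> = (\<Prod>i\<in>I. d (\<phi> i))"
      unfolding D(1) using I by (intro pmf_Pi') (auto simp: PiE_iff extensional_def)
    moreover have "(\<Prod>q\<in>R. K q (\<phi> (fst q)) (\<phi> (snd q))) = (if \<phi> \<in> ?H then 1 else 0)"
    proof (cases "\<phi> \<in> ?H")
      case True
      then have "K q (\<phi> (fst q)) (\<phi> (snd q)) = 1" if "q \<in> R" for q using K[of q "\<phi> (fst q)" "\<phi> (snd q)"] that by auto
      then show ?thesis using True by simp
    next
      case False
      then show ?thesis using I by (auto simp: prod_zero)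
    qed
    ultimately show "(if \<phi> \<in> ?H then pmf ?p \<phi> else 0) = (\<Prod>i\<in>I. d (\<phi> i)) * (\<Prod>q\<in>R. K q (\<phi> (fst q)) (\<phi> (snd q)))"
      by simp
  qed
  finally show ?thesis ..
qed

text \<open>With probability above 1/3 the sample has the property, and then none of its
  \<open>n div k\<close> disjoint blocks, \<open>k\<close> being the order of \<open>F\<close>, is
  an induced copy of \<open>F\<close>. So the probability that one block is such a copy is of order
  \<open>1 / n\<close>.\<close>

lemma hom_bound:
  assumes P: "graph_property P" "hereditary P" and G: "weighted_graph G D" and F: "is_graph F" "F \<notin> P"
    and R: "orientation (verts F) R"
    and pr: "measure (iid_samples n D) {u. induced_subgraph G (u ` {..<n}) \<notin> P} < 2 / 3"
  shows "weighted_set.hom (verts G) (pmf D) (verts F) R (\<lambda>q. adj G ({fst q, snd q} \<in> edges F)) * real n \<le> 3 * real (card (verts F))"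
    (is "?hom * _ \<le> _")
proof -
  interpret weighted_set "verts G" "pmf D" by (rule weighted_graph_imp_weighted_set[OF G])
  let ?I = "verts F" and ?k = "card (verts F)"
  have I: "finite ?I" "?I \<noteq> {}" using F by (auto simp: is_graph_def)
  have D: "set_pmf D \<subseteq> verts G" and gG: "is_graph G" using G by (auto simp: weighted_graph_def)
  have R': "R \<subseteq> ?I \<times> ?I" using R by (simp add: orientation_def)
  have finR: "finite R" using R' I finite_subset by blast
  define H where "H = {\<phi>. \<forall>q\<in>R. adj G ({fst q, snd q} \<in> edges F) (\<phi> (fst q)) (\<phi> (snd q)) \<noteq> 0}"
  have hom: "?hom = measure (Pi_pmf ?I undefined (\<lambda>_. D)) H"
    unfolding H_def using D I finR R' by (intro hom_eq_measure_Pi_pmf) (auto simp: adj_def)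
  obtain g where "bij_betw g ?I {0..<?k}" using ex_bij_betw_finite_nat[OF I(1)] by blast
  then have g: "bij_betw g ?I {..<?k}" by (simp add: atLeast0LessThan)
  define t where "t = n div ?k"
  let ?S = "{u. \<forall>j<t. (\<lambda>i. u (j * ?k + g i)) \<notin> H}"
  have le: "t * ?k \<le> n" by (simp add: t_def)
  have Hcong: "\<phi> \<in> H \<longleftrightarrow> \<psi> \<in> H" if "\<And>i. i \<in> ?I \<Longrightarrow> \<phi> i = \<psi> i" for \<phi> \<psi>
    unfolding H_def using that R' by (force)
  have small: "j * ?k + g i < t * ?k" if "j < t" "i \<in> ?I" for i j
  proof -
    have "g i < ?k" using g that by (auto simp: bij_betw_def)
    then have "j * ?k + g i < Suc j * ?k" by simp
    also have "\<dots> \<le> t * ?k" using that by (intro mult_le_mono1) simp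
    finally show ?thesis .
  qed
  have "1 / 3 < measure (iid_samples n D) {u. induced_subgraph G (u ` {..<n}) \<in> P}"
    using measure_pmf.prob_compl[of "{u. induced_subgraph G (u ` {..<n}) \<notin> P}" "iid_samples n D"] pr
    by (simp add: Collect_neg_eq[symmetric] Compl_eq_Diff_UNIV[symmetric] Compl_eq)
  also have "\<dots> = measure (iid_samples n D) ({u. induced_subgraph G (u ` {..<n}) \<in> P} \<inter> set_pmf (iid_samples n D))"
    by (simp add: measure_Int_set_pmf)
  also have "\<dots> \<le> measure (iid_samples n D) ?S"
  proof (intro measure_pmf.finite_measure_mono subsetI)
    fix u assume u: "u \<in> {u. induced_subgraph G (u ` {..<n}) \<in> P} \<inter> set_pmf (iid_samples n D)"
    have "set_pmf (iid_samples n D) \<subseteq> PiE_dflt {..<n} undefined (\<lambda>_. set_pmf D)"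
      unfolding iid_samples_def by (simp add: set_Pi_pmf)
    then have uV: "u ` {..<n} \<subseteq> verts G" using u D by (auto simp: PiE_dflt_def)
    show "u \<in> ?S"
    proof (intro CollectI allI impI notI)
      fix j assume j: "j < t" and h: "(\<lambda>i. u (j * ?k + g i)) \<in> H"
      have "(\<lambda>i. u (j * ?k + g i)) ` ?I \<subseteq> u ` {..<n}" using small[OF j] le by fastforce
      moreover have "adj G ({a, b} \<in> edges F) (u (j * ?k + g a)) (u (j * ?k + g b)) \<noteq> 0" if "(a, b) \<in> R" for a b
        using h that unfolding H_def by fastforce
      ultimately have "induced_subgraph G (u ` {..<n}) \<notin> P"
        by (intro hit_imp_not_in_property[OF P gG F R uV])
      then show False using u by simp
    qed
  qed simp
  also have "\<dots> = measure (iid_samples (t * ?k) D) ?S"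
  proof -
    have "iid_samples (t * ?k) D = map_pmf (\<lambda>f x. if x \<in> {..<t * ?k} then f x else undefined) (iid_samples n D)"
      unfolding iid_samples_def using le by (intro Pi_pmf_subset) auto
    then have "measure (iid_samples (t * ?k) D) ?S
       = measure (iid_samples n D) ((\<lambda>f x. if x \<in> {..<t * ?k} then f x else undefined) -` ?S)"
      by (simp add: measure_map_pmf)
    also have "(\<lambda>f x. if x \<in> {..<t * ?k} then f x else undefined) -` ?S = ?S"
    proof -
      have "(\<lambda>i. if j * ?k + g i \<in> {..<t * ?k} then f (j * ?k + g i) else undefined) \<in> H \<longleftrightarrow> (\<lambda>i. f (j * ?k + g i)) \<in> H"
        if "j < t" for j f
        using small[OF that] by (intro Hcong) auto
      then show ?thesis by auto
    qed
    finally show ?thesis ..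
  qed
  also have "\<dots> = (1 - ?hom) ^ t"
    unfolding hom by (rule prob_no_block[OF g I(1) Hcong])
  finally have p: "1 / 3 < (1 - ?hom) ^ t" .
  have h01: "0 \<le> ?hom" "?hom \<le> 1" unfolding hom by auto
  \<comment> \<open>Bernoulli's inequality gives an upper bound for the power without logarithms;
    against the lower bound 1/3 it leaves \<open>real t * ?hom\<close> at most 2.\<close>
  have "(1 - ?hom) ^ t * (1 + real t * ?hom) \<le> (1 - ?hom) ^ t * (1 + ?hom) ^ t"
    using h01 Bernoulli_inequality[of ?hom t] by (intro mult_left_mono) auto
  also have "\<dots> = (1 - ?hom\<^sup>2) ^ t"
    by (simp add: power_mult_distrib[symmetric] power2_eq_square algebra_simps)
  also have "\<dots> \<le> 1" using h01 by (intro power_le_one) (auto simp: power_le_one)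
  finally have "(1 - ?hom) ^ t * (1 + real t * ?hom) \<le> 1" .
  moreover have "1 / 3 * (1 + real t * ?hom) \<le> (1 - ?hom) ^ t * (1 + real t * ?hom)"
    using p h01 by (intro mult_right_mono) auto
  ultimately have "1 / 3 * (1 + real t * ?hom) \<le> 1" by (rule order_trans[rotated])
  then have "real t * ?hom \<le> 2" by simp
  then have "real t * ?hom * real ?k \<le> 2 * real ?k" by (rule mult_right_mono) simp
  \<comment> \<open>The samples after the last full block add at most one further \<open>?k\<close>,
    which makes the constant 2 + 1 = 3.\<close>
  moreover have "?hom * real (n mod ?k) \<le> 1 * real ?k"
  proof (intro mult_mono h01)
    have "?k > 0" using I by (simp add: card_gt_0_iff)
    then show "real (n mod ?k) \<le> real ?k" by (simp add: less_imp_le)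
  qed auto
  moreover have "real n = real t * real ?k + real (n mod ?k)"
    unfolding t_def of_nat_mult[symmetric] of_nat_add[symmetric] by simp
  ultimately show ?thesis by (simp add: algebra_simps)
qed

text \<open>Extendability does not control which new vertex \<open>y\<close> appears. Renaming
  \<open>y\<close> to the wanted \<open>z\<close> fixes \<open>G\<close> pointwise, and the property
  is closed under isomorphism.\<close>

lemma extend_by_vertex:
  assumes P: "graph_property P" "extendable P" and G: "G \<in> P" and z: "z \<notin> verts G"
  obtains H where "H \<in> P" "verts H = insert z (verts G)" "induced_subgraph H (verts G) = G"
proof -
  obtain H where H: "H \<in> P" "card (verts H) = card (verts G) + 1" "verts G \<subseteq> verts H"
      "induced_subgraph H (verts G) = G"
    using P(2) G unfolding extendable_def by blast
  note gH = property_is_graph[OF P(1) H(1)] and gG = property_is_graph[OF P(1) G]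
  have "finite (verts G)" using gG by (simp add: is_graph_def)
  from card_Diff_subset[OF this H(3)] have "card (verts H - verts G) = 1" using H(2) by simp
  then obtain y where y: "verts H - verts G = {y}" by (auto simp only: card_1_singleton_iff One_nat_def)
  then have vH: "verts H = insert y (verts G)" "y \<notin> verts G" using H(3) by auto
  define f where "f x = (if x = y then z else x)" for x
  have inj: "inj_on f (verts H)" using z vH by (auto simp: f_def inj_on_def)
  have img: "f ` verts H = insert z (verts G)" using vH by (auto simp: f_def)
  define H' where "H' = \<lparr>verts = f ` verts H, edges = (`) f ` edges H\<rparr>"
  have eH: "e \<subseteq> verts H \<and> finite e \<and> card e = 2" if "e \<in> edges H" for e
    using gH that unfolding is_graph_def nsets_def by blast
  have gH': "is_graph H'"
  proof -
    have "f ` e \<in> nsets (f ` verts H) 2" if "e \<in> edges H" for e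
      using eH[OF that] inj_on_subset[OF inj, of e] by (auto simp: nsets_def card_image)
    then show ?thesis using gH by (auto simp: is_graph_def H'_def)
  qed
  have edge: "f ` e \<in> edges H' \<longleftrightarrow> e \<in> edges H" if "e \<subseteq> verts H" for e
  proof
    assume "f ` e \<in> edges H'"
    then obtain e' where e': "e' \<in> edges H" "f ` e = f ` e'" by (auto simp: H'_def)
    then have "e = e'" using inj_on_image_eq_iff[OF inj that] eH by blast
    then show "e \<in> edges H" using e' by simp
  qed (simp add: H'_def)
  have "graph_iso H H'"
    unfolding graph_iso_def
  proof (intro exI[of _ f] conjI ballI)
    show "bij_betw f (verts H) (verts H')" using inj by (simp add: bij_betw_def H'_def)
    show "{x, y} \<in> edges H \<longleftrightarrow> {f x, f y} \<in> edges H'" if "x \<in> verts H" "y \<in> verts H" for x y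
      using edge[of "{x, y}"] that by simp
  qed
  then have "H' \<in> P" using P(1) H(1) gH' unfolding graph_property_def by blast
  moreover have "verts H' = insert z (verts G)" by (simp add: H'_def img)
  moreover have "induced_subgraph H' (verts G) = G"
  proof -
    have "edges (induced_subgraph H' (verts G)) = edges (induced_subgraph H (verts G))"
    proof (intro equalityI subsetI)
      fix e assume "e \<in> edges (induced_subgraph H' (verts G))"
      then have e: "e \<in> edges H'" "e \<subseteq> verts G" by (auto simp: induced_subgraph_def)
      have "f ` e = e" using e(2) vH(2) by (force simp: f_def image_def)
      then have "e \<in> edges H" using edge[of e] e H(3) by auto
      then show "e \<in> edges (induced_subgraph H (verts G))" using e by (simp add: induced_subgraph_def)
    next
      fix e assume "e \<in> edges (induced_subgraph H (verts G))"
      then have e: "e \<in> edges H" "e \<subseteq> verts G" by (auto simp: induced_subgraph_def)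
      have "f ` e = e" using e(2) vH(2) by (force simp: f_def image_def)
      then have "e \<in> edges H'" using edge[of e] e H(3) by auto
      then show "e \<in> edges (induced_subgraph H' (verts G))" using e by (simp add: induced_subgraph_def)
    qed
    moreover have "verts (induced_subgraph H' (verts G)) = verts (induced_subgraph H (verts G))"
      using H(3) by (auto simp: induced_subgraph_def H'_def img)
    ultimately show ?thesis using H(4) by (metis ugraph.equality old.unit.exhaust)
  qed
  ultimately show ?thesis by (rule that)
qed

lemma extend_to_superset:
  assumes P: "graph_property P" "extendable P" and G: "G \<in> P" and V: "finite V" "verts G \<subseteq> V"
  obtains H where "H \<in> P" "verts H = V" "induced_subgraph H (verts G) = G"
proof -
  have "\<exists>H\<in>P. verts H = verts G \<union> Z \<and> induced_subgraph H (verts G) = G" if "finite Z" "Z \<inter> verts G = {}" for Z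
    using that
  proof (induction Z rule: finite_induct)
    case empty
    have "is_graph G" by (rule property_is_graph[OF P(1) G])
    then have "induced_subgraph G (verts G) = G"
      by (cases G) (auto simp: induced_subgraph_def is_graph_def nsets_def)
    then show ?case using G by auto
  next
    case (insert z Z)
    then obtain H where H: "H \<in> P" "verts H = verts G \<union> Z" "induced_subgraph H (verts G) = G" by auto
    have "z \<notin> verts H" using insert H by auto
    from extend_by_vertex[OF P H(1) this] obtain H' where H': "H' \<in> P" "verts H' = insert z (verts H)"
      "induced_subgraph H' (verts H) = H" .
    have "induced_subgraph H' (verts G) = induced_subgraph (induced_subgraph H' (verts H)) (verts G)"
      using H(2) by (auto simp: induced_subgraph_def)
    then have "induced_subgraph H' (verts G) = G" using H' H by simp
    then show ?case using H' H by auto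
  qed
  from this[of "V - verts G"] show ?thesis using V that by (auto simp: Un_absorb1)
qed

text \<open>Tychonoff for a product of unit intervals; over a countable index type compactness gives
  sequential compactness.\<close>

lemma convergent_subsequence_pointwise:
  fixes f :: "nat \<Rightarrow> 'k :: countable \<Rightarrow> real"
  assumes "\<And>n k. f n k \<in> {0..1}"
  obtains r l where "strict_mono r" "\<And>k. (\<lambda>n. f (r n) k) \<longlonglongrightarrow> l k"
proof -
  have "compactin (product_topology (\<lambda>_. euclidean) UNIV) (PiE UNIV (\<lambda>_ :: 'k. {0..1 :: real}))"
    by (simp add: compactin_PiE)
  then have "compact (PiE UNIV (\<lambda>_ :: 'k. {0..1 :: real}))"
    by (simp add: euclidean_product_topology)
  then have "seq_compact (PiE UNIV (\<lambda>_ :: 'k. {0..1 :: real}))" by (rule compact_imp_seq_compact)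
  moreover have "\<forall>n. f n \<in> PiE UNIV (\<lambda>_. {0..1})" using assms by (auto simp: PiE_iff)
  ultimately obtain l r where lr: "strict_mono r" "(f \<circ> r) \<longlonglongrightarrow> l" using seq_compactE by blast
  have "(\<lambda>n. (f \<circ> r) n k) \<longlonglongrightarrow> l k" for k
  proof -
    have "continuous_on UNIV (\<lambda>x :: 'k \<Rightarrow> real. x k)" by (rule continuous_on_product_coordinates)
    then have "isCont (\<lambda>x :: 'k \<Rightarrow> real. x k) l" by (simp only: continuous_on_eq_continuous_at[OF open_UNIV] ball_UNIV)
    from isCont_tendsto_compose[OF this lr(2)] show ?thesis .
  qed
  then have "(\<lambda>n. f (r n) k) \<longlonglongrightarrow> l k" for k by simp
  then show ?thesis by (rule that[OF lr(1)])
qed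

section \<open>Convergence of coded graphs\<close>

locale coded = weighted_set V d for V :: "'v set" and d +
  fixes A :: "bool \<Rightarrow> 'v \<Rightarrow> 'v \<Rightarrow> real" and c :: "nat \<Rightarrow> 'v \<Rightarrow> nat"
  assumes A_sym: "A b v w = A b w v" and A_01: "A b v w \<in> {0..1}"
    and A_sum: "A True v w + A False v w = (if v = w then 0 else 1)"
    and c_0: "c 0 v = 0" and c_div: "c (Suc m) v div 4 = c m v"
    and c_unique: "atom (c (Suc m) v) \<Longrightarrow> atom (c (Suc m) w) \<Longrightarrow> v = w"
    and c_once: "atom (c (Suc m) v) \<Longrightarrow> atom (c (Suc k) v) \<Longrightarrow> m = k"
    and c_light: "v \<in> V \<Longrightarrow> (\<And>k. k < m \<Longrightarrow> \<not> atom (c (Suc k) v)) \<Longrightarrow> real m * d v \<le> 1"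
    and c_good: "m > 0 \<Longrightarrow> good (A b) (c m) (2 * sqrt (2 / real m))"
begin

lemma c_less: "c m v < 4 ^ m"
  by (rule code_less[of "\<lambda>m. c m v" m, OF c_div c_0])

lemma c_chain: "k \<le> m \<Longrightarrow> c k v = c m v div 4 ^ (m - k)"
  using div_pow_chain[of "\<lambda>m. c m v" k m] c_div by blast

lemma early_code: "early m (c m v) \<longleftrightarrow> (\<exists>k<m. atom (c (Suc k) v))"
proof -
  have "c (Suc k) v = c m v div 4 ^ (m - Suc k)" if "k < m" for k using c_chain[of "Suc k" m v] that by simp
  then show ?thesis unfolding early_def by auto
qed

abbreviation cls where "cls m i \<equiv> {v. v \<in> V \<and> c m v = i}"

lemma sum_cls_split:
  fixes f :: "'v \<Rightarrow> real"
  shows "(\<Sum>v\<in>cls m i. f v) = (\<Sum>r<4. \<Sum>v\<in>cls (Suc m) (4 * i + r). f v)"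
proof -
  have "cls m i = (\<Union>r\<in>{..<4}. cls (Suc m) (4 * i + r))"
  proof (intro equalityI subsetI)
    fix v assume v: "v \<in> cls m i"
    then have "c (Suc m) v = 4 * i + c (Suc m) v mod 4" using c_div[of m v] by auto
    moreover have "c (Suc m) v mod 4 < 4" by simp
    ultimately show "v \<in> (\<Union>r\<in>{..<4}. cls (Suc m) (4 * i + r))" using v by blast
  next
    fix v assume "v \<in> (\<Union>r\<in>{..<4}. cls (Suc m) (4 * i + r))"
    then obtain r where "r < 4" "v \<in> V" "c (Suc m) v = 4 * i + r" by auto
    then show "v \<in> cls m i" using c_div[of m v] by auto
  qed
  then show ?thesis using fin by (simp only:) (intro sum.UNION_disjoint; auto)
qed

lemma mass_split: "mass (c m) i = (\<Sum>r<4. mass (c (Suc m)) (4 * i + r))"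
  unfolding mass_def by (rule sum_cls_split)

lemma emass_split: "emass (A b) (c m) i j = (\<Sum>r<4. \<Sum>s<4. emass (A b) (c (Suc m)) (4 * i + r) (4 * j + s))"
proof -
  have "emass (A b) (c m) i j
    = (\<Sum>s<4. \<Sum>w\<in>cls (Suc m) (4 * j + s). \<Sum>r<4. \<Sum>v\<in>cls (Suc m) (4 * i + r). d w * d v * A b v w)"
    unfolding emass_def sum_cls_split[of _ m] ..
  also have "\<dots> = (\<Sum>s<4. \<Sum>r<4. \<Sum>w\<in>cls (Suc m) (4 * j + s). \<Sum>v\<in>cls (Suc m) (4 * i + r). d w * d v * A b v w)"
    by (rule sum.cong[OF refl], rule sum.swap)
  also have "\<dots> = (\<Sum>r<4. \<Sum>s<4. emass (A b) (c (Suc m)) (4 * i + r) (4 * j + s))"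
    unfolding emass_def by (rule sum.swap)
  finally show ?thesis .
qed

lemma mass_0: "mass (c 0) 0 = 1"
  using d_sum by (simp add: mass_def c_0)

lemma mass_out: "i \<ge> 4 ^ m \<Longrightarrow> mass (c m) i = 0"
  unfolding mass_def using c_less[of m] by (intro sum.neutral) (auto simp: not_less[symmetric])

lemma emass_nonneg: "emass (A b) c' i j \<ge> 0"
  unfolding emass_def using A_01 by (intro sum_nonneg mult_nonneg_nonneg d_nonneg) auto

lemma emass_sym: "emass (A b) c' i j = emass (A b) c' j i"
proof -
  have "emass (A b) c' i j = (\<Sum>v | v \<in> V \<and> c' v = i. \<Sum>w | w \<in> V \<and> c' w = j. d w * d v * A b v w)"
    unfolding emass_def by (rule sum.swap)
  also have "\<dots> = emass (A b) c' j i"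
    unfolding emass_def
  proof (intro sum.cong refl)
    fix v w show "d w * d v * A b v w = d v * d w * A b w v" unfolding A_sym[of b v w] by simp
  qed
  finally show ?thesis .
qed

text \<open>The two colours together cover every ordered pair of distinct vertices, so only the
  pairs \<open>(v, v)\<close> are missing.\<close>

lemma emass_sum:
  "mass c' i * mass c' j - (emass (A True) c' i j + emass (A False) c' i j)
   = (if i = j then (\<Sum>v | v \<in> V \<and> c' v = i. (d v)\<^sup>2) else 0)"
proof -
  have "mass c' i * mass c' j = (\<Sum>w | w \<in> V \<and> c' w = j. \<Sum>v | v \<in> V \<and> c' v = i. d w * d v)"
    unfolding mass_def sum_product by (subst sum.swap) (simp add: mult.commute)
  moreover have "emass (A True) c' i j + emass (A False) c' i j
    = (\<Sum>w | w \<in> V \<and> c' w = j. \<Sum>v | v \<in> V \<and> c' v = i. d w * d v * (A True v w + A False v w))"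
    unfolding emass_def by (simp add: sum.distrib distrib_left)
  ultimately have "mass c' i * mass c' j - (emass (A True) c' i j + emass (A False) c' i j)
    = (\<Sum>w | w \<in> V \<and> c' w = j. \<Sum>v | v \<in> V \<and> c' v = i. d w * d v * (1 - (A True v w + A False v w)))"
    by (simp add: sum_subtractf right_diff_distrib)
  also have "\<dots> = (\<Sum>w | w \<in> V \<and> c' w = j. \<Sum>v | v \<in> V \<and> c' v = i. if v = w then (d v)\<^sup>2 else 0)"
    unfolding A_sum by (intro sum.cong refl) (auto simp: power2_eq_square)
  also have "\<dots> = (\<Sum>w | w \<in> V \<and> c' w = j. if c' w = i then (d w)\<^sup>2 else 0)"
    using fin by (intro sum.cong refl) auto
  also have "\<dots> = (if i = j then (\<Sum>v | v \<in> V \<and> c' v = i. (d v)\<^sup>2) else 0)"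
    by (auto intro!: sum.cong sum.neutral)
  finally show ?thesis .
qed

text \<open>The vertices in cells that are not early have weight at most \<open>1 / m\<close>, so
  their squared weights sum to at most \<open>1 / m\<close>.\<close>

lemma emass_diag:
  assumes "m > 0"
  shows "(\<Sum>i | i < 4 ^ m \<and> \<not> early m i.
    mass (c m) i * mass (c m) i - emass (A True) (c m) i i - emass (A False) (c m) i i) \<le> 1 / m"
proof -
  have "(\<Sum>i | i < 4 ^ m \<and> \<not> early m i.
    mass (c m) i * mass (c m) i - emass (A True) (c m) i i - emass (A False) (c m) i i)
    = (\<Sum>i | i < 4 ^ m \<and> \<not> early m i. \<Sum>v\<in>cls m i. (d v)\<^sup>2)"
    using emass_sum[of "c m"] by (intro sum.cong refl) (simp add: algebra_simps)
  also have "\<dots> \<le> (\<Sum>i | i < 4 ^ m \<and> \<not> early m i. \<Sum>v\<in>cls m i. d v * (1 / m))"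
  proof (intro sum_mono)
    fix i v assume i: "i \<in> {i. i < 4 ^ m \<and> \<not> early m i}" and v: "v \<in> cls m i"
    have "real m * d v \<le> 1" using i v early_code[of m v] by (intro c_light) auto
    then have "d v \<le> 1 / m" using assms by (simp add: field_simps)
    then show "(d v)\<^sup>2 \<le> d v * (1 / m)" unfolding power2_eq_square by (intro mult_left_mono d_nonneg)
  qed
  also have "\<dots> = (\<Sum>i | i < 4 ^ m \<and> \<not> early m i. mass (c m) i) * (1 / m)"
    by (simp only: mass_def sum_distrib_right)
  also have "\<dots> \<le> 1 * (1 / m)"
  proof (intro mult_right_mono)
    have "(\<Sum>i | i < 4 ^ m \<and> \<not> early m i. mass (c m) i) \<le> (\<Sum>i<4 ^ m. mass (c m) i)"
      by (intro sum_mono2) (auto simp: mass_nonneg)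
    also have "\<dots> = (\<Sum>v\<in>V. d v)"
      unfolding mass_def using c_less fin by (intro sum.group) auto
    finally show "(\<Sum>i | i < 4 ^ m \<and> \<not> early m i. mass (c m) i) \<le> 1" by (simp add: d_sum)
  qed simp
  finally show ?thesis by simp
qed

lemma mass_two_atoms:
  assumes "k < l" "atom i" "atom (i div 4 ^ (l - k))"
  shows "mass (c (Suc l)) i = 0"
proof -
  have False if "v \<in> cls (Suc l) i" for v
  proof -
    have "atom (c (Suc l) v)" using that assms by auto
    moreover have "atom (c (Suc k) v)" using c_chain[of "Suc k" "Suc l" v] that assms by auto
    ultimately show False using c_once[of l v k] assms by simp
  qed
  then have none: "cls (Suc l) i = {}" by blast
  show ?thesis unfolding mass_def none by simp
qed

lemma dens_01: "dens (A b) c' i j \<in> {0..1}"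
proof -
  have "emass (A b) c' i j \<le> mass c' i * mass c' j"
  proof -
    have "0 \<le> (if i = j then (\<Sum>v | v \<in> V \<and> c' v = i. (d v)\<^sup>2) else 0)" by (simp add: sum_nonneg)
    then show ?thesis
      using emass_sum[of c' i j] emass_nonneg[of True c' i j] emass_nonneg[of False c' i j] by (cases b) auto
  qed
  then show ?thesis unfolding dens_def
    using emass_nonneg[of b c' i j] mass_nonneg[of c' i] mass_nonneg[of c' j]
    by (cases "mass c' i * mass c' j = 0") (auto simp: divide_le_eq zero_less_mult_iff)
qed

text \<open>The factor 4 is the 2 in \<open>c_good\<close> times the 2 from averaging both
  arguments. The bound depends only on \<open>m\<close> and \<open>R\<close>, not on the graph, so
  it persists in the limit.\<close>

lemma hom_close_to_step:
  assumes I: "finite I" "R \<subseteq> I \<times> I" and R: "\<And>a b. (a, b) \<in> R \<Longrightarrow> (b, a) \<notin> R" and m: "m > 0"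
  shows "\<bar>hom I R (\<lambda>q. A (col q)) - (\<Sum>\<iota>\<in>PiE I (\<lambda>_. {..<4 ^ m}). (\<Prod>i\<in>I. mass (c m) (\<iota> i)) *
    (\<Prod>q\<in>R. dens (A (col q)) (c m) (\<iota> (fst q)) (\<iota> (snd q))))\<bar> \<le> real (card R) * (4 * sqrt (2 / m))"
proof -
  have "\<bar>hom I R (\<lambda>q. A (col q)) - hom I R (\<lambda>q v w. dens (A (col q)) (c m) (c m v) (c m w))\<bar> \<le> real (card R) * (4 * sqrt (2 / m))"
  proof (rule counting[OF I R])
    fix q and f h :: "'v \<Rightarrow> real" assume "range f \<subseteq> {0..1}" "range h \<subseteq> {0..1}"
    then have "\<bar>bil (A (col q)) f h - bil (\<lambda>v w. dens (A (col q)) (c m) (c m v) (c m w)) f h\<bar> \<le> 2 * (2 * sqrt (2 / m))"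
      by (intro good_imp_close c_good m A_sym)
    then show "\<bar>bil (A (col q)) f h - bil (\<lambda>v w. dens (A (col q)) (c m) (c m v) (c m w)) f h\<bar> \<le> 4 * sqrt (2 / m)" by simp
  qed (use A_01 dens_01 in auto)
  moreover have "hom I R (\<lambda>q v w. dens (A (col q)) (c m) (c m v) (c m w))
    = (\<Sum>\<iota>\<in>PiE I (\<lambda>_. {..<4 ^ m}). (\<Prod>i\<in>I. mass (c m) (\<iota> i)) *
      (\<Prod>q\<in>R. dens (A (col q)) (c m) (\<iota> (fst q)) (\<iota> (snd q))))"
    using c_less I by (intro hom_step_kernel[of I "c m" "4 ^ m" R "\<lambda>q. dens (A (col q)) (c m)"]) auto
  ultimately show ?thesis by simp
qed

end

locale coded_limit =
  fixes V :: "nat \<Rightarrow> 'v set" and d A c and \<mu> :: "nat \<Rightarrow> nat \<Rightarrow> real" and e :: "bool \<Rightarrow> nat \<Rightarrow> nat \<Rightarrow> nat \<Rightarrow> real"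
  assumes coded: "coded (V n) (d n) (A n) (c n)"
    and lim_mu: "(\<lambda>n. weighted_set.mass (V n) (d n) (c n m) i) \<longlonglongrightarrow> \<mu> m i"
    and lim_e: "(\<lambda>n. weighted_set.emass (V n) (d n) (A n b) (c n m) i j) \<longlonglongrightarrow> e b m i j"
begin

sublocale cd: coded "V n" "d n" "A n" "c n" for n by (rule coded)

text \<open>Each axiom is an equation or a weak inequality in finitely many masses that holds for
  every \<open>n\<close>, so it passes to the limit.\<close>

sublocale limit_data \<mu> e
proof
  fix m i j k l :: nat and b
  show "\<mu> m i \<ge> 0" by (rule LIMSEQ_le_const[OF lim_mu]) (auto intro: cd.mass_nonneg)
  show "\<mu> 0 0 = 1" using lim_mu[of 0 0] by (simp add: cd.mass_0 LIMSEQ_const_iff)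
  show "\<mu> m i = 0" if "i \<ge> 4 ^ m" using lim_mu[of m i] that by (simp add: cd.mass_out LIMSEQ_const_iff)
  show "\<mu> m i = (\<Sum>r<4. \<mu> (Suc m) (4 * i + r))"
  proof (rule LIMSEQ_unique[OF lim_mu])
    show "(\<lambda>n. cd.mass n (c n m) i) \<longlonglongrightarrow> (\<Sum>r<4. \<mu> (Suc m) (4 * i + r))"
      by (subst cd.mass_split) (intro tendsto_sum lim_mu)
  qed
  show "e b m i j \<ge> 0" by (rule LIMSEQ_le_const[OF lim_e]) (auto intro: cd.emass_nonneg)
  show "e b m i j = e b m j i"
    by (rule LIMSEQ_unique[OF lim_e]) (subst cd.emass_sym, rule lim_e)
  show "e b m i j = (\<Sum>r<4. \<Sum>s<4. e b (Suc m) (4 * i + r) (4 * j + s))"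
  proof (rule LIMSEQ_unique[OF lim_e])
    show "(\<lambda>n. cd.emass n (A n b) (c n m) i j) \<longlonglongrightarrow> (\<Sum>r<4. \<Sum>s<4. e b (Suc m) (4 * i + r) (4 * j + s))"
      by (subst cd.emass_split) (intro tendsto_sum lim_e)
  qed
  have lim: "(\<lambda>n. cd.mass n (c n m) i * cd.mass n (c n m) j - (cd.emass n (A n True) (c n m) i j + cd.emass n (A n False) (c n m) i j))
      \<longlonglongrightarrow> \<mu> m i * \<mu> m j - (e True m i j + e False m i j)" for i j
    by (intro tendsto_intros lim_mu lim_e)
  have "0 \<le> \<mu> m i * \<mu> m j - (e True m i j + e False m i j)"
    by (rule LIMSEQ_le_const[OF lim]) (auto simp: cd.emass_sum intro!: sum_nonneg)
  then show "e True m i j + e False m i j \<le> \<mu> m i * \<mu> m j" by simp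
  show "e True m i j + e False m i j = \<mu> m i * \<mu> m j" if "i \<noteq> j"
    using lim[of i j] that by (simp add: cd.emass_sum LIMSEQ_const_iff)
  show "(\<Sum>i | i < 4 ^ m \<and> \<not> early m i. \<mu> m i * \<mu> m i - e True m i i - e False m i i) \<le> 1 / m" if "m > 0"
  proof (rule LIMSEQ_le_const2)
    show "(\<lambda>n. \<Sum>i | i < 4 ^ m \<and> \<not> early m i. cd.mass n (c n m) i * cd.mass n (c n m) i
        - cd.emass n (A n True) (c n m) i i - cd.emass n (A n False) (c n m) i i)
      \<longlonglongrightarrow> (\<Sum>i | i < 4 ^ m \<and> \<not> early m i. \<mu> m i * \<mu> m i - e True m i i - e False m i i)"
      by (intro tendsto_intros lim_mu lim_e)
  qed (use cd.emass_diag that in auto)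
  show "\<mu> (Suc l) i = 0" if "k < l" "atom i" "atom (i div 4 ^ (l - k))"
    using lim_mu[of "Suc l" i] cd.mass_two_atoms[OF that] by (simp add: LIMSEQ_const_iff)
qed

text \<open>If some limit mass is 0, the densities may fail to converge. They stay in [0, 1],
  though, while the product of the masses tends to 0, and so does the whole term.\<close>

lemma tendsto_term:
  assumes I: "finite I" "R \<subseteq> I \<times> I"
  shows "(\<lambda>n. (\<Prod>i\<in>I. cd.mass n (c n m) (\<iota> i)) * (\<Prod>q\<in>R. cd.dens n (A n (col q)) (c n m) (\<iota> (fst q)) (\<iota> (snd q))))
    \<longlonglongrightarrow> (\<Prod>i\<in>I. \<mu> m (\<iota> i)) * (\<Prod>q\<in>R. e (col q) m (\<iota> (fst q)) (\<iota> (snd q)) / (\<mu> m (\<iota> (fst q)) * \<mu> m (\<iota> (snd q))))"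
proof -
  let ?mass = "\<lambda>n. \<Prod>i\<in>I. cd.mass n (c n m) (\<iota> i)"
  let ?dens = "\<lambda>n. \<Prod>q\<in>R. cd.dens n (A n (col q)) (c n m) (\<iota> (fst q)) (\<iota> (snd q))"
  show ?thesis
proof (cases "\<exists>i\<in>I. \<mu> m (\<iota> i) = 0")
  case True
  then have 0: "(\<Prod>i\<in>I. \<mu> m (\<iota> i)) = 0" using I by auto
  have "(\<lambda>n. \<Prod>i\<in>I. cd.mass n (c n m) (\<iota> i)) \<longlonglongrightarrow> 0"
    unfolding 0[symmetric] by (intro tendsto_prod lim_mu)
  then have "(\<lambda>n. ?mass n * ?dens n) \<longlonglongrightarrow> 0"
  proof (rule Lim_null_comparison[rotated])
    have "?dens n \<in> {0..1}" for n
      using cd.dens_01[of n] by (auto intro!: prod_nonneg prod_le_1)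
    moreover have "?mass n \<ge> 0" for n by (intro prod_nonneg cd.mass_nonneg)
    ultimately show "\<forall>\<^sub>F n in sequentially. norm (?mass n *
        ?dens n) \<le> ?mass n"
      by (intro always_eventually allI) (auto simp: abs_mult intro!: mult_left_le)
  qed
  then show ?thesis unfolding 0 by simp
next
  case False
  have "(\<lambda>n. \<Prod>q\<in>R. cd.dens n (A n (col q)) (c n m) (\<iota> (fst q)) (\<iota> (snd q)))
    \<longlonglongrightarrow> (\<Prod>q\<in>R. e (col q) m (\<iota> (fst q)) (\<iota> (snd q)) / (\<mu> m (\<iota> (fst q)) * \<mu> m (\<iota> (snd q))))"
  proof (rule tendsto_prod)
    fix q assume "q \<in> R"
    then have "fst q \<in> I" "snd q \<in> I" using I by auto
    then show "(\<lambda>n. cd.dens n (A n (col q)) (c n m) (\<iota> (fst q)) (\<iota> (snd q)))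
      \<longlonglongrightarrow> e (col q) m (\<iota> (fst q)) (\<iota> (snd q)) / (\<mu> m (\<iota> (fst q)) * \<mu> m (\<iota> (snd q)))"
      unfolding cd.dens_def using False by (intro tendsto_intros lim_mu lim_e) auto
  qed
  from tendsto_mult[OF tendsto_prod[OF lim_mu] this] show ?thesis .
qed
qed

text \<open>An exchange of limits: for fixed \<open>m\<close>, letting \<open>n\<close> grow removes
  the density of the graphs and leaves an error depending on \<open>m\<close> only, which then tends
  to 0.\<close>

lemma step_hom_tendsto_0:
  assumes I: "finite I" "R \<subseteq> I \<times> I" and R: "\<And>a b. (a, b) \<in> R \<Longrightarrow> (b, a) \<notin> R"
    and hom: "(\<lambda>n. cd.hom n I R (\<lambda>q. A n (col q))) \<longlonglongrightarrow> 0"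
  shows "(\<lambda>m. \<Sum>\<iota>\<in>PiE I (\<lambda>_. {..<4 ^ m}). (\<Prod>i\<in>I. \<mu> m (\<iota> i)) *
      (\<Prod>q\<in>R. e (col q) m (\<iota> (fst q)) (\<iota> (snd q)) / (\<mu> m (\<iota> (fst q)) * \<mu> m (\<iota> (snd q))))) \<longlonglongrightarrow> 0"
    (is "?\<tau> \<longlonglongrightarrow> 0")
proof (rule Lim_null_comparison)
  let ?\<tau>n = "\<lambda>n m. \<Sum>\<iota>\<in>PiE I (\<lambda>_. {..<4 ^ m}). (\<Prod>i\<in>I. cd.mass n (c n m) (\<iota> i)) *
      (\<Prod>q\<in>R. cd.dens n (A n (col q)) (c n m) (\<iota> (fst q)) (\<iota> (snd q)))"
  show "\<forall>\<^sub>F m in sequentially. norm (?\<tau> m) \<le> real (card R) * (4 * sqrt (2 / m))"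
  proof (rule eventually_mono[OF eventually_gt_at_top[of 0]])
    fix m :: nat assume m: "m > 0"
    have "(\<lambda>n. \<bar>cd.hom n I R (\<lambda>q. A n (col q)) - ?\<tau>n n m\<bar>) \<longlonglongrightarrow> \<bar>0 - ?\<tau> m\<bar>"
      by (intro tendsto_intros hom tendsto_term I)
    then have "\<bar>0 - ?\<tau> m\<bar> \<le> real (card R) * (4 * sqrt (2 / m))"
      by (rule LIMSEQ_le_const2) (use cd.hom_close_to_step[OF I R m] in auto)
    then show "norm (?\<tau> m) \<le> real (card R) * (4 * sqrt (2 / m))" by simp
  qed
  have "(\<lambda>m. real (card R) * (4 * sqrt (2 * (1 / real m)))) \<longlonglongrightarrow> real (card R) * (4 * sqrt (2 * 0))"
    by (intro tendsto_intros lim_1_over_n)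
  then show "(\<lambda>m. real (card R) * (4 * sqrt (2 / real m))) \<longlonglongrightarrow> 0" by simp
qed

end

lemma coded_adj:
  assumes "weighted_graph G D"
  obtains c where "coded (verts G) (pmf D) (adj G) c"
proof -
  interpret weighted_set "verts G" "pmf D" by (rule weighted_graph_imp_weighted_set[OF assms])
  have A: "adj G b v w \<in> {0..1}" for b v w by (simp add: adj_def)
  from exists_code[of "adj G", OF A] obtain c where c: "\<forall>v. c 0 v = 0" "\<forall>m v. c (Suc m) v div 4 = c m v"
    "\<forall>m. \<forall>v w. atom (c (Suc m) v) \<longrightarrow> atom (c (Suc m) w) \<longrightarrow> v = w"
    "\<forall>v m k. atom (c (Suc m) v) \<longrightarrow> atom (c (Suc k) v) \<longrightarrow> m = k"
    "\<forall>m. \<forall>v\<in>verts G. (\<forall>k<m. \<not> atom (c (Suc k) v)) \<longrightarrow> real m * pmf D v \<le> 1"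
    "\<forall>m>0. \<forall>b. good (adj G b) (c m) (2 * sqrt (2 / real m))"
    by (elim exE conjE)
  have "coded (verts G) (pmf D) (adj G) c"
  proof
    fix b v w m k
    show "adj G b v w = adj G b w v" by (simp add: adj_def insert_commute eq_commute)
    show "adj G True v w + adj G False v w = (if v = w then 0 else 1)" by (simp add: adj_def)
    show "adj G b v w \<in> {0..1}" by (rule A)
    show "c 0 v = 0" "c (Suc m) v div 4 = c m v" using c(1,2) by simp_all
    show "v = w" if "atom (c (Suc m) v)" "atom (c (Suc m) w)" by (rule c(3)[rule_format, OF that])
    show "m = k" if "atom (c (Suc m) v)" "atom (c (Suc k) v)" by (rule c(4)[rule_format, OF that])
    show "real m * pmf D v \<le> 1" if "v \<in> verts G" "\<And>k. k < m \<Longrightarrow> \<not> atom (c (Suc k) v)"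
      by (rule c(5)[rule_format, OF that])
    show "good (adj G b) (c m) (2 * sqrt (2 / real m))" if "m > 0" by (rule c(6)[rule_format, OF that])
  qed
  then show ?thesis by (rule that)
qed

lemma convergent_coded_subsequence:
  assumes G: "\<And>n. weighted_graph (G n) (D n)"
  obtains r c \<mu> e where "strict_mono (r :: nat \<Rightarrow> nat)"
    "coded_limit (\<lambda>n. verts (G (r n))) (\<lambda>n. pmf (D (r n))) (\<lambda>n. adj (G (r n))) c \<mu> e"
proof -
  have "\<exists>c. coded (verts (G n)) (pmf (D n)) (adj (G n)) c" for n using coded_adj[OF G] by metis
  then obtain c where c: "\<And>n. coded (verts (G n)) (pmf (D n)) (adj (G n)) (c n)" by metis
  interpret cd: coded "verts (G n)" "pmf (D n)" "adj (G n)" "c n" for n by (rule c)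
  \<comment> \<open>All masses and pair masses over all levels form one countable family, so a
    single subsequence makes all of them converge.\<close>
  define f where "f n k = (case k of Inl (m, i) \<Rightarrow> cd.mass n (c n m) i
     | Inr (b, m, i, j) \<Rightarrow> cd.emass n (adj (G n) b) (c n m) i j)" for n and k :: "(nat \<times> nat) + (bool \<times> nat \<times> nat \<times> nat)"
  have mass1: "cd.mass n (c n m) i \<in> {0..1}" for n m i
  proof -
    have "cd.mass n (c n m) i \<le> sum (pmf (D n)) (verts (G n))"
      unfolding cd.mass_def by (intro sum_mono2 cd.fin) auto
    then show ?thesis using cd.mass_nonneg cd.d_sum by simp
  qed
  have "cd.emass n (adj (G n) b) (c n m) i j \<in> {0..1}" for n b m i j
  proof -
    have "cd.emass n (adj (G n) b) (c n m) i j \<le> cd.mass n (c n m) i * cd.mass n (c n m) j"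
      using cd.dens_01[of n b "c n m" i j] cd.emass_sum[of n "c n m" i j]
        cd.emass_nonneg[of n True "c n m" i j] cd.emass_nonneg[of n False "c n m" i j]
        sum_nonneg[of "{v. v \<in> verts (G n) \<and> c n m v = i}" "\<lambda>v. (pmf (D n) v)\<^sup>2"]
      by (cases b) (auto split: if_splits)
    also have "\<dots> \<le> 1" using mass1[of n m i] mass1[of n m j] by (auto intro: mult_le_one)
    finally show ?thesis using cd.emass_nonneg by simp
  qed
  then have "f n k \<in> {0..1}" for n k
    unfolding f_def using mass1 by (auto split: sum.splits prod.splits)
  then obtain r l where rl: "strict_mono r" "\<And>k. (\<lambda>n. f (r n) k) \<longlonglongrightarrow> l k"
    using convergent_subsequence_pointwise[of f] by blast
  have "coded_limit (\<lambda>n. verts (G (r n))) (\<lambda>n. pmf (D (r n))) (\<lambda>n. adj (G (r n))) (\<lambda>n. c (r n))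
     (\<lambda>m i. l (Inl (m, i))) (\<lambda>b m i j. l (Inr (b, m, i, j)))"
  proof (rule coded_limit.intro)
    show "coded (verts (G (r n))) (pmf (D (r n))) (adj (G (r n))) (c (r n))" for n by (rule c)
    show "(\<lambda>n. cd.mass (r n) (c (r n) m) i) \<longlonglongrightarrow> l (Inl (m, i))" for m i
      using rl(2)[of "Inl (m, i)"] by (simp add: f_def)
    show "(\<lambda>n. cd.emass (r n) (adj (G (r n)) b) (c (r n) m) i j) \<longlonglongrightarrow> l (Inr (b, m, i, j))" for b m i j
      using rl(2)[of "Inr (b, m, i, j)"] by (simp add: f_def)
  qed
  then show ?thesis using that rl(1) by blast
qed

section \<open>Repairing a graph\<close>

text \<open>Here \<open>ok b v w\<close> says that the pair may have colour \<open>b\<close>. A pair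
  changes colour only if its own colour is not allowed. Pairs with an end outside \<open>V'\<close>
  are left to extendability and charged in full, once for each end that may lie outside.\<close>

lemma repair:
  assumes P: "graph_property P" "extendable P" and G: "weighted_graph G D" and V': "V' \<subseteq> verts G"
    and sym: "\<And>b v w. ok b v w \<longleftrightarrow> ok b w v"
    and in_P: "\<And>F. is_graph F \<Longrightarrow> verts F = V' \<Longrightarrow>
      (\<And>a b. a \<in> V' \<Longrightarrow> b \<in> V' \<Longrightarrow> a \<noteq> b \<Longrightarrow> ok ({a, b} \<in> edges F) a b) \<Longrightarrow> F \<in> P"
    and some_ok: "\<And>a b. a \<in> V' \<Longrightarrow> b \<in> V' \<Longrightarrow> a \<noteq> b \<Longrightarrow> ok True a b \<or> ok False a b"
    and cost: "2 * (\<Sum>v\<in>verts G - V'. pmf D v) + (\<Sum>v\<in>V'. \<Sum>w\<in>V'. \<Sum>b\<in>UNIV.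
      pmf D v * pmf D w * (adj G b v w * (if ok b v w then 0 else 1))) < \<epsilon>"
    and \<epsilon>: "\<epsilon> < 1"
  shows "\<not> eps_far \<epsilon> G D P"
proof -
  interpret weighted_set "verts G" "pmf D" by (rule weighted_graph_imp_weighted_set[OF G])
  let ?d = "pmf D" and ?V = "verts G"
  let ?c = "\<lambda>v w. \<Sum>b\<in>UNIV. ?d v * ?d w * (adj G b v w * (if ok b v w then 0 else 1))"
  have gG: "is_graph G" using G by (simp add: weighted_graph_def)
  have c0: "0 \<le> ?c v w" for v w by (intro sum_nonneg) (auto simp: adj_def)
  have finV': "finite V'" using V' fin finite_subset by blast
  \<comment> \<open>Dropping every vertex would cost 2, more than \<epsilon>; graphs must have a
    vertex for extendability to start from.\<close>
  have ne: "V' \<noteq> {}"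
  proof
    assume "V' = {}"
    then show False using cost \<epsilon> d_sum by simp
  qed
  \<comment> \<open>An edge of the new graph: allowed as an edge, and either an edge before or not
    allowed as a non-edge.\<close>
  define keep where "keep v w \<longleftrightarrow> ok True v w \<and> ({v, w} \<in> edges G \<or> \<not> ok False v w)" for v w
  have keep_sym: "keep v w \<longleftrightarrow> keep w v" for v w by (auto simp: keep_def sym[of _ v w] insert_commute)
  define F where "F = \<lparr>verts = V', edges = {{v, w} | v w. v \<in> V' \<and> w \<in> V' \<and> v \<noteq> w \<and> keep v w}\<rparr>"
  have edgeF: "{a, b} \<in> edges F \<longleftrightarrow> keep a b" if "a \<in> V'" "b \<in> V'" "a \<noteq> b" for a b
    using that keep_sym by (auto simp: F_def doubleton_eq_iff)
  have vF: "verts F = V'" by (simp add: F_def)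
  have gF: "is_graph F" unfolding is_graph_def F_def nsets_def using finV' ne by auto
  have "F \<in> P"
  proof (rule in_P[OF gF vF])
    fix a b assume ab: "a \<in> V'" "b \<in> V'" "a \<noteq> b"
    show "ok ({a, b} \<in> edges F) a b"
      using some_ok[OF ab] unfolding edgeF[OF ab] keep_def by (cases "ok True a b"; cases "ok False a b"; cases "{a, b} \<in> edges G") auto
  qed
  then obtain H where H: "H \<in> P" "verts H = ?V" "induced_subgraph H (verts F) = F"
    using extend_to_superset[OF P, of F ?V] V' fin vF by metis
  have edgeH: "{a, b} \<in> edges H \<longleftrightarrow> keep a b" if "a \<in> V'" "b \<in> V'" "a \<noteq> b" for a b
  proof -
    have "{a, b} \<in> edges (induced_subgraph H V') \<longleftrightarrow> {a, b} \<in> edges H" using that by (simp add: induced_subgraph_def)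
    then show ?thesis using H(3) edgeF[OF that] vF by simp
  qed
  have gH: "is_graph H" by (rule property_is_graph[OF P(1) H(1)])
  define X where "X = sym_diff (edges G) (edges H)"
  have X_iff: "e \<in> X \<longleftrightarrow> (e \<in> edges G) \<noteq> (e \<in> edges H)" for e unfolding X_def by blast
  have X_nsets: "X \<subseteq> nsets ?V 2"
    using gG gH unfolding is_graph_def H(2) X_def by blast
  let ?pairs = "{p \<in> ?V \<times> ?V. fst p \<noteq> snd p \<and> {fst p, snd p} \<in> X}"
  have fin_pairs: "finite ?pairs" using fin by simp
  have X: "X \<subseteq> (\<lambda>p. {fst p, snd p}) ` ?pairs"
  proof
    fix e assume e: "e \<in> X"
    then have "e \<in> nsets ?V 2" using X_nsets by blast
    then obtain v w where "e = {v, w}" "v \<noteq> w" "v \<in> ?V" "w \<in> ?V"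
      by (auto simp: nsets_def card_2_iff)
    then show "e \<in> (\<lambda>p. {fst p, snd p}) ` ?pairs" using e by (intro image_eqI[of _ _ "(v, w)"]) auto
  qed
  have "graph_dist D G H \<le> (\<Sum>e\<in>(\<lambda>p. {fst p, snd p}) ` ?pairs. \<Prod>x\<in>e. ?d x)"
    unfolding graph_dist_def X_def[symmetric] using X fin_pairs by (intro sum_mono2) (auto intro: prod_nonneg)
  \<comment> \<open>Passing to ordered pairs counts each edge at least once, which suffices for an
    upper bound.\<close>
  also have "\<dots> \<le> (\<Sum>e\<in>(\<lambda>p. {fst p, snd p}) ` ?pairs. \<Sum>p | p \<in> ?pairs \<and> {fst p, snd p} = e. ?d (fst p) * ?d (snd p))"
  proof (intro sum_mono)
    fix e assume "e \<in> (\<lambda>p. {fst p, snd p}) ` ?pairs"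
    then obtain p where p: "p \<in> ?pairs" "e = {fst p, snd p}" by blast
    then have "(\<Prod>x\<in>e. ?d x) = ?d (fst p) * ?d (snd p)" by auto
    also have "\<dots> = (\<Sum>q\<in>{p}. ?d (fst q) * ?d (snd q))" by simp
    also have "\<dots> \<le> (\<Sum>p | p \<in> ?pairs \<and> {fst p, snd p} = e. ?d (fst p) * ?d (snd p))"
    proof (rule sum_mono2)
      show "finite {q. q \<in> ?pairs \<and> {fst q, snd q} = e}" using fin by simp
      show "{p} \<subseteq> {q. q \<in> ?pairs \<and> {fst q, snd q} = e}" using p by blast
    qed simp
    finally show "(\<Prod>x\<in>e. ?d x) \<le> \<dots>" .
  qed
  also have "\<dots> = (\<Sum>p\<in>?pairs. ?d (fst p) * ?d (snd p))"
    by (rule sum.image_gen[OF fin_pairs, symmetric])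
  also have "\<dots> \<le> (\<Sum>p\<in>?V \<times> ?V. ?d (fst p) * ?d (snd p) * (if fst p \<notin> V' then 1 else 0)
      + ?d (fst p) * ?d (snd p) * (if snd p \<notin> V' then 1 else 0)
      + (if fst p \<in> V' \<and> snd p \<in> V' then ?c (fst p) (snd p) else 0))"
    (is "_ \<le> sum ?g _")
  proof -
    have g0: "0 \<le> ?g p" for p using c0 by auto
    have "(\<Sum>p\<in>?pairs. ?d (fst p) * ?d (snd p)) \<le> sum ?g ?pairs"
    proof (intro sum_mono)
      fix p assume p: "p \<in> ?pairs"
      obtain v w where vw: "p = (v, w)" by (cases p)
      show "?d (fst p) * ?d (snd p) \<le> ?g p"
      proof (cases "v \<in> V' \<and> w \<in> V'")
        case False then show ?thesis unfolding vw by auto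
      next
        case True
        have v: "v \<noteq> w" "({v, w} \<in> edges G) \<noteq> keep v w"
          using p edgeH[of v w] True unfolding vw by (auto simp: X_iff)
        have "?d v * ?d w \<le> ?c v w"
          using v unfolding UNIV_bool by (auto simp: adj_def keep_def)
        then show ?thesis unfolding vw using True by simp
      qed
    qed
    also have "\<dots> \<le> sum ?g (?V \<times> ?V)" using fin g0 by (intro sum_mono2) auto
    finally show ?thesis .
  qed
  also have "\<dots> = (\<Sum>v\<in>?V. \<Sum>w\<in>?V. ?d v * ?d w * (if v \<notin> V' then 1 else 0))
      + (\<Sum>v\<in>?V. \<Sum>w\<in>?V. ?d v * ?d w * (if w \<notin> V' then 1 else 0))
      + (\<Sum>v\<in>?V. \<Sum>w\<in>?V. if v \<in> V' \<and> w \<in> V' then ?c v w else 0)"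
    by (simp add: sum.cartesian_product case_prod_beta sum.distrib)
  also have "(\<Sum>v\<in>?V. \<Sum>w\<in>?V. ?d v * ?d w * (if v \<notin> V' then 1 else 0)) = (\<Sum>v\<in>?V - V'. ?d v)"
  proof -
    have "(\<Sum>v\<in>?V. \<Sum>w\<in>?V. ?d v * ?d w * (if v \<notin> V' then 1 else 0)) = (\<Sum>v\<in>?V. (?d v * (if v \<notin> V' then 1 else 0)) * sum ?d ?V)"
      unfolding sum_distrib_left by (intro sum.cong refl) auto
    also have "\<dots> = (\<Sum>v\<in>?V. if v \<notin> V' then ?d v else 0)" by (intro sum.cong refl) (auto simp: d_sum)
    also have "\<dots> = (\<Sum>v\<in>?V - V'. ?d v)" using fin by (intro sum.mono_neutral_cong_right) auto
    finally show ?thesis .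
  qed
  also have "(\<Sum>v\<in>?V. \<Sum>w\<in>?V. ?d v * ?d w * (if w \<notin> V' then 1 else 0)) = (\<Sum>v\<in>?V - V'. ?d v)"
  proof -
    have "(\<Sum>v\<in>?V. \<Sum>w\<in>?V. ?d v * ?d w * (if w \<notin> V' then 1 else 0)) = (\<Sum>v\<in>?V. ?d v * (\<Sum>w\<in>?V. if w \<notin> V' then ?d w else 0))"
      unfolding sum_distrib_left by (intro sum.cong refl) auto
    also have "\<dots> = (\<Sum>w\<in>?V. if w \<notin> V' then ?d w else 0)" by (simp add: d_sum flip: sum_distrib_right)
    also have "\<dots> = (\<Sum>v\<in>?V - V'. ?d v)" using fin by (intro sum.mono_neutral_cong_right) auto
    finally show ?thesis .
  qed
  also have "(\<Sum>v\<in>?V. \<Sum>w\<in>?V. if v \<in> V' \<and> w \<in> V' then ?c v w else 0) = (\<Sum>v\<in>V'. \<Sum>w\<in>V'. ?c v w)"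
  proof -
    have "(\<Sum>w\<in>?V. if v \<in> V' \<and> w \<in> V' then ?c v w else 0) = (if v \<in> V' then \<Sum>w\<in>V'. ?c v w else 0)" for v
    proof (cases "v \<in> V'")
      case True
      then show ?thesis using fin V' by (simp only: simp_thms if_True) (intro sum.mono_neutral_cong_right; auto)
    qed simp
    then show ?thesis using fin V' by (simp only:) (intro sum.mono_neutral_cong_right; auto)
  qed
  finally have "graph_dist D G H < \<epsilon>" using cost by simp
  then show ?thesis unfolding eps_far_def using H by (meson not_le)
qed

section \<open>Independent uniform points in prescribed cells\<close>

lemma prob_space_uniform:
  assumes "prob_space M" "measure M C > 0"
  shows "prob_space (uniform_measure M C)"
proof -
  interpret prob_space M by fact
  show ?thesis using assms(2) by (intro prob_space_uniform_measure) (auto simp: emeasure_eq_measure)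
qed

text \<open>Conditioning a product measure on a box conditions the coordinates separately. Both
  measures agree on boxes, and these determine them.\<close>

lemma uniform_measure_PiM:
  assumes I: "finite I" and M: "prob_space M" and C: "\<And>i. C i \<in> sets M" "\<And>i. measure M (C i) > 0"
  shows "PiM I (\<lambda>i. uniform_measure M (C i)) = uniform_measure (PiM I (\<lambda>_. M)) (PiE I C)"
proof -
  interpret M: prob_space M by (rule M)
  have pos: "emeasure M (C i) \<noteq> 0" "emeasure M (C i) \<noteq> \<infinity>" for i
    using C(2)[of i] by (auto simp: M.emeasure_eq_measure)
  have N: "prob_space (uniform_measure M (C i))" for i by (rule prob_space_uniform[OF M C(2)])
  interpret N: product_prob_space "\<lambda>i. uniform_measure M (C i)" I by (intro product_prob_spaceI N)
  interpret P: finite_product_prob_space "\<lambda>_. M" I by unfold_locales (rule I)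
  have box: "PiE I C \<in> sets (PiM I (\<lambda>_. M))" using I C by (intro sets_PiM_I_finite) auto
  have mbox: "measure (PiM I (\<lambda>_. M)) (PiE I C) = (\<Prod>i\<in>I. measure M (C i))" using C by (intro P.prob_times)
  have posbox: "(\<Prod>i\<in>I. measure M (C i)) > 0" using C by (intro prod_pos) auto
  show ?thesis
  proof (rule N.PiM_eqI[symmetric, OF I])
    show "sets (uniform_measure (PiM I (\<lambda>_. M)) (PiE I C)) = sets (PiM I (\<lambda>i. uniform_measure M (C i)))"
      by (simp cong: sets_PiM_cong)
    fix A assume "\<And>i. i \<in> I \<Longrightarrow> A i \<in> sets (uniform_measure M (C i))"
    then have A: "\<And>i. i \<in> I \<Longrightarrow> A i \<in> sets M" by simp
    have inter: "PiE I C \<inter> PiE I A = PiE I (\<lambda>i. C i \<inter> A i)" by auto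
    have "emeasure (uniform_measure (PiM I (\<lambda>_. M)) (PiE I C)) (PiE I A)
      = ennreal (measure (PiM I (\<lambda>_. M)) (PiE I (\<lambda>i. C i \<inter> A i)) / measure (PiM I (\<lambda>_. M)) (PiE I C))"
      using I A box posbox unfolding mbox[symmetric]
      by (subst emeasure_uniform_measure) (auto simp: inter P.P.emeasure_eq_measure divide_ennreal intro!: sets_PiM_I_finite)
    also have "\<dots> = ennreal (\<Prod>i\<in>I. measure M (C i \<inter> A i) / measure M (C i))"
      using A C by (subst (1 2) P.prob_times) (auto simp: prod_dividef)
    also have "\<dots> = (\<Prod>i\<in>I. ennreal (measure M (C i \<inter> A i) / measure M (C i)))"
      by (intro prod_ennreal[symmetric]) auto
    also have "\<dots> = (\<Prod>i\<in>I. emeasure (uniform_measure M (C i)) (A i))"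
      using A C by (intro prod.cong refl) (simp add: emeasure_uniform_measure M.emeasure_eq_measure divide_ennreal)
    finally show "emeasure (uniform_measure (PiM I (\<lambda>_. M)) (PiE I C)) (PiE I A) = \<dots>" .
  qed
qed

text \<open>Conditioning on a box of positive measure keeps null sets null. Statements almost
  everywhere on powers of \<open>M\<close> thus carry over to points chosen in prescribed
  cells.\<close>

lemma AE_PiM_uniform_restrict:
  assumes V: "finite V" "I \<subseteq> V" and M: "prob_space M" and C: "\<And>i. C i \<in> sets M" "\<And>i. measure M (C i) > 0"
    and Q: "AE x in PiM I (\<lambda>_. M). Q x"
  shows "AE x in PiM V (\<lambda>i. uniform_measure M (C i)). Q (restrict x I)"
proof -
  interpret M: prob_space M by (rule M)
  have I: "finite I" using V finite_subset by blast
  have N: "prob_space (uniform_measure M (C i))" for i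
    by (rule prob_space_uniform[OF M C(2)])
  interpret N: product_prob_space "\<lambda>i. uniform_measure M (C i)" V by (intro product_prob_spaceI N)
  have "AE x in PiM I (\<lambda>i. uniform_measure M (C i)). Q x"
    unfolding uniform_measure_PiM[OF I M C]
    by (rule AE_uniform_measureI) (use I C Q in \<open>auto intro!: sets_PiM_I_finite\<close>)
  then have "AE x in distr (PiM V (\<lambda>i. uniform_measure M (C i))) (PiM I (\<lambda>i. uniform_measure M (C i))) (\<lambda>x. restrict x I). Q x"
    by (subst N.distr_PiM_restrict_finite[OF I V(2)])
  then show ?thesis by (rule AE_distrD[rotated]) (rule measurable_restrict_subset[OF V(2)])
qed

lemma uniform_measure_pair:
  assumes M: "prob_space M" and C: "C \<in> sets M" "measure M C > 0" "C' \<in> sets M" "measure M C' > 0"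
  shows "uniform_measure M C \<Otimes>\<^sub>M uniform_measure M C' = uniform_measure (M \<Otimes>\<^sub>M M) (C \<times> C')"
proof -
  interpret M: prob_space M by (rule M)
  interpret PP: pair_prob_space M M ..
  have N: "prob_space (uniform_measure M C)" "prob_space (uniform_measure M C')"
    by (rule prob_space_uniform[OF M C(2)], rule prob_space_uniform[OF M C(4)])
  show ?thesis
  proof (rule pair_measure_eqI)
    show "sigma_finite_measure (uniform_measure M C)" "sigma_finite_measure (uniform_measure M C')"
      using N by (auto intro: prob_space_imp_sigma_finite)
    show "sets (uniform_measure M C \<Otimes>\<^sub>M uniform_measure M C') = sets (uniform_measure (M \<Otimes>\<^sub>M M) (C \<times> C'))"
      by (simp cong: sets_pair_measure_cong)
    fix A B assume "A \<in> sets (uniform_measure M C)" "B \<in> sets (uniform_measure M C')"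
    then have AB: "A \<in> sets M" "B \<in> sets M" by auto
    have "emeasure (uniform_measure (M \<Otimes>\<^sub>M M) (C \<times> C')) (A \<times> B)
      = emeasure M (C \<inter> A) * emeasure M (C' \<inter> B) / (emeasure M C * emeasure M C')"
      using AB C by (subst emeasure_uniform_measure) (auto simp: Times_Int_Times M.emeasure_pair_measure_Times)
    also have "\<dots> = ennreal ((measure M (C \<inter> A) / measure M C) * (measure M (C' \<inter> B) / measure M C'))"
      using C by (simp add: M.emeasure_eq_measure divide_ennreal flip: ennreal_mult)
    also have "\<dots> = ennreal (measure M (C \<inter> A) / measure M C) * ennreal (measure M (C' \<inter> B) / measure M C')"
      by (intro ennreal_mult) auto
    also have "\<dots> = emeasure (uniform_measure M C) A * emeasure (uniform_measure M C') B"
      using AB C by (simp add: emeasure_uniform_measure M.emeasure_eq_measure divide_ennreal)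
    finally show "emeasure (uniform_measure M C) A * emeasure (uniform_measure M C') B
      = emeasure (uniform_measure (M \<Otimes>\<^sub>M M) (C \<times> C')) (A \<times> B)" ..
  qed
qed

lemma prob_PiM_uniform_pair:
  assumes ab: "a \<in> V" "b \<in> V" "a \<noteq> b" and M: "prob_space M"
    and C: "\<And>i. C i \<in> sets M" "\<And>i. measure M (C i) > 0" and S: "S \<in> sets (M \<Otimes>\<^sub>M M)"
  shows "(\<integral>x. (indicator S (x a, x b) :: real) \<partial>PiM V (\<lambda>i. uniform_measure M (C i)))
    = measure (M \<Otimes>\<^sub>M M) ((C a \<times> C b) \<inter> S) / (measure M (C a) * measure M (C b))"
proof -
  interpret M: prob_space M by (rule M)
  interpret PP: pair_prob_space M M ..
  let ?N = "\<lambda>i. uniform_measure M (C i)"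
  have N: "prob_space (?N i)" for i
    by (rule prob_space_uniform[OF M C(2)])
  have S': "S \<in> sets (?N a \<Otimes>\<^sub>M ?N b)" using S by (simp cong: sets_pair_measure_cong)
  have meas: "(\<lambda>x. (x a, x b)) \<in> PiM V ?N \<rightarrow>\<^sub>M ?N a \<Otimes>\<^sub>M ?N b" using ab by measurable
  have "(\<integral>x. (indicator S (x a, x b) :: real) \<partial>PiM V ?N) = (\<integral>p. (indicator S p :: real) \<partial>distr (PiM V ?N) (?N a \<Otimes>\<^sub>M ?N b) (\<lambda>x. (x a, x b)))"
    using S' by (intro integral_distr[symmetric] meas) auto
  also have "distr (PiM V ?N) (?N a \<Otimes>\<^sub>M ?N b) (\<lambda>x. (x a, x b)) = ?N a \<Otimes>\<^sub>M ?N b"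
    by (rule distr_PiM_pair[OF N ab])
  also have "?N a \<Otimes>\<^sub>M ?N b = uniform_measure (M \<Otimes>\<^sub>M M) (C a \<times> C b)" by (rule uniform_measure_pair[OF M C C])
  also have "(\<integral>p. (indicator S p :: real) \<partial>\<dots>) = measure (uniform_measure (M \<Otimes>\<^sub>M M) (C a \<times> C b)) S"
    using S by simp
  also have "\<dots> = measure (M \<Otimes>\<^sub>M M) ((C a \<times> C b) \<inter> S) / measure (M \<Otimes>\<^sub>M M) (C a \<times> C b)"
    using C S by (intro measure_uniform_measure) (auto simp: M.emeasure_pair_measure_Times M.emeasure_eq_measure ennreal_mult_eq_top_iff less_le)
  also have "measure (M \<Otimes>\<^sub>M M) (C a \<times> C b) = measure M (C a) * measure M (C b)"
    using C by (simp only: measure_def M.emeasure_pair_measure_Times enn2real_mult)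
  finally show ?thesis .
qed

lemma prob_PiM_uniform_component:
  assumes a: "a \<in> V" and M: "prob_space M"
    and C: "\<And>i. C i \<in> sets M" "\<And>i. measure M (C i) > 0" and S: "S \<in> sets M"
  shows "(\<integral>x. (indicator S (x a) :: real) \<partial>PiM V (\<lambda>i. uniform_measure M (C i))) = measure M (C a \<inter> S) / measure M (C a)"
proof -
  interpret M: prob_space M by (rule M)
  let ?N = "\<lambda>i. uniform_measure M (C i)"
  have N: "prob_space (?N i)" for i
    by (rule prob_space_uniform[OF M C(2)])
  interpret N: product_prob_space ?N V by (intro product_prob_spaceI N)
  have "(\<integral>x. (indicator S (x a) :: real) \<partial>PiM V ?N) = (\<integral>y. (indicator S y :: real) \<partial>distr (PiM V ?N) (?N a) (\<lambda>x. x a))"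
    using S a by (intro integral_distr[symmetric]) auto
  also have "\<dots> = measure (?N a) S" using S N.PiM_component[OF a] by simp
  also have "\<dots> = measure M (C a \<inter> S) / measure M (C a)"
    using C(1) S C(2)[of a] by (intro measure_uniform_measure) (auto simp: M.emeasure_eq_measure)
  finally show ?thesis .
qed

section \<open>Random repair\<close>

context weighted_set begin

lemma sum_by_class:
  assumes "\<And>v. v \<in> V \<Longrightarrow> c v < N"
  shows "(\<Sum>v\<in>V. d v * g (c v)) = (\<Sum>i<N. mass c i * g i)"
proof -
  have "(\<Sum>v\<in>V. d v * g (c v)) = (\<Sum>i<N. \<Sum>v | v \<in> V \<and> c v = i. d v * g (c v))"
    using assms fin by (intro sum.group[symmetric]) auto
  also have "\<dots> = (\<Sum>i<N. mass c i * g i)"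
    by (intro sum.cong refl) (auto simp: mass_def sum_distrib_right)
  finally show ?thesis .
qed

lemma sum_by_class2:
  assumes "\<And>v. v \<in> V \<Longrightarrow> c v < N"
  shows "(\<Sum>v\<in>V. \<Sum>w\<in>V. d v * d w * (A v w * g (c v) (c w))) = (\<Sum>i<N. \<Sum>j<N. emass A c i j * g i j)"
proof -
  have "(\<Sum>v\<in>V. \<Sum>w\<in>V. d v * d w * (A v w * g (c v) (c w)))
    = (\<Sum>v\<in>V. \<Sum>j<N. \<Sum>w | w \<in> V \<and> c w = j. d v * d w * (A v w * g (c v) (c w)))"
  proof (rule sum.cong[OF refl])
    fix v
    show "(\<Sum>w\<in>V. d v * d w * (A v w * g (c v) (c w)))
      = (\<Sum>j<N. \<Sum>w | w \<in> V \<and> c w = j. d v * d w * (A v w * g (c v) (c w)))"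
      using assms by (intro sum.group[symmetric] fin) auto
  qed
  also have "\<dots> = (\<Sum>i<N. \<Sum>v | v \<in> V \<and> c v = i. \<Sum>j<N. \<Sum>w | w \<in> V \<and> c w = j. d v * d w * (A v w * g (c v) (c w)))"
    using assms by (intro sum.group[symmetric] fin) auto
  also have "\<dots> = (\<Sum>i<N. \<Sum>j<N. \<Sum>v | v \<in> V \<and> c v = i. \<Sum>w | w \<in> V \<and> c w = j. d v * d w * (A v w * g (c v) (c w)))"
    by (rule sum.cong[OF refl], rule sum.swap)
  also have "\<dots> = (\<Sum>i<N. \<Sum>j<N. \<Sum>w | w \<in> V \<and> c w = j. \<Sum>v | v \<in> V \<and> c v = i. d v * d w * (A v w * g (c v) (c w)))"
    by (rule sum.cong[OF refl], rule sum.cong[OF refl], rule sum.swap)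
  also have "\<dots> = (\<Sum>i<N. \<Sum>j<N. emass A c i j * g i j)"
    unfolding emass_def sum_distrib_right
  proof (intro sum.cong refl)
    fix i j w v assume "w \<in> {w. w \<in> V \<and> c w = j}" "v \<in> {v. v \<in> V \<and> c v = i}"
    then show "d v * d w * (A v w * g (c v) (c w)) = d w * d v * A v w * g i j" by simp
  qed
  finally show ?thesis .
qed

end

section \<open>Random placement of a graph in its limit, and the expected cost\<close>

locale graph_limit =
  coded_limit "\<lambda>n. verts (G n)" "\<lambda>n. pmf (D n)" "\<lambda>n. adj (G n)" c \<mu> e + limit_kernel \<mu> e M \<kappa> ms
  for G :: "nat \<Rightarrow> 'a ugraph" and D c \<mu> e M \<kappa> ms +
  fixes P :: "'a ugraph set"
  assumes P_property: "graph_property P" and P_ext: "extendable P" and weighted: "\<And>n. weighted_graph (G n) (D n)"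
    and hom_0: "\<And>F R. is_graph F \<Longrightarrow> F \<notin> P \<Longrightarrow> orientation (verts F) R \<Longrightarrow>
      (\<lambda>n. weighted_set.hom (verts (G n)) (pmf (D n)) (verts F) R (\<lambda>q. adj (G n) ({fst q, snd q} \<in> edges F))) \<longlonglongrightarrow> 0"
begin

lemma AE_F_excluded:
  assumes F: "is_graph F" "F \<notin> P" and R: "orientation (verts F) R"
  shows "AE x in PiM (verts F) (\<lambda>_. M). \<exists>q\<in>R. WL ({fst q, snd q} \<in> edges F) (x (fst q)) (x (snd q)) = 0"
proof -
  have I: "finite (verts F)" "R \<subseteq> verts F \<times> verts F" using F R by (auto simp: is_graph_def orientation_def)
  have R2: "(b, a) \<notin> R" if "(a, b) \<in> R" for a b using R that unfolding orientation_def by blast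
  have R1: "(a, a) \<notin> R" for a using R2[of a a] by blast
  show ?thesis
    by (intro AE_prod_WL_0[where c = "\<lambda>q. {fst q, snd q} \<in> edges F"] I R1 step_hom_tendsto_0 R2 hom_0 F R)
qed

definition late where "late m = (\<Union>k\<in>{m..}. At k)"

lemma late_sets [measurable]: "late m \<in> sets M" unfolding late_def by auto

text \<open>A bound for the expected cost of placing \<open>G n\<close> at level \<open>m\<close>:
  the vertices in cells that vanish in the limit, those expected to land in late blocks, and the
  pairs expected to change colour. For fixed \<open>m\<close> it involves \<open>n\<close> only
  through finitely many masses, so it converges.\<close>

definition cost_bound :: "nat \<Rightarrow> nat \<Rightarrow> real" where
  "cost_bound m n = 2 * ((\<Sum>i<4 ^ m. cd.mass n (c n m) i * (if \<mu> m i = 0 then 1 else 0))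
      + (\<Sum>i<4 ^ m. cd.mass n (c n m) i * (measure M (cell m i \<inter> late m) / \<mu> m i)))
    + (\<Sum>b\<in>UNIV. \<Sum>i<4 ^ m. \<Sum>j<4 ^ m. cd.emass n (adj (G n) b) (c n m) i j *
        (measure MM ((cell m i \<times> cell m j) \<inter> Z b) / (\<mu> m i * \<mu> m j)))"

lemma cost_bound_tendsto:
  "(\<lambda>n. cost_bound m n) \<longlonglongrightarrow> 2 * measure M (late m)
    + (\<Sum>b\<in>UNIV. \<integral>p. Wp b m p * indicator (Z b) p \<partial>MM)"
proof -
  have "(\<lambda>n. cost_bound m n) \<longlonglongrightarrow> 2 * ((\<Sum>i<4 ^ m. \<mu> m i * (if \<mu> m i = 0 then 1 else 0))
      + (\<Sum>i<4 ^ m. \<mu> m i * (measure M (cell m i \<inter> late m) / \<mu> m i)))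
    + (\<Sum>b\<in>UNIV. \<Sum>i<4 ^ m. \<Sum>j<4 ^ m. e b m i j *
        (measure MM ((cell m i \<times> cell m j) \<inter> Z b) / (\<mu> m i * \<mu> m j)))"
    unfolding cost_bound_def by (intro tendsto_add tendsto_mult tendsto_sum tendsto_const lim_mu lim_e)
  moreover have "(\<Sum>i<4 ^ m. \<mu> m i * (if \<mu> m i = 0 then 1 else 0)) = 0" by (intro sum.neutral) auto
  moreover have "(\<Sum>i<4 ^ m. \<mu> m i * (measure M (cell m i \<inter> late m) / \<mu> m i)) = measure M (late m)"
  proof -
    \<comment> \<open>On a cell of measure 0 the quotient defaults to 0, and the right side is 0
      too.\<close>
    have "\<mu> m i * (measure M (cell m i \<inter> late m) / \<mu> m i) = measure M (cell m i \<inter> late m)" for i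
    proof (cases "\<mu> m i = 0")
      case True
      have "measure M (cell m i \<inter> late m) \<le> measure M (cell m i)" by (intro finite_measure_mono) auto
      then show ?thesis using True by (simp add: measure_cell order_antisym)
    qed simp
    then have "(\<Sum>i<4 ^ m. \<mu> m i * (measure M (cell m i \<inter> late m) / \<mu> m i)) = (\<Sum>i<4 ^ m. measure M (cell m i \<inter> late m))"
      by simp
    also have "\<dots> = measure M (\<Union>i<4 ^ m. cell m i \<inter> late m)"
      by (intro finite_measure_finite_Union[symmetric]) (auto simp: disjoint_family_on_def cell_def)
    also have "(\<Union>i<4 ^ m. cell m i \<inter> late m) = late m"
    proof -
      have "late m \<subseteq> space M" by (rule sets.sets_into_space) simp
      then show ?thesis using \<kappa>_less by (auto simp: cell_def)
    qed
    finally show ?thesis .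
  qed
  moreover have "(\<Sum>i<4 ^ m. \<Sum>j<4 ^ m. e b m i j * (measure MM ((cell m i \<times> cell m j) \<inter> Z b) / (\<mu> m i * \<mu> m j)))
    = (\<integral>p. Wp b m p * indicator (Z b) p \<partial>MM)" for b
  proof -
    have "integrable MM (indicator (Z b) :: _ \<Rightarrow> real)" by (intro integrable_bounded[where B = 1]) (auto simp: indicator_def)
    from integral_step_mult[OF this, of "\<lambda>i j. e b m i j / (\<mu> m i * \<mu> m j)" m]
    have *: "(\<integral>p. Wp b m p * indicator (Z b) p \<partial>MM)
      = (\<Sum>i<4 ^ m. \<Sum>j<4 ^ m. e b m i j / (\<mu> m i * \<mu> m j) * (\<integral>p. indicator (cell m i \<times> cell m j) p * indicator (Z b) p \<partial>MM))"
      unfolding W_def .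
    have ind: "(\<integral>p. indicator (cell m i \<times> cell m j) p * indicator (Z b) p \<partial>MM) = measure MM ((cell m i \<times> cell m j) \<inter> Z b)" for i j
    proof -
      have "(\<integral>p. indicator (cell m i \<times> cell m j) p * indicator (Z b) p \<partial>MM) = (\<integral>p. (indicator ((cell m i \<times> cell m j) \<inter> Z b) p :: real) \<partial>MM)"
        by (simp only: indicator_inter_arith)
      also have "\<dots> = measure MM ((cell m i \<times> cell m j) \<inter> Z b)" by simp
      finally show ?thesis .
    qed
    show ?thesis unfolding * ind by (simp only: times_divide_eq_left times_divide_eq_right)
  qed
  ultimately show ?thesis by simp
qed

text \<open>The level is chosen first, far enough along \<open>ms\<close> that the limit of the
  bound is below \<epsilon>; then \<open>n\<close> is taken large for this level.\<close>

lemma exists_small_cost_bound: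
  assumes "\<epsilon> > 0"
  obtains m n where "cost_bound m n < \<epsilon>"
proof -
  have "(\<lambda>k. 2 * measure M (late (ms k)) + (\<Sum>b\<in>UNIV. \<integral>p. Wp b (ms k) p * indicator (Z b) p \<partial>MM)) \<longlonglongrightarrow> 2 * 0 + (\<Sum>b\<in>(UNIV :: bool set). 0)"
    using LIMSEQ_subseq_LIMSEQ[OF late_atoms_small ms]
    by (intro tendsto_add tendsto_mult tendsto_sum tendsto_const integral_W_Z) (simp add: comp_def late_def)
  then have "\<forall>\<^sub>F k in sequentially. 2 * measure M (late (ms k)) + (\<Sum>b\<in>UNIV. \<integral>p. Wp b (ms k) p * indicator (Z b) p \<partial>MM) < \<epsilon>"
    using assms by (intro order_tendstoD(2)) auto
  then obtain k where "2 * measure M (late (ms k)) + (\<Sum>b\<in>UNIV. \<integral>p. Wp b (ms k) p * indicator (Z b) p \<partial>MM) < \<epsilon>"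
    using eventually_happens'[OF sequentially_bot] by blast
  from order_tendstoD(2)[OF cost_bound_tendsto this] obtain n where "cost_bound (ms k) n < \<epsilon>"
    using eventually_happens'[OF sequentially_bot] by blast
  then show ?thesis by (rule that)
qed

context
  fixes m n :: nat
begin

abbreviation "V \<equiv> verts (G n)"
abbreviation "dd \<equiv> pmf (D n)"
abbreviation "code \<equiv> c n m"

definition V0 where "V0 = {v \<in> V. \<mu> m (code v) > 0}"
text \<open>The default \<open>space M\<close> makes every \<open>C v\<close> a set of positive
  measure, so that the lemmas on uniform measures apply to all indices.\<close>

definition C where "C v = (if v \<in> V0 then cell m (code v) else space M)"
definition \<Omega> where "\<Omega> = PiM V0 (\<lambda>v. uniform_measure M (C v))"
definition AT where "AT = (\<Union>k. At k)"
text \<open>An early cell contains a single vertex, which may safely occupy its block. Any other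
  vertex whose point falls into a block might share it, and is dropped.\<close>

definition kept where "kept x = {v \<in> V0. early m (code v) \<or> x v \<notin> AT}"
abbreviation flip_cost where
  "flip_cost b v w x \<equiv> dd v * dd w * (adj (G n) b v w * indicator (Z b) (x v, x w))"
abbreviation drop_cost where
  "drop_cost v x \<equiv> dd v * (if early m (code v) then 0 else indicator AT (x v))"
definition cost where
  "cost x = 2 * ((\<Sum>v\<in>V - V0. dd v) + (\<Sum>v\<in>V0. drop_cost v x))
    + (\<Sum>v\<in>V0. \<Sum>w\<in>V0. \<Sum>b\<in>UNIV. flip_cost b v w x)"

abbreviation "colours_available x \<equiv> \<forall>v\<in>V0. \<forall>w\<in>V0. v \<noteq> w \<longrightarrow>
    same_atom (x v) (x w) \<or> WL True (x v) (x w) + WL False (x v) (x w) = 1"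
text \<open>Both the kept vertices and the repaired graph depend on \<open>x\<close>, so all
  labelled graphs on subsets of \<open>V0\<close> are covered in advance. They are finitely
  many.\<close>

abbreviation "avoids_forbidden R x \<equiv> \<forall>I\<in>Pow V0. \<forall>E\<in>Pow (Pow V0). is_graph \<lparr>verts = I, edges = E\<rparr> \<longrightarrow> \<lparr>verts = I, edges = E\<rparr> \<notin> P \<longrightarrow>
    (\<exists>q\<in>R I. WL ({fst q, snd q} \<in> E) (x (fst q)) (x (snd q)) = 0)"

lemma V0_subset: "V0 \<subseteq> V" and finite_V0: "finite V0"
  using cd.fin[of n] by (auto simp: V0_def)

lemma C_sets: "C v \<in> sets M" by (simp add: C_def)

lemma C_pos: "measure M (C v) > 0"
  by (simp add: C_def V0_def measure_cell prob_space)

lemma AT_sets [measurable]: "AT \<in> sets M" unfolding AT_def by auto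

lemma prob_\<Omega>: "prob_space \<Omega>"
  unfolding \<Omega>_def by (intro prob_space_PiM prob_space_uniform prob C_pos)

lemma AE_C: "AE x in \<Omega>. \<forall>v\<in>V0. x v \<in> C v"
proof (rule AE_finite_allI[OF finite_V0])
  fix v assume v: "v \<in> V0"
  have "AE y in uniform_measure M (C v). y \<in> C v"
    by (rule AE_uniform_measureI) (use C_sets in auto)
  moreover have "prob_space (uniform_measure M (C i))" for i
    by (intro prob_space_uniform prob C_pos)
  ultimately show "AE x in \<Omega>. x v \<in> C v"
    unfolding \<Omega>_def using v by (intro AE_PiM_component) auto
qed

lemma AE_pairs: "AE x in \<Omega>. colours_available x"
proof (intro AE_finite_allI[OF finite_V0])
  fix v w assume vw: "v \<in> V0" "w \<in> V0"
  let ?Q = "\<lambda>y z. same_atom y z \<or> WL True y z + WL False y z = 1"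
  show "AE x in \<Omega>. v \<noteq> w \<longrightarrow> ?Q (x v) (x w)"
  proof (cases "v = w")
    case False
    have "AE x in PiM {v, w} (\<lambda>_. M). ?Q (x v) (x w)"
      by (rule AE_PiM_pair[OF _ _ False WL_sum_1]) auto
    from AE_PiM_uniform_restrict[OF finite_V0 _ prob C_sets C_pos this]
    show ?thesis unfolding \<Omega>_def using vw by simp
  qed simp
qed

lemma AE_in_P:
  assumes or: "\<forall>I. finite I \<longrightarrow> orientation I (R I)"
  shows "AE x in \<Omega>. avoids_forbidden R x"
proof (intro AE_finite_allI finite_V0 finite_Pow_iff[THEN iffD2])
  fix I E assume I: "I \<in> Pow V0"
  let ?F = "\<lparr>verts = I, edges = E\<rparr>"
  show "AE x in \<Omega>. is_graph ?F \<longrightarrow> ?F \<notin> P \<longrightarrow> (\<exists>q\<in>R I. WL ({fst q, snd q} \<in> E) (x (fst q)) (x (snd q)) = 0)"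
  proof (cases "is_graph ?F \<and> ?F \<notin> P")
    case True
    have oI: "orientation I (R I)" using I finite_V0 finite_subset by (intro or[rule_format]) auto
    have "AE x in PiM I (\<lambda>_. M). \<exists>q\<in>R I. WL ({fst q, snd q} \<in> E) (x (fst q)) (x (snd q)) = 0"
      by (rule AE_F_excluded[of ?F "R I", unfolded ugraph.select_convs]) (use True oI in auto)
    from AE_PiM_uniform_restrict[OF finite_V0 _ prob C_sets C_pos this]
    have "AE x in \<Omega>. \<exists>q\<in>R I. WL ({fst q, snd q} \<in> E) (restrict x I (fst q)) (restrict x I (snd q)) = 0"
      unfolding \<Omega>_def using I by simp
    then show ?thesis
    proof eventually_elim
      case (elim x)
      then obtain q where q: "q \<in> R I" "WL ({fst q, snd q} \<in> E) (restrict x I (fst q)) (restrict x I (snd q)) = 0" by blast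
      have "fst q \<in> I" "snd q \<in> I" using oI q(1) by (auto simp: orientation_def)
      then show ?case using q by auto
    qed
  qed auto
qed

text \<open>A kept vertex whose point lies in \<open>At k\<close> is in an early cell, singled out
  at some level below \<open>m\<close>. Its point lies in that block as well, and since blocks are
  disjoint the level is that of \<open>k\<close>. Only one vertex is singled out there.\<close>

lemma kept_same_atom:
  assumes x: "\<And>v. v \<in> V0 \<Longrightarrow> x v \<in> C v" and ab: "a \<in> kept x" "b \<in> kept x" "same_atom (x a) (x b)"
  shows "a = b"
proof -
  obtain k where k: "x a \<in> At k" "x b \<in> At k" using ab(3) by (auto simp: same_atom_def)
  have *: "atom (c n (Suc k) v)" if v: "v \<in> kept x" "x v \<in> At k" for v
  proof -
    have "x v \<in> AT" using v(2) by (auto simp: AT_def)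
    then have v0: "v \<in> V0" "early m (code v)" using v(1) by (auto simp: kept_def)
    then obtain l where l: "l < m" "atom (c n (Suc l) v)" using cd.early_code[of m n v] by auto
    have xv: "x v \<in> space M" "\<kappa> m (x v) = code v" using x[OF v0(1)] v0(1) by (auto simp: C_def cell_def)
    have "\<kappa> (Suc l) (x v) = c n (Suc l) v"
      using \<kappa>_chain[OF xv(1), of "Suc l" m] cd.c_chain[of "Suc l" m n v] l xv(2) by simp
    then have "x v \<in> At l" using l xv by (simp add: At_def)
    then have "l = k" using v(2) At_disjoint[of k l] At_disjoint[of l k] by (cases k l rule: linorder_cases) auto
    then show ?thesis using l by simp
  qed
  show ?thesis using *[OF ab(1) k(1)] *[OF ab(2) k(2)] by (rule cd.c_unique)
qed

text \<open>\<open>repair\<close> applies with the colours of nonzero limit density as the allowed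
  ones: a graph on \<open>kept x\<close> using only such colours cannot be forbidden, and kept pairs
  lie in no common block, so some colour is available.\<close>

lemma small_cost_imp_not_far:
  assumes x: "\<And>v. v \<in> V0 \<Longrightarrow> x v \<in> C v"
    and pairs: "colours_available x"
    and or: "\<forall>I. finite I \<longrightarrow> orientation I (R I)"
    and inP: "avoids_forbidden R x"
    and cost: "cost x < \<epsilon>" and \<epsilon>: "\<epsilon> < 1"
  shows "\<not> eps_far \<epsilon> (G n) (D n) P"
proof (rule repair[OF P_property P_ext weighted, where V' = "kept x" and ok = "\<lambda>b v w. WL b (x v) (x w) \<noteq> 0"])
  have kV0: "kept x \<subseteq> V0" by (auto simp: kept_def)
  then show kV: "kept x \<subseteq> V" using V0_subset by auto
  show "WL b (x v) (x w) \<noteq> 0 \<longleftrightarrow> WL b (x w) (x v) \<noteq> 0" for b v w using WL_sym[of b "x v" "x w"] by simp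
  show "F \<in> P" if F: "is_graph F" "verts F = kept x"
    and ok: "\<And>a b. a \<in> kept x \<Longrightarrow> b \<in> kept x \<Longrightarrow> a \<noteq> b \<Longrightarrow> WL ({a, b} \<in> edges F) (x a) (x b) \<noteq> 0" for F
  proof (rule ccontr)
    assume notP: "F \<notin> P"
    have Feq: "F = \<lparr>verts = kept x, edges = edges F\<rparr>" using F(2) by (cases F) auto
    have "edges F \<in> Pow (Pow V0)" using F kV0 unfolding is_graph_def nsets_def by auto
    then have "\<exists>q\<in>R (kept x). WL ({fst q, snd q} \<in> edges F) (x (fst q)) (x (snd q)) = 0"
      using inP kV0 F notP Feq by (metis PowI)
    then obtain q where q: "q \<in> R (kept x)" "WL ({fst q, snd q} \<in> edges F) (x (fst q)) (x (snd q)) = 0" by blast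
    have "orientation (kept x) (R (kept x))" using kV0 finite_V0 finite_subset by (intro or[rule_format]) blast
    then have "fst q \<in> kept x" "snd q \<in> kept x" "fst q \<noteq> snd q"
      using q(1) unfolding orientation_def by (auto, metis prod.collapse)
    then show False using ok q(2) by blast
  qed
  show "WL True (x a) (x b) \<noteq> 0 \<or> WL False (x a) (x b) \<noteq> 0" if "a \<in> kept x" "b \<in> kept x" "a \<noteq> b" for a b
    using kept_same_atom[OF x, of a b] that pairs kV0 by fastforce
  show "\<epsilon> < 1" by (rule \<epsilon>)
  have "(\<Sum>v\<in>V - kept x. dd v) = (\<Sum>v\<in>V - V0. dd v) + (\<Sum>v\<in>V0 - kept x. dd v)"
  proof -
    have "V - kept x = (V - V0) \<union> (V0 - kept x)" using kV0 V0_subset by auto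
    then show ?thesis using cd.fin[of n] finite_V0 by (simp only:) (intro sum.union_disjoint; auto)
  qed
  also have "(\<Sum>v\<in>V0 - kept x. dd v) = (\<Sum>v\<in>V0. drop_cost v x)"
    using finite_V0 by (intro sum.mono_neutral_cong_left) (auto simp: kept_def)
  finally have 1: "(\<Sum>v\<in>V - kept x. dd v)
    = (\<Sum>v\<in>V - V0. dd v) + (\<Sum>v\<in>V0. drop_cost v x)" .
  have xM: "x v \<in> space M" if "v \<in> V0" for v using x[OF that] sets.sets_into_space[OF C_sets, of v] by auto
  have "(\<Sum>v\<in>kept x. \<Sum>w\<in>kept x. \<Sum>b\<in>UNIV. dd v * dd w * (adj (G n) b v w * (if WL b (x v) (x w) \<noteq> 0 then 0 else 1)))
    = (\<Sum>v\<in>kept x. \<Sum>w\<in>kept x. \<Sum>b\<in>UNIV. flip_cost b v w x)"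
    using xM kV0 by (intro sum.cong refl arg_cong2[where f = "(*)"]) (auto simp: Z_def indicator_def space_pair_measure)
  also have "\<dots> \<le> (\<Sum>v\<in>V0. \<Sum>w\<in>V0. \<Sum>b\<in>UNIV. flip_cost b v w x)"
  proof -
    have nn: "0 \<le> (\<Sum>b\<in>UNIV. flip_cost b v w x)" for v w
      by (intro sum_nonneg) (auto simp: adj_def)
    have "(\<Sum>v\<in>kept x. \<Sum>w\<in>kept x. \<Sum>b\<in>UNIV. flip_cost b v w x)
      \<le> (\<Sum>v\<in>kept x. \<Sum>w\<in>V0. \<Sum>b\<in>UNIV. flip_cost b v w x)"
      using nn by (intro sum_mono sum_mono2 finite_V0 kV0)
    also have "\<dots> \<le> (\<Sum>v\<in>V0. \<Sum>w\<in>V0. \<Sum>b\<in>UNIV. flip_cost b v w x)"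
      by (intro sum_mono2 finite_V0 kV0) (rule sum_nonneg, rule nn)
    finally show ?thesis .
  qed
  finally show "2 * (\<Sum>v\<in>V - kept x. dd v) + (\<Sum>v\<in>kept x. \<Sum>w\<in>kept x. \<Sum>b\<in>UNIV.
      dd v * dd w * (adj (G n) b v w * (if WL b (x v) (x w) \<noteq> 0 then 0 else 1))) < \<epsilon>"
    using cost unfolding cost_def 1 by linarith
qed

lemma indicator_AT_integral:
  assumes "v \<in> V0"
  shows "integrable \<Omega> (\<lambda>x. indicator AT (x v) :: real)"
    "(\<integral>x. (indicator AT (x v) :: real) \<partial>\<Omega>) = measure M (cell m (code v) \<inter> AT) / \<mu> m (code v)"
proof -
  interpret O: prob_space \<Omega> by (rule prob_\<Omega>)
  have "(\<lambda>x. x v) \<in> \<Omega> \<rightarrow>\<^sub>M uniform_measure M (C v)" unfolding \<Omega>_def using assms by measurable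
  then have [measurable]: "(\<lambda>x. x v) \<in> \<Omega> \<rightarrow>\<^sub>M M" by (simp cong: measurable_cong_sets)
  show "integrable \<Omega> (\<lambda>x. indicator AT (x v) :: real)"
    by (intro O.integrable_const_bound[where B = 1]) (auto simp: indicator_def)
  show "(\<integral>x. (indicator AT (x v) :: real) \<partial>\<Omega>) = measure M (cell m (code v) \<inter> AT) / \<mu> m (code v)"
    unfolding \<Omega>_def prob_PiM_uniform_component[OF assms prob C_sets C_pos AT_sets]
    using assms by (simp add: C_def measure_cell)
qed

lemma indicator_Z_integral:
  assumes "v \<in> V0" "w \<in> V0"
  shows "integrable \<Omega> (\<lambda>x. indicator (Z b) (x v, x w) :: real)"
    "v \<noteq> w \<Longrightarrow> (\<integral>x. (indicator (Z b) (x v, x w) :: real) \<partial>\<Omega>)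
      = measure MM ((cell m (code v) \<times> cell m (code w)) \<inter> Z b) / (\<mu> m (code v) * \<mu> m (code w))"
proof -
  interpret O: prob_space \<Omega> by (rule prob_\<Omega>)
  have "(\<lambda>x. x v) \<in> \<Omega> \<rightarrow>\<^sub>M uniform_measure M (C v)" "(\<lambda>x. x w) \<in> \<Omega> \<rightarrow>\<^sub>M uniform_measure M (C w)"
    unfolding \<Omega>_def using assms by measurable
  then have [measurable]: "(\<lambda>x. x v) \<in> \<Omega> \<rightarrow>\<^sub>M M" "(\<lambda>x. x w) \<in> \<Omega> \<rightarrow>\<^sub>M M" by (simp_all cong: measurable_cong_sets)
  show "integrable \<Omega> (\<lambda>x. indicator (Z b) (x v, x w) :: real)"
    by (intro O.integrable_const_bound[where B = 1]) (auto simp: indicator_def)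
  show "(\<integral>x. (indicator (Z b) (x v, x w) :: real) \<partial>\<Omega>)
      = measure MM ((cell m (code v) \<times> cell m (code w)) \<inter> Z b) / (\<mu> m (code v) * \<mu> m (code w))" if "v \<noteq> w"
    unfolding \<Omega>_def prob_PiM_uniform_pair[OF assms that prob C_sets C_pos Z_sets]
    using assms by (simp add: C_def measure_cell)
qed

lemma cost_integral:
  shows cost_integrable: "integrable \<Omega> cost" and cost_le_bound: "(\<integral>x. cost x \<partial>\<Omega>) \<le> cost_bound m n"
proof -
  interpret O: prob_space \<Omega> by (rule prob_\<Omega>)
  let ?g = "\<lambda>v. if early m (code v) then 0 else measure M (cell m (code v) \<inter> AT) / \<mu> m (code v)"
  let ?h = "\<lambda>b i j. measure MM ((cell m i \<times> cell m j) \<inter> Z b) / (\<mu> m i * \<mu> m j)"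
  have i1: "integrable \<Omega> (\<lambda>x. drop_cost v x)" if "v \<in> V0" for v
    using indicator_AT_integral(1)[OF that] by (cases "early m (code v)") simp_all
  have i2: "integrable \<Omega> (\<lambda>x. flip_cost b v w x)" if "v \<in> V0" "w \<in> V0" for v w b
    using indicator_Z_integral(1)[OF that] by (intro integrable_mult_right)
  show int: "integrable \<Omega> cost"
    unfolding cost_def using i1 i2
    by (intro Bochner_Integration.integrable_add integrable_mult_right Bochner_Integration.integrable_sum O.integrable_const) auto
  have e1: "(\<integral>x. drop_cost v x \<partial>\<Omega>) = dd v * ?g v" if "v \<in> V0" for v
    using indicator_AT_integral(2)[OF that] by (cases "early m (code v)") simp_all
  \<comment> \<open>For \<open>v = w\<close> the two points coincide and are not independent, but
    then \<open>adj\<close> is 0.\<close>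
  have e2: "(\<integral>x. flip_cost b v w x \<partial>\<Omega>)
    = dd v * dd w * (adj (G n) b v w * ?h b (code v) (code w))" if "v \<in> V0" "w \<in> V0" for v w b
    using indicator_Z_integral(2)[OF that, of b] by (cases "v = w") (simp_all add: adj_def)
  have "(\<integral>x. cost x \<partial>\<Omega>) = 2 * ((\<Sum>v\<in>V - V0. dd v) + (\<Sum>v\<in>V0. dd v * ?g v))
    + (\<Sum>v\<in>V0. \<Sum>w\<in>V0. \<Sum>b\<in>UNIV. dd v * dd w * (adj (G n) b v w * ?h b (code v) (code w)))"
  proof -
    have "(\<integral>x. cost x \<partial>\<Omega>) = 2 * ((\<Sum>v\<in>V - V0. dd v) + (\<integral>x. (\<Sum>v\<in>V0. drop_cost v x) \<partial>\<Omega>))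
       + (\<integral>x. (\<Sum>v\<in>V0. \<Sum>w\<in>V0. \<Sum>b\<in>UNIV. flip_cost b v w x) \<partial>\<Omega>)"
      unfolding cost_def using i1 i2
      by (subst Bochner_Integration.integral_add; (subst integral_mult_right_zero)?; (subst Bochner_Integration.integral_add)?;
        (auto intro!: Bochner_Integration.integrable_add integrable_mult_right Bochner_Integration.integrable_sum O.integrable_const simp: O.prob_space)?)
    also have "(\<integral>x. (\<Sum>v\<in>V0. drop_cost v x) \<partial>\<Omega>) = (\<Sum>v\<in>V0. dd v * ?g v)"
    proof -
      have "(\<integral>x. (\<Sum>v\<in>V0. drop_cost v x) \<partial>\<Omega>)
        = (\<Sum>v\<in>V0. \<integral>x. drop_cost v x \<partial>\<Omega>)"
        using i1 by (intro Bochner_Integration.integral_sum)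
      also have "\<dots> = (\<Sum>v\<in>V0. dd v * ?g v)" using e1 by (intro sum.cong refl)
      finally show ?thesis .
    qed
    also have "(\<integral>x. (\<Sum>v\<in>V0. \<Sum>w\<in>V0. \<Sum>b\<in>UNIV. flip_cost b v w x) \<partial>\<Omega>)
       = (\<Sum>v\<in>V0. \<Sum>w\<in>V0. \<Sum>b\<in>UNIV. \<integral>x. flip_cost b v w x \<partial>\<Omega>)"
    proof -
      have "(\<integral>x. (\<Sum>v\<in>V0. \<Sum>w\<in>V0. \<Sum>b\<in>UNIV. flip_cost b v w x) \<partial>\<Omega>)
         = (\<Sum>v\<in>V0. \<integral>x. (\<Sum>w\<in>V0. \<Sum>b\<in>UNIV. flip_cost b v w x) \<partial>\<Omega>)"
        using i2 by (intro Bochner_Integration.integral_sum Bochner_Integration.integrable_sum)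
      also have "\<dots> = (\<Sum>v\<in>V0. \<Sum>w\<in>V0. \<integral>x. (\<Sum>b\<in>UNIV. flip_cost b v w x) \<partial>\<Omega>)"
        using i2 by (intro sum.cong refl Bochner_Integration.integral_sum Bochner_Integration.integrable_sum)
      also have "\<dots> = (\<Sum>v\<in>V0. \<Sum>w\<in>V0. \<Sum>b\<in>UNIV. \<integral>x. flip_cost b v w x \<partial>\<Omega>)"
        using i2 by (intro sum.cong refl Bochner_Integration.integral_sum)
      finally show ?thesis .
    qed
    also have "\<dots> = (\<Sum>v\<in>V0. \<Sum>w\<in>V0. \<Sum>b\<in>UNIV. dd v * dd w * (adj (G n) b v w * ?h b (code v) (code w)))"
      using e2 by (intro sum.cong refl)
    finally show ?thesis .
  qed
  also have "\<dots> \<le> cost_bound m n"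
    unfolding cost_bound_def
  proof (intro add_mono mult_left_mono)
    have less: "code v < 4 ^ m" for v by (rule cd.c_less)
    have "(\<Sum>v\<in>V - V0. dd v) = (\<Sum>v\<in>V. dd v * (if \<mu> m (code v) = 0 then 1 else 0))"
      using cd.fin[of n] mu_nonneg[of m]
      by (intro sum.mono_neutral_cong_left) (auto simp: V0_def less_le)
    also have "\<dots> = (\<Sum>i<4 ^ m. cd.mass n (c n m) i * (if \<mu> m i = 0 then 1 else 0))"
      using cd.sum_by_class[of n code "4 ^ m" "\<lambda>i. if \<mu> m i = 0 then 1 else 0"] less by simp
    finally show "(\<Sum>v\<in>V - V0. dd v) \<le> (\<Sum>i<4 ^ m. cd.mass n (c n m) i * (if \<mu> m i = 0 then 1 else 0))" by simp
    \<comment> \<open>In a cell that is not early, a point of some block can only lie in a late one,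
      because an earlier mark would be visible in the cell number.\<close>
    have g_le: "?g v \<le> measure M (cell m (code v) \<inter> late m) / \<mu> m (code v)" if v: "v \<in> V0" for v
    proof (cases "early m (code v)")
      case False
      have "cell m (code v) \<inter> AT \<subseteq> cell m (code v) \<inter> late m"
      proof
        fix y assume y: "y \<in> cell m (code v) \<inter> AT"
        then obtain k where k: "y \<in> At k" by (auto simp: AT_def)
        have "k \<ge> m"
        proof (rule ccontr)
          assume "\<not> m \<le> k"
          then have "\<kappa> (Suc k) y = \<kappa> m y div 4 ^ (m - Suc k)" using y \<kappa>_chain[of y "Suc k" m] by (auto simp: cell_def)
          then have "early m (code v)" using y k \<open>\<not> m \<le> k\<close> by (auto simp: early_def cell_def At_def intro!: exI[of _ k])
          then show False using False by simp
        qed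
        then show "y \<in> cell m (code v) \<inter> late m" using y k by (auto simp: late_def)
      qed
      then have "measure M (cell m (code v) \<inter> AT) \<le> measure M (cell m (code v) \<inter> late m)"
        by (intro finite_measure_mono) auto
      then show ?thesis using False mu_nonneg[of m "code v"] by (simp add: divide_right_mono)
    qed (simp add: mu_nonneg)
    have "(\<Sum>v\<in>V0. dd v * ?g v) \<le> (\<Sum>v\<in>V0. dd v * (measure M (cell m (code v) \<inter> late m) / \<mu> m (code v)))"
      using g_le by (intro sum_mono mult_left_mono) auto
    also have "\<dots> \<le> (\<Sum>v\<in>V. dd v * (measure M (cell m (code v) \<inter> late m) / \<mu> m (code v)))"
      using V0_subset cd.fin[of n] by (intro sum_mono2) (auto simp: mu_nonneg)
    also have "\<dots> = (\<Sum>i<4 ^ m. cd.mass n (c n m) i * (measure M (cell m i \<inter> late m) / \<mu> m i))"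
      using cd.sum_by_class[of n code "4 ^ m" "\<lambda>i. measure M (cell m i \<inter> late m) / \<mu> m i"] less by simp
    finally show "(\<Sum>v\<in>V0. dd v * ?g v) \<le> (\<Sum>i<4 ^ m. cd.mass n (c n m) i * (measure M (cell m i \<inter> late m) / \<mu> m i))" .
    let ?t = "\<lambda>v w. \<Sum>b\<in>UNIV. dd v * dd w * (adj (G n) b v w * ?h b (code v) (code w))"
    have t0: "0 \<le> ?t v w" for v w by (intro sum_nonneg) (auto simp: adj_def mu_nonneg)
    have "(\<Sum>v\<in>V0. \<Sum>w\<in>V0. ?t v w) \<le> (\<Sum>v\<in>V0. \<Sum>w\<in>V. ?t v w)"
      using t0 by (intro sum_mono sum_mono2 V0_subset cd.fin)
    also have "\<dots> \<le> (\<Sum>v\<in>V. \<Sum>w\<in>V. ?t v w)" by (intro sum_mono2 V0_subset cd.fin) (rule sum_nonneg, rule t0)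
    also have "\<dots> = (\<Sum>v\<in>V. \<Sum>b\<in>UNIV. \<Sum>w\<in>V. dd v * dd w * (adj (G n) b v w * ?h b (code v) (code w)))"
      by (rule sum.cong[OF refl], rule sum.swap)
    also have "\<dots> = (\<Sum>b\<in>UNIV. \<Sum>v\<in>V. \<Sum>w\<in>V. dd v * dd w * (adj (G n) b v w * ?h b (code v) (code w)))"
      by (rule sum.swap)
    also have "\<dots> = (\<Sum>b\<in>UNIV. \<Sum>i<4 ^ m. \<Sum>j<4 ^ m. cd.emass n (adj (G n) b) (c n m) i j * ?h b i j)"
      by (rule sum.cong[OF refl], rule cd.sum_by_class2) (rule less)
    finally show "(\<Sum>v\<in>V0. \<Sum>w\<in>V0. ?t v w)
      \<le> (\<Sum>b\<in>UNIV. \<Sum>i<4 ^ m. \<Sum>j<4 ^ m. cd.emass n (adj (G n) b) (c n m) i j * ?h b i j)" .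
  qed simp
  finally show "(\<integral>x. cost x \<partial>\<Omega>) \<le> cost_bound m n" .
qed

text \<open>First moment method: if the graph were far, almost every placement would cost at least
  \<epsilon>, and so would the average.\<close>

lemma cost_bound_imp_not_far:
  assumes "cost_bound m n < \<epsilon>" "\<epsilon> < 1"
  shows "\<not> eps_far \<epsilon> (G n) (D n) P"
proof
  assume far: "eps_far \<epsilon> (G n) (D n) P"
  interpret O: prob_space \<Omega> by (rule prob_\<Omega>)
  define R :: "'a set \<Rightarrow> ('a \<times> 'a) set" where "R I = (SOME R. orientation I R)" for I
  have or: "\<forall>I. finite I \<longrightarrow> orientation I (R I)"
    unfolding R_def using exists_orientation by (metis someI)
  have "AE x in \<Omega>. \<epsilon> \<le> cost x"
    using AE_C AE_pairs AE_in_P[OF or]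
  proof eventually_elim
    case (elim x)
    show ?case
    proof (rule ccontr)
      assume "\<not> \<epsilon> \<le> cost x"
      then have "\<not> eps_far \<epsilon> (G n) (D n) P"
        using small_cost_imp_not_far[of x R \<epsilon>] elim or assms(2) by auto
      then show False using far by simp
    qed
  qed
  then have "\<epsilon> \<le> (\<integral>x. cost x \<partial>\<Omega>)" by (intro O.integral_ge_const cost_integrable)
  then show False using cost_le_bound assms(1) by linarith
qed

end

lemma exists_not_far:
  assumes "0 < \<epsilon>" "\<epsilon> < 1"
  shows "\<exists>n. \<not> eps_far \<epsilon> (G n) (D n) P"
  using exists_small_cost_bound[OF assms(1)] cost_bound_imp_not_far[OF _ assms(2)] by metis

end

section \<open>The compactness argument\<close>

theorem theorem4:
  fixes P :: "'a::infinite ugraph set"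
  assumes "graph_property P" and "hereditary P" and "extendable P"
  shows "\<exists>s :: real \<Rightarrow> nat. \<forall>\<epsilon>\<in>{0<..<1}. s \<epsilon> \<ge> 1 \<and>
    (\<forall>G D. weighted_graph G D \<and> eps_far \<epsilon> G D P \<longrightarrow>
       measure_pmf.prob (iid_samples (s \<epsilon>) D)
         {u. induced_subgraph G (u ` {..<s \<epsilon>}) \<notin> P} \<ge> 2 / 3)"
proof (rule bchoice, rule ballI, rule ccontr)
  fix \<epsilon> :: real assume \<epsilon>: "\<epsilon> \<in> {0<..<1}"
  assume neg: "\<nexists>s :: nat. s \<ge> 1 \<and> (\<forall>G D. weighted_graph G D \<and> eps_far \<epsilon> G D P \<longrightarrow>
       measure_pmf.prob (iid_samples s D) {u. induced_subgraph G (u ` {..<s}) \<notin> P} \<ge> 2 / 3)"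
  \<comment> \<open>The counterexample number \<open>n\<close> is taken for sample size
    \<open>Suc n\<close>, since only positive sizes are refuted.\<close>
  have "\<exists>G D. weighted_graph G D \<and> eps_far \<epsilon> G D P \<and>
      measure_pmf.prob (iid_samples (Suc n) D) {u. induced_subgraph G (u ` {..<Suc n}) \<notin> P} < 2 / 3" for n
  proof (rule ccontr)
    assume no: "\<not> ?thesis"
    show False using neg
    proof (rule notE, intro exI[of _ "Suc n"] conjI allI impI)
      fix G D assume "weighted_graph G D \<and> eps_far \<epsilon> G D P"
      then show "measure_pmf.prob (iid_samples (Suc n) D) {u. induced_subgraph G (u ` {..<Suc n}) \<notin> P} \<ge> 2 / 3"
        using no by (meson not_le)
    qed simp
  qed
  then obtain G D where GD: "\<And>n. weighted_graph (G n) (D n)" "\<And>n. eps_far \<epsilon> (G n) (D n) P"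
    "\<And>n. measure_pmf.prob (iid_samples (Suc n) (D n)) {u. induced_subgraph (G n) (u ` {..<Suc n}) \<notin> P} < 2 / 3"
    by metis
  obtain r c \<mu> e where r: "strict_mono (r :: nat \<Rightarrow> nat)"
    and cl: "coded_limit (\<lambda>n. verts (G (r n))) (\<lambda>n. pmf (D (r n))) (\<lambda>n. adj (G (r n))) c \<mu> e"
    by (rule convergent_coded_subsequence[OF GD(1)])
  interpret coded_limit "\<lambda>n. verts (G (r n))" "\<lambda>n. pmf (D (r n))" "\<lambda>n. adj (G (r n))" c \<mu> e by (rule cl)
  show False
  proof (rule exists_space, rule limit_space.exists_convergent_subsequence)
    fix M :: "real measure" and \<kappa> assume M: "prob_space M" "\<And>m. \<kappa> m \<in> M \<rightarrow>\<^sub>M count_space UNIV"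
      "\<And>m i. measure M {x \<in> space M. \<kappa> m x = i} = \<mu> m i"
      "\<And>m x. x \<in> space M \<Longrightarrow> \<kappa> (Suc m) x div 4 = \<kappa> m x"
      "\<And>m x. x \<in> space M \<Longrightarrow> \<mu> m (\<kappa> m x) > 0"
    show "limit_space \<mu> e M \<kappa>"
      by (intro limit_space.intro limit_space_axioms.intro limit_data_axioms M)
    then interpret limit_space \<mu> e M \<kappa> .
    fix ms assume ms: "strict_mono ms" "\<And>b. AE p in MM. convergent (\<lambda>k. Wp b (ms k) p)"
    interpret limit_kernel \<mu> e M \<kappa> ms
      by (intro limit_kernel.intro limit_kernel_axioms.intro limit_space_axioms ms)
    interpret graph_limit "\<lambda>n. G (r n)" "\<lambda>n. D (r n)" c \<mu> e M \<kappa> ms P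
    proof (intro graph_limit.intro graph_limit_axioms.intro cl limit_kernel_axioms assms(1,3) GD(1))
      fix F R assume F: "is_graph F" "F \<notin> P" and R: "orientation (verts F) R"
      show "(\<lambda>n. cd.hom n (verts F) R (\<lambda>q. adj (G (r n)) ({fst q, snd q} \<in> edges F))) \<longlonglongrightarrow> 0" (is "?h \<longlonglongrightarrow> 0")
      proof (rule Lim_null_comparison)
        show "\<forall>\<^sub>F n in sequentially. norm (?h n) \<le> 3 * real (card (verts F)) * (1 / n)"
        proof (rule eventually_mono[OF eventually_gt_at_top[of 0]])
          fix n :: nat assume n: "n > 0"
          have h0: "0 \<le> ?h n"
            unfolding cd.hom_def by (intro sum_nonneg mult_nonneg_nonneg prod_nonneg) (auto simp: adj_def)
          \<comment> \<open>The bound is of order one over the sample size, and a subsequence only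
            makes the samples larger, so the densities still tend to 0.\<close>
          have "real n \<le> real (Suc (r n))" using strict_mono_imp_increasing[OF r, of n] by simp
          then have "?h n * real n \<le> ?h n * real (Suc (r n))" using h0 by (intro mult_left_mono)
          also have "\<dots> \<le> 3 * real (card (verts F))"
            by (rule hom_bound[OF assms(1,2) GD(1) F R GD(3)])
          finally have "?h n \<le> 3 * real (card (verts F)) * (1 / n)" using n by (simp add: field_simps)
          then show "norm (?h n) \<le> 3 * real (card (verts F)) * (1 / n)" using h0 by simp
        qed
        show "(\<lambda>n. 3 * real (card (verts F)) * (1 / real n)) \<longlonglongrightarrow> 0"
          using tendsto_mult[OF tendsto_const lim_1_over_n, of "3 * real (card (verts F))"] by simp
      qed
    qed
    show False using exists_not_far[of \<epsilon>] \<epsilon> GD(2) by auto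
  qed
qed

end
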